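(* Let $(\mathcal G,z)$ be a non-trivial flow-critical tame canvas. If $\deg(z)\ge 7$ and $\mathcal G$ contains a vertex of degree $\deg(z)-2$, then $C(\mathcal G,z)=\{\deg(z)-2\}$.
   Context: Graphs are finite, loopless, and may have parallel edges. A $\mathbb{Z}_3$-boundary of a graph $G$ is a map $\beta:V(G)\to\mathbb{Z}_3$ summing to $0$ over every component; $\mathcal G=(G,\beta)$ is a $\mathbb{Z}_3$-bordered graph. A nowhere-zero flow in $(G,\beta)$ is an orientation with $\deg^+(v)-\deg^-(v)\equiv\beta(v)\pmod 3$ for all $v$. For a vertex $v$, $|\tau(v)|$ is $0$ if $\deg(v)$ even and $\beta(v)=0$; $2$ if $\deg(v)$ even and $\beta(v)\ne0$; $3$ if $\deg(v)$ odd and $\beta(v)=0$; $1$ if $\deg(v)$ odd and $\beta(v)\neq 0$. For a partition $\mathcal P$ of $V(G)$, $\mathcal G/\mathcal P$ identifies each part into one vertex, deletes loops, and gives each new vertex the sum of $\beta$ over its part; $\mathcal P$ is non-trivial if some part has $\ge2$ vertices. A canvas $(\mathcal G,z)$ is a $\mathbb{Z}_3$-bordered graph with distinguished vertex $z$; non-trivial if it has at least three vertices. A tip preflow is an orientation $\psi$ of the edges at $z$ with (in $\psi$) $\deg^+(z)-\deg^-(z)\equiv\beta(z)\pmod 3$; it extends if some nowhere-zero flow agrees with it at $z$. $\mathcal P$ is tip-respecting if $\{z\}$ is a part. The canvas is flow-critical if for every non-trivial tip-respecting $\mathcal P$ some tip preflow extends to a nowhere-zero flow in $\mathcal G/\mathcal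 P$ but not in $\mathcal G$; tame if $\deg(v)\ge4+|\tau(v)|$ for all $v\ne z$. The census $C(\mathcal G,z)$ is the multiset $\{\deg(v): v\in V(\mathcal G)\setminus\{z\},\ \deg(v)\neq 4\}$. *)

theory Defs
  imports "HOL-Library.Numeral_Type" "HOL-Library.Disjoint_Sets" "HOL-Library.Multiset"
begin

text \<open>
  Edges are abstract objects carrying a two-element set of end vertices, so parallel edges
  are allowed and loops are not.  The type \<open>3\<close> is the ring of integers modulo 3.
\<close>

record ('v, 'e) graph =
  verts :: "'v set"
  edges :: "'e set"
  ends :: "'e \<Rightarrow> 'v set"

record ('v, 'e) bordered_graph = "('v, 'e) graph" +
  bd :: "'v \<Rightarrow> 3"

definition is_graph :: "('v, 'e, 'x) graph_scheme \<Rightarrow> bool" where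
  "is_graph G \<longleftrightarrow> finite (verts G) \<and> finite (edges G) \<and>
     (\<forall>e \<in> edges G. ends G e \<subseteq> verts G \<and> card (ends G e) = 2)"

definition adjacency :: "('v, 'e, 'x) graph_scheme \<Rightarrow> 'v rel" where
  "adjacency G = {(u, v). \<exists>e \<in> edges G. ends G e = {u, v}}"

definition components :: "('v, 'e, 'x) graph_scheme \<Rightarrow> 'v set set" where
  "components G = verts G // {(u, v). u \<in> verts G \<and> v \<in> verts G \<and> (u, v) \<in> (adjacency G)\<^sup>*}"

definition is_boundary :: "('v, 'e, 'x) graph_scheme \<Rightarrow> ('v \<Rightarrow> 3) \<Rightarrow> bool" where
  "is_boundary G \<beta> \<longleftrightarrow> (\<forall>C \<in> components G. (\<Sum>v \<in> C. \<beta> v) = 0)"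

definition is_bordered_graph :: "('v, 'e) bordered_graph \<Rightarrow> bool" where
  "is_bordered_graph G \<longleftrightarrow> is_graph G \<and> is_boundary G (bd G)"

definition edges_at :: "('v, 'e, 'x) graph_scheme \<Rightarrow> 'v \<Rightarrow> 'e set" where
  "edges_at G v = {e \<in> edges G. v \<in> ends G e}"

definition degree :: "('v, 'e, 'x) graph_scheme \<Rightarrow> 'v \<Rightarrow> nat" where
  "degree G v = card (edges_at G v)"

text \<open>
  An orientation of a set \<open>S\<close> of edges is given by the choice of a tail for each edge in \<open>S\<close>;
  its values outside \<open>S\<close> are irrelevant.
\<close>

definition orientation_on :: "('v, 'e, 'x) graph_scheme \<Rightarrow> 'e set \<Rightarrow> ('e \<Rightarrow> 'v) \<Rightarrow> bool" where
  "orientation_on G S \<phi> \<longleftrightarrow> (\<forall>e \<in> S. \<phi> e \<in> ends G e)"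

definition out_degree :: "('v, 'e, 'x) graph_scheme \<Rightarrow> ('e \<Rightarrow> 'v) \<Rightarrow> 'v \<Rightarrow> nat" where
  "out_degree G \<phi> v = card {e \<in> edges_at G v. \<phi> e = v}"

definition in_degree :: "('v, 'e, 'x) graph_scheme \<Rightarrow> ('e \<Rightarrow> 'v) \<Rightarrow> 'v \<Rightarrow> nat" where
  "in_degree G \<phi> v = card {e \<in> edges_at G v. \<phi> e \<noteq> v}"

definition satisfies_boundary_at :: "('v, 'e) bordered_graph \<Rightarrow> ('e \<Rightarrow> 'v) \<Rightarrow> 'v \<Rightarrow> bool" where
  "satisfies_boundary_at G \<phi> v \<longleftrightarrow>
     (of_nat (out_degree G \<phi> v) - of_nat (in_degree G \<phi> v) :: 3) = bd G v"

definition nowhere_zero_flow :: "('v, 'e) bordered_graph \<Rightarrow> ('e \<Rightarrow> 'v) \<Rightarrow> bool" where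
  "nowhere_zero_flow G \<phi> \<longleftrightarrow> orientation_on G (edges G) \<phi> \<and>
     (\<forall>v \<in> verts G. satisfies_boundary_at G \<phi> v)"

definition abs_tau :: "('v, 'e) bordered_graph \<Rightarrow> 'v \<Rightarrow> nat" where
  "abs_tau G v =
     (if even (degree G v) then (if bd G v = 0 then 0 else 2)
      else (if bd G v = 0 then 3 else 1))"

text \<open>
  The vertices of the contraction are the parts themselves; an edge survives iff its two ends
  lie in different parts, and it then joins these two parts.
\<close>

definition contract :: "('v, 'e) bordered_graph \<Rightarrow> 'v set set \<Rightarrow> ('v set, 'e) bordered_graph" where
  "contract G P =
     \<lparr>verts = P,
      edges = {e \<in> edges G. \<not> (\<exists>X \<in> P. ends G e \<subseteq> X)},
      ends = (\<lambda>e. {X \<in> P. X \<inter> ends G e \<noteq> {}}),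
      bd = (\<lambda>X. \<Sum>v \<in> X. bd G v)\<rparr>"

definition part_of :: "'v set set \<Rightarrow> 'v \<Rightarrow> 'v set" where
  "part_of P v = (THE X. X \<in> P \<and> v \<in> X)"

definition contract_orientation :: "'v set set \<Rightarrow> ('e \<Rightarrow> 'v) \<Rightarrow> 'e \<Rightarrow> 'v set" where
  "contract_orientation P \<phi> e = part_of P (\<phi> e)"

definition nontrivial_partition :: "'v set set \<Rightarrow> bool" where
  "nontrivial_partition P \<longleftrightarrow> (\<exists>X \<in> P. card X \<ge> 2)"

definition tip_respecting :: "'v \<Rightarrow> 'v set set \<Rightarrow> bool" where
  "tip_respecting z P \<longleftrightarrow> {z} \<in> P"

definition canvas :: "('v, 'e) bordered_graph \<Rightarrow> 'v \<Rightarrow> bool" where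
  "canvas G z \<longleftrightarrow> is_bordered_graph G \<and> z \<in> verts G"

definition nontrivial_canvas :: "('v, 'e) bordered_graph \<Rightarrow> 'v \<Rightarrow> bool" where
  "nontrivial_canvas G z \<longleftrightarrow> canvas G z \<and> card (verts G) \<ge> 3"

definition tip_preflow :: "('v, 'e) bordered_graph \<Rightarrow> 'v \<Rightarrow> ('e \<Rightarrow> 'v) \<Rightarrow> bool" where
  "tip_preflow G z \<psi> \<longleftrightarrow> orientation_on G (edges_at G z) \<psi> \<and> satisfies_boundary_at G \<psi> z"

definition extends :: "('v, 'e) bordered_graph \<Rightarrow> 'v \<Rightarrow> ('e \<Rightarrow> 'v) \<Rightarrow> bool" where
  "extends G z \<psi> \<longleftrightarrow> (\<exists>\<phi>. nowhere_zero_flow G \<phi> \<and> (\<forall>e \<in> edges_at G z. \<phi> e = \<psi> e))"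

text \<open>
  If \<open>P\<close> is tip-respecting, no edge at \<open>z\<close> is lost in the contraction, whose tip is \<open>{z}\<close>;
  a tip preflow of \<open>G\<close> is transported to the contraction by sending tails to their parts.
\<close>

definition flow_critical :: "('v, 'e) bordered_graph \<Rightarrow> 'v \<Rightarrow> bool" where
  "flow_critical G z \<longleftrightarrow>
     (\<forall>P. partition_on (verts G) P \<and> nontrivial_partition P \<and> tip_respecting z P \<longrightarrow>
        (\<exists>\<psi>. tip_preflow G z \<psi> \<and>
             extends (contract G P) {z} (contract_orientation P \<psi>) \<and>
             \<not> extends G z \<psi>))"

definition tame :: "('v, 'e) bordered_graph \<Rightarrow> 'v \<Rightarrow> bool" where
  "tame G z \<longleftrightarrow> (\<forall>v \<in> verts G - {z}. degree G v \<ge> 4 + abs_tau G v)"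

definition census :: "('v, 'e) bordered_graph \<Rightarrow> 'v \<Rightarrow> nat multiset" where
  "census G z = filter_mset (\<lambda>d. d \<noteq> 4) (image_mset (degree G) (mset_set (verts G - {z})))"

end

(*
  A graph is encoded by its edge multiplicities, a nowhere-zero flow by the net number of edges
  directed from one vertex to another, and the boundary together with the degree parity by an
  integer modulo 6, whose distance dist6 to 0 is the modulus of tau.  As every set of at least two
  vertices avoiding the tip yields a flow-critical canvas after contracting its complement into the
  tip, one can show by induction the stronger statement tip_bound: the tip has degree at least
  6 + |tau|, every other vertex has degree at most deg(z) - 2, and if equality holds at v then all
  vertices other than v and z have degree 4.

  In the induction step a preflow that does not extend is kept while the graph is made smaller: a
  vertex of degree 4 is split into two edges, a pair of edges is lifted off a vertex of too large
  degree, and an edge is deleted if its direction lowers |tau| at its non-tip ends.  A coarsest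
  quotient in which the preflow still does not extend is again critical.  If none of this applies,
  then all vertices (but possibly v) are tight, adjacent ones ask for the same net direction, and
  all tip edges point the wrong way; then a neighbour of the tip is merged into the tip (absorb).
*)

theory Submission imports Defs begin

section \<open>Residues modulo 6 and net flows\<close>

text \<open>What survives a deletion or a lift is not criticality but a single preflow without an
  extension, and \<open>critical_quotient\<close> recovers a critical instance from it. The price:
  the vertices of that quotient are unknown unions of old vertices, so every reduction has to keep
  all proper sets of non-tip vertices tame, not only the single vertices. This is what the
  strengthened bound pays for. A proper set of at least two non-tip vertices is the vertex set of a
  smaller canvas, so its cut is at least 6 + |tau|, which is 2 more than tameness asks. Deleting one
  edge costs at most one unit of the cut and one of |tau|, lifting a pair costs at most two units of
  the cut; only the single vertices at the changed place need separate care. The equality case is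
  part of the induction for two reasons. Without vertices of degree 4 it improves deg(v) + 2 to
  deg(v) + 3 for such sets. And in a counterexample a successful reduction would reach equality, so
  that all vertices except v and z would have degree 4 afterwards, while one deletion or lift
  changes very few degrees.\<close>

definition dist6 :: "int \<Rightarrow> int" where
  "dist6 a = min (a mod 6) (6 - a mod 6)"

lemma dist6_cong: "6 dvd a - b \<Longrightarrow> dist6 a = dist6 b"
  unfolding dist6_def by (metis mod_eq_dvd_iff)

lemma dist6_bounds: "0 \<le> dist6 a" "dist6 a \<le> 3"
  using pos_mod_bound[of 6 a] pos_mod_sign[of 6 a] unfolding dist6_def by linarith+

lemma dist6_witness:
  obtains q where "a = 6 * q + dist6 a" | q where "a = 6 * q - dist6 a"
proof (cases "a mod 6 \<le> 6 - a mod 6")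
  case True
  then show ?thesis
    using that(1)[of "a div 6"] mult_div_mod_eq[of 6 a] unfolding dist6_def by simp
next
  case False
  then show ?thesis
    using that(2)[of "a div 6 + 1"] mult_div_mod_eq[of 6 a] unfolding dist6_def by simp
qed

lemma dist6_le: "dist6 a \<le> \<bar>a - 6 * q\<bar>"
proof -
  have "a = 6 * (a div 6) + a mod 6" "0 \<le> a mod 6" "a mod 6 < 6"
    by simp_all
  then show ?thesis
    unfolding dist6_def by (cases "q \<le> a div 6"; linarith)
qed

lemma dist6_le_abs: "dist6 a \<le> \<bar>a\<bar>"
  using dist6_le[of a 0] by simp

lemma dist6_even: "even (dist6 a) \<longleftrightarrow> even a"
  by (rule dist6_witness[of a]; presburger)

lemma dist6_minus: "dist6 (- a) = dist6 a"
proof -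
  have "dist6 (- b) \<le> dist6 b" for b
  proof (rule dist6_witness[of b])
    fix q assume "b = 6 * q + dist6 b"
    then show ?thesis using dist6_le[of "- b" "- q"] dist6_bounds[of b] by linarith
  next
    fix q assume "b = 6 * q - dist6 b"
    then show ?thesis using dist6_le[of "- b" "- q"] dist6_bounds[of b] by linarith
  qed
  from this[of a] this[of "- a"] show ?thesis by simp
qed

lemma dist6_add: "dist6 (a + b) \<le> dist6 a + dist6 b"
proof -
  obtain q s where a: "a = 6 * q + s" "\<bar>s\<bar> = dist6 a"
    by (rule dist6_witness[of a])
      (metis abs_of_nonneg dist6_bounds(1), metis abs_minus_cancel abs_of_nonneg dist6_bounds(1) diff_conv_add_uminus)
  obtain q' s' where b: "b = 6 * q' + s'" "\<bar>s'\<bar> = dist6 b"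
    by (rule dist6_witness[of b])
      (metis abs_of_nonneg dist6_bounds(1), metis abs_minus_cancel abs_of_nonneg dist6_bounds(1) diff_conv_add_uminus)
  have "dist6 (a + b) \<le> \<bar>(a + b) - 6 * (q + q')\<bar>"
    by (rule dist6_le)
  also have "\<dots> \<le> \<bar>s\<bar> + \<bar>s'\<bar>"
    using a(1) b(1) by simp
  finally show ?thesis using a(2) b(2) by simp
qed

lemma dist6_diff: "dist6 (a - b) \<le> dist6 a + dist6 b"
  using dist6_add[of a "- b"] by (simp add: dist6_minus)

lemma dist6_eq_0: "dist6 a = 0 \<longleftrightarrow> 6 dvd a"
proof
  assume 0: "dist6 a = 0"
  show "6 dvd a"
    by (rule dist6_witness[of a]) (use 0 in \<open>metis add_0_right diff_zero dvd_triv_left\<close>)+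
next
  assume "6 dvd a"
  then have "a mod 6 = 0" by simp
  then show "dist6 a = 0" unfolding dist6_def by simp
qed

lemma dist6_small:
  assumes "\<bar>a\<bar> \<le> 3"
  shows "dist6 a = \<bar>a\<bar>"
proof -
  obtain q where "a = 6 * q + dist6 a \<or> a = 6 * q - dist6 a"
    by (rule dist6_witness[of a]) auto
  moreover from this have "q = 0 \<or> q = 1 \<or> q = - 1"
    using dist6_bounds[of a] assms by linarith
  ultimately show ?thesis
    using dist6_bounds[of a] assms by linarith
qed

text \<open>The possible differences (edges out minus edges in) over \<open>m\<close> parallel
  edges. It is empty for negative \<open>m\<close>, so membership in \<open>netset (m - 1)\<close>
  also says that there is an edge to remove.\<close>

definition netset :: "int \<Rightarrow> int set" where
  "netset m = {s. \<bar>s\<bar> \<le> m \<and> even (m - s)}"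

lemma netset_0: "s \<in> netset 0 \<longleftrightarrow> s = 0"
  by (auto simp: netset_def)

lemma netset_minus: "- s \<in> netset m \<longleftrightarrow> s \<in> netset m"
  by (auto simp: netset_def)

lemma netset_add: "s \<in> netset m \<Longrightarrow> s' \<in> netset m' \<Longrightarrow> s + s' \<in> netset (m + m')"
  by (auto simp: netset_def)

lemma netset_sum:
  assumes "\<And>a. a \<in> A \<Longrightarrow> g a \<in> netset (m a)"
  shows "sum g A \<in> netset (sum m A)"
proof (cases "finite A")
  case True
  then show ?thesis using assms
  proof (induction A)
    case (insert x A)
    have "g x + sum g A \<in> netset (m x + sum m A)"
      by (rule netset_add) (use insert in auto)
    then show ?case using insert by simp
  qed (simp add: netset_def)
qed (simp add: netset_def)

lemma netset_split_add:
  assumes s: "s \<in> netset (m + m')" and m: "0 \<le> m" "0 \<le> m'"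
  obtains r r' where "r \<in> netset m" "r' \<in> netset m'" "s = r + r'"
proof -
  have "\<bar>s\<bar> \<le> m + m'" "even (m + m' - s)" using s by (auto simp: netset_def)
  consider "\<bar>s - m\<bar> \<le> m'" | "s - m > m'" | "s - m < - m'" by linarith
  then show ?thesis
  proof cases
    case 1
    show ?thesis
      by (rule that[of m "s - m"]) (use 1 m \<open>even _\<close> in \<open>auto simp: netset_def\<close>)
  next
    case 2
    then show ?thesis using \<open>\<bar>s\<bar> \<le> m + m'\<close> by linarith
  next
    case 3
    show ?thesis
      by (rule that[of "s + m'" "- m'"])
        (use 3 m \<open>even _\<close> \<open>\<bar>s\<bar> \<le> _\<close> in \<open>auto simp: netset_def\<close>)
  qed
qed

text \<open>Contraction merges several bundles of edges into one; this distributes the net value of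
  the merged bundle over the original ones when a flow of the contraction is pulled back.\<close>

lemma netset_split_sum:
  assumes "finite A" "s \<in> netset (sum m A)" "\<And>a. a \<in> A \<Longrightarrow> 0 \<le> m a"
  obtains g where "\<And>a. a \<in> A \<Longrightarrow> g a \<in> netset (m a)" "sum g A = s"
proof -
  have "\<exists>g. (\<forall>a\<in>A. g a \<in> netset (m a)) \<and> sum g A = s"
    using assms
  proof (induction A arbitrary: s)
    case empty
    then show ?case by (simp add: netset_0)
  next
    case (insert x A)
    have "s \<in> netset (m x + sum m A)" "0 \<le> m x" "0 \<le> sum m A"
      using insert by (auto intro: sum_nonneg)
    then obtain r r' where r: "r \<in> netset (m x)" "r' \<in> netset (sum m A)" "s = r + r'"
      by (rule netset_split_add)
    then obtain g where g: "\<forall>a\<in>A. g a \<in> netset (m a)" "sum g A = r'"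
      using insert by blast
    have "sum (g(x := r)) A = sum g A"
      by (rule sum.cong) (use insert in auto)
    then show ?case
      by (intro exI[of _ "g(x := r)"]) (use insert r g in auto)
  qed
  then show ?thesis using that by blast
qed

text \<open>Two parallel edges suffice for every residue of the right parity: distances up to 2 are
  available directly, and distance 3 makes \<open>m\<close> odd and hence at least 3.\<close>

lemma netset_residue:
  assumes "2 \<le> m" "even (m - r)"
  obtains s where "s \<in> netset m" "6 dvd s - r"
proof -
  obtain e where e: "r = 6 * e + dist6 r \<or> r = 6 * e - dist6 r"
    by (rule dist6_witness[of r]) auto
  note d = dist6_bounds[of r] dist6_even[of r]
  show ?thesis
  proof (cases "dist6 r \<le> m")
    case True
    from e show ?thesis
    proof
      assume "r = 6 * e + dist6 r"
      then have "dist6 r - r = 6 * (- e)" by simp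
      then show ?thesis
        by (intro that[of "dist6 r"]) (use True d assms in \<open>auto simp: netset_def\<close>)
    next
      assume "r = 6 * e - dist6 r"
      then have "- dist6 r - r = 6 * (- e)" by simp
      then show ?thesis
        by (intro that[of "- dist6 r"]) (use True d assms in \<open>auto simp: netset_def\<close>)
    qed
  next
    case False
    then have "dist6 r = 3" "m = 2" using d assms by linarith+
    then show ?thesis using d assms by simp
  qed
qed

text \<open>Singles out one of \<open>m + 1\<close> parallel edges together with its direction
  \<open>e\<close>, so that it can be removed or rerouted.\<close>

lemma netset_step:
  assumes "s \<in> netset (m + 1)" "0 \<le> m"
  obtains e :: int where "e = 1 \<or> e = -1" "s - e \<in> netset m"
proof -
  have "s - 1 \<in> netset m \<or> s + 1 \<in> netset m"
    using assms unfolding netset_def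
    by (cases "s > 0"; cases "s = 0"; simp) presburger+
  then show ?thesis using that[of 1] that[of "-1"] by auto
qed

section \<open>Instances, flows and quotients\<close>

definition cut :: "'v set \<Rightarrow> ('v \<Rightarrow> 'v \<Rightarrow> int) \<Rightarrow> 'v set \<Rightarrow> int" where
  "cut V \<mu> A = (\<Sum>a\<in>A. \<Sum>b\<in>V - A. \<mu> a b)"

definition ecount :: "('v \<Rightarrow> 'v \<Rightarrow> int) \<Rightarrow> 'v set \<Rightarrow> 'v set \<Rightarrow> int" where
  "ecount \<mu> A B = (\<Sum>a\<in>A. \<Sum>b\<in>B. \<mu> a b)"

lemma sum_fibers:
  assumes "finite V" "finite A"
  shows "(\<Sum>a\<in>A. sum g {u \<in> V. h u = a}) = sum g {u \<in> V. h u \<in> A}"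
proof -
  have "(\<Sum>a\<in>A. sum g {u \<in> {u \<in> V. h u \<in> A}. h u = a}) = sum g {u \<in> V. h u \<in> A}"
    by (rule sum.group) (use assms in auto)
  moreover have "{u \<in> {u \<in> V. h u \<in> A}. h u = a} = {u \<in> V. h u = a}" if "a \<in> A" for a
    using that by auto
  ultimately show ?thesis by simp
qed

lemma ecount_commute:
  assumes "\<And>a b. \<mu> a b = \<mu> b a"
  shows "ecount \<mu> A B = ecount \<mu> B A"
  unfolding ecount_def by (subst sum.swap) (simp add: assms)

lemma ecount_Un_right:
  assumes "finite B" "finite C" "B \<inter> C = {}"
  shows "ecount \<mu> A (B \<union> C) = ecount \<mu> A B + ecount \<mu> A C"
  unfolding ecount_def using assms by (simp add: sum.union_disjoint sum.distrib)

lemma ecount_Un_left: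
  assumes "finite A" "finite B" "A \<inter> B = {}"
  shows "ecount \<mu> (A \<union> B) C = ecount \<mu> A C + ecount \<mu> B C"
  unfolding ecount_def using assms by (simp add: sum.union_disjoint)

lemma ecount_nonneg: "(\<And>a b. 0 \<le> \<mu> a b) \<Longrightarrow> 0 \<le> ecount \<mu> A B"
  unfolding ecount_def by (intro sum_nonneg) auto

lemma cut_ecount: "cut V \<mu> A = ecount \<mu> A (V - A)"
  by (simp add: cut_def ecount_def)

locale multigraph =
  fixes V :: "'v set" and \<mu> :: "'v \<Rightarrow> 'v \<Rightarrow> int"
  assumes finite_V: "finite V"
    and mu_sym: "\<mu> a b = \<mu> b a"
    and mu_nonneg: "0 \<le> \<mu> a b"
begin

lemma cut_compl: "A \<subseteq> V \<Longrightarrow> cut V \<mu> (V - A) = cut V \<mu> A"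
  by (simp add: cut_ecount double_diff ecount_commute[OF mu_sym])

lemma cut_nonneg: "0 \<le> cut V \<mu> A"
  unfolding cut_ecount by (rule ecount_nonneg) (rule mu_nonneg)

lemma cut_empty: "cut V \<mu> {} = 0"
  by (simp add: cut_def)

lemma cut_single: "cut V \<mu> {v} = (\<Sum>w\<in>V - {v}. \<mu> v w)"
  by (simp add: cut_def)

lemma cut_Un:
  assumes "A \<subseteq> V" "B \<subseteq> V" "A \<inter> B = {}"
  shows "cut V \<mu> (A \<union> B) = cut V \<mu> A + cut V \<mu> B - 2 * ecount \<mu> A B"
proof -
  have fin: "finite A" "finite B" "finite (V - (A \<union> B))"
    using assms finite_V finite_subset by auto
  have eqs: "V - A = (V - (A \<union> B)) \<union> B" "V - B = (V - (A \<union> B)) \<union> A"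
    using assms by auto
  have "cut V \<mu> A = ecount \<mu> A (V - (A \<union> B)) + ecount \<mu> A B"
    unfolding cut_ecount eqs(1) by (rule ecount_Un_right) (use fin in auto)
  moreover have "cut V \<mu> B = ecount \<mu> B (V - (A \<union> B)) + ecount \<mu> B A"
    unfolding cut_ecount eqs(2) by (rule ecount_Un_right) (use fin in auto)
  moreover have "cut V \<mu> (A \<union> B) = ecount \<mu> A (V - (A \<union> B)) + ecount \<mu> B (V - (A \<union> B))"
    unfolding cut_ecount by (rule ecount_Un_left) (use fin assms in auto)
  ultimately show ?thesis
    using ecount_commute[of \<mu> B A, OF mu_sym] by simp
qed

lemma cut_insert:
  assumes "insert x A \<subseteq> V" "x \<notin> A"
  shows "cut V \<mu> (insert x A) = cut V \<mu> A + cut V \<mu> {x} - 2 * (\<Sum>a\<in>A. \<mu> x a)"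
proof -
  have "cut V \<mu> ({x} \<union> A) = cut V \<mu> {x} + cut V \<mu> A - 2 * ecount \<mu> {x} A"
    by (rule cut_Un) (use assms in auto)
  then show ?thesis by (simp add: ecount_def)
qed

lemma cut_sum_singles:
  assumes "A \<subseteq> V"
  shows "cut V \<mu> A \<le> (\<Sum>a\<in>A. cut V \<mu> {a})"
    and "even ((\<Sum>a\<in>A. cut V \<mu> {a}) - cut V \<mu> A)"
proof -
  have "finite A" using assms finite_V finite_subset by auto
  then have "cut V \<mu> A \<le> (\<Sum>a\<in>A. cut V \<mu> {a}) \<and> even ((\<Sum>a\<in>A. cut V \<mu> {a}) - cut V \<mu> A)"
    using assms
  proof (induction A)
    case (insert x A)
    have "cut V \<mu> (insert x A) = cut V \<mu> A + cut V \<mu> {x} - 2 * (\<Sum>a\<in>A. \<mu> x a)"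
      by (rule cut_insert) (use insert in auto)
    moreover have "0 \<le> (\<Sum>a\<in>A. \<mu> x a)"
      by (intro sum_nonneg mu_nonneg)
    ultimately show ?case using insert by simp
  qed (simp add: cut_empty)
  then show "cut V \<mu> A \<le> (\<Sum>a\<in>A. cut V \<mu> {a})" "even ((\<Sum>a\<in>A. cut V \<mu> {a}) - cut V \<mu> A)"
    by auto
qed

end

text \<open>Quotients are taken along maps of the vertex type into itself, so all instances of the
  induction share one type and quotients compose. Diagonal entries count the edges inside a fibre;
  keeping them makes composition exact, while cuts and flows look only at distinct vertices.\<close>

definition quot_mult :: "'v set \<Rightarrow> ('v \<Rightarrow> 'v) \<Rightarrow> ('v \<Rightarrow> 'v \<Rightarrow> int) \<Rightarrow> 'v \<Rightarrow> 'v \<Rightarrow> int" where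
  "quot_mult V h \<mu> a b = ecount \<mu> {u \<in> V. h u = a} {w \<in> V. h w = b}"

definition quot_sum :: "'v set \<Rightarrow> ('v \<Rightarrow> 'v) \<Rightarrow> ('v \<Rightarrow> int) \<Rightarrow> 'v \<Rightarrow> int" where
  "quot_sum V h t a = sum t {u \<in> V. h u = a}"

lemma sum_quot_sum:
  assumes "finite V" "finite A"
  shows "sum (quot_sum V h t) A = sum t {u \<in> V. h u \<in> A}"
  unfolding quot_sum_def by (rule sum_fibers[OF assms])

lemma ecount_quot:
  assumes "finite V" "finite A" "finite B"
  shows "ecount (quot_mult V h \<mu>) A B = ecount \<mu> {u \<in> V. h u \<in> A} {w \<in> V. h w \<in> B}"
proof -
  have "ecount (quot_mult V h \<mu>) A B =
      (\<Sum>a\<in>A. \<Sum>b\<in>B. \<Sum>u\<in>{u \<in> V. h u = a}. \<Sum>w\<in>{w \<in> V. h w = b}. \<mu> u w)"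
    by (simp add: ecount_def quot_mult_def)
  also have "\<dots> = (\<Sum>a\<in>A. \<Sum>u\<in>{u \<in> V. h u = a}. \<Sum>b\<in>B. \<Sum>w\<in>{w \<in> V. h w = b}. \<mu> u w)"
    by (rule sum.cong[OF refl], rule sum.swap)
  also have "\<dots> = (\<Sum>a\<in>A. \<Sum>u\<in>{u \<in> V. h u = a}. \<Sum>w\<in>{w \<in> V. h w \<in> B}. \<mu> u w)"
    by (simp add: sum_fibers[OF assms(1,3)])
  also have "\<dots> = ecount \<mu> {u \<in> V. h u \<in> A} {w \<in> V. h w \<in> B}"
    by (simp add: sum_fibers[OF assms(1,2)] ecount_def)
  finally show ?thesis .
qed

lemma cut_quot:
  assumes "finite V" "B \<subseteq> h ` V"
  shows "cut (h ` V) (quot_mult V h \<mu>) B = cut V \<mu> {u \<in> V. h u \<in> B}"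
proof -
  have "finite B" using assms finite_surj by blast
  have "{w \<in> V. h w \<in> h ` V - B} = V - {u \<in> V. h u \<in> B}" by auto
  then show ?thesis
    unfolding cut_ecount using assms \<open>finite B\<close> by (simp add: ecount_quot)
qed

lemma quot_mult_comp:
  assumes "finite V"
  shows "quot_mult (h ` V) h' (quot_mult V h \<mu>) = quot_mult V (h' \<circ> h) \<mu>"
proof (intro ext)
  fix a b
  have eq: "{u \<in> V. h u \<in> h ` V \<and> h' (h u) = c} = {u \<in> V. h' (h u) = c}" for c
    by auto
  show "quot_mult (h ` V) h' (quot_mult V h \<mu>) a b = quot_mult V (h' \<circ> h) \<mu> a b"
    by (subst quot_mult_def, subst ecount_quot) (use assms in \<open>auto simp: eq quot_mult_def\<close>)
qed

lemma quot_sum_comp: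
  assumes "finite V"
  shows "quot_sum (h ` V) h' (quot_sum V h t) = quot_sum V (h' \<circ> h) t"
proof
  fix a
  have eq: "{u \<in> V. h u \<in> h ` V \<and> h' (h u) = c} = {u \<in> V. h' (h u) = c}" for c
    by auto
  show "quot_sum (h ` V) h' (quot_sum V h t) a = quot_sum V (h' \<circ> h) t a"
    by (subst quot_sum_def, subst sum_quot_sum) (use assms in \<open>auto simp: eq quot_sum_def\<close>)
qed

text \<open>
  The tip is an element of \<open>V\<close>; \<open>t v\<close> is the required net outflow at \<open>v\<close>, which only matters
  modulo 6: modulo 3 it is the boundary, modulo 2 it is the degree.
\<close>

definition inst :: "'v set \<Rightarrow> 'v \<Rightarrow> ('v \<Rightarrow> 'v \<Rightarrow> int) \<Rightarrow> ('v \<Rightarrow> int) \<Rightarrow> bool" where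
  "inst V z \<mu> t \<longleftrightarrow> multigraph V \<mu> \<and> z \<in> V \<and> (\<forall>v\<in>V. even (t v + cut V \<mu> {v})) \<and> 6 dvd sum t V"

definition flow :: "'v set \<Rightarrow> ('v \<Rightarrow> 'v \<Rightarrow> int) \<Rightarrow> ('v \<Rightarrow> int) \<Rightarrow> ('v \<Rightarrow> 'v \<Rightarrow> int) \<Rightarrow> bool" where
  "flow V \<mu> t f \<longleftrightarrow> (\<forall>a\<in>V. \<forall>b\<in>V. f a b = - f b a) \<and>
     (\<forall>a\<in>V. \<forall>b\<in>V. a \<noteq> b \<longrightarrow> f a b \<in> netset (\<mu> a b)) \<and>
     (\<forall>v\<in>V. 6 dvd sum (f v) V - t v)"

text \<open>\<open>\<psi> u\<close> is the net number of edges directed from the tip to \<open>u\<close>.\<close>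

definition preflow :: "'v set \<Rightarrow> 'v \<Rightarrow> ('v \<Rightarrow> 'v \<Rightarrow> int) \<Rightarrow> ('v \<Rightarrow> int) \<Rightarrow> ('v \<Rightarrow> int) \<Rightarrow> bool" where
  "preflow V z \<mu> t \<psi> \<longleftrightarrow> (\<forall>u\<in>V - {z}. \<psi> u \<in> netset (\<mu> z u)) \<and> 6 dvd sum \<psi> (V - {z}) - t z"

definition extendable :: "'v set \<Rightarrow> 'v \<Rightarrow> ('v \<Rightarrow> 'v \<Rightarrow> int) \<Rightarrow> ('v \<Rightarrow> int) \<Rightarrow> ('v \<Rightarrow> int) \<Rightarrow> bool" where
  "extendable V z \<mu> t \<psi> \<longleftrightarrow> (\<exists>f. flow V \<mu> t f \<and> (\<forall>u\<in>V - {z}. f z u = \<psi> u))"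

definition onto_tip :: "'v \<Rightarrow> 'v set \<Rightarrow> 'v \<Rightarrow> 'v" where
  "onto_tip z A u = (if u \<in> A then u else z)"

text \<open>The contraction \<open>onto_tip z A\<close> describes all ways in which the rest of the
  graph can act on \<open>A\<close>. Quantifying over sets and not over partitions makes the notion
  pass to these contractions (\<open>critical_onto_tip\<close>).\<close>

definition critical :: "'v set \<Rightarrow> 'v \<Rightarrow> ('v \<Rightarrow> 'v \<Rightarrow> int) \<Rightarrow> ('v \<Rightarrow> int) \<Rightarrow> bool" where
  "critical V z \<mu> t \<longleftrightarrow> (\<forall>A. A \<subseteq> V - {z} \<and> 2 \<le> card A \<longrightarrow>
     (\<exists>\<psi>. preflow (insert z A) z (quot_mult V (onto_tip z A) \<mu>) (quot_sum V (onto_tip z A) t) \<psi> \<and>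
       \<not> extendable (insert z A) z (quot_mult V (onto_tip z A) \<mu>) (quot_sum V (onto_tip z A) t) \<psi>))"

lemma instD:
  assumes "inst V z \<mu> t"
  shows "multigraph V \<mu>" "finite V" "z \<in> V" "\<And>a b. \<mu> a b = \<mu> b a" "\<And>a b. 0 \<le> \<mu> a b"
    "\<And>v. v \<in> V \<Longrightarrow> even (t v + cut V \<mu> {v})" "6 dvd sum t V"
proof -
  show m: "multigraph V \<mu>" using assms unfolding inst_def by blast
  show "finite V" by (rule multigraph.finite_V[OF m])
  show "\<mu> a b = \<mu> b a" for a b by (rule multigraph.mu_sym[OF m])
  show "0 \<le> \<mu> a b" for a b by (rule multigraph.mu_nonneg[OF m])
qed (use assms in \<open>auto simp: inst_def\<close>)

lemma inst_parity:
  assumes "inst V z \<mu> t" "A \<subseteq> V"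
  shows "even (sum t A + cut V \<mu> A)"
proof -
  interpret multigraph V \<mu> using instD(1)[OF assms(1)] .
  have "even (\<Sum>a\<in>A. t a + cut V \<mu> {a})"
    by (rule dvd_sum) (use instD(6)[OF assms(1)] assms(2) in blast)
  then show ?thesis using cut_sum_singles(2)[OF assms(2)] by (simp add: sum.distrib)
qed

lemma inst_quot:
  assumes I: "inst V z \<mu> t"
  shows "inst (h ` V) (h z) (quot_mult V h \<mu>) (quot_sum V h t)"
proof -
  note D = instD[OF I]
  have "multigraph (h ` V) (quot_mult V h \<mu>)"
    by unfold_locales (use D in \<open>auto simp: quot_mult_def ecount_commute[OF D(4)] intro: ecount_nonneg\<close>)
  moreover have "even (quot_sum V h t a + cut (h ` V) (quot_mult V h \<mu>) {a})" if "a \<in> h ` V" for a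
    using inst_parity[OF I, of "{u \<in> V. h u = a}"] that D(2) by (simp add: cut_quot quot_sum_def)
  moreover have "6 dvd sum (quot_sum V h t) (h ` V)"
    using D(2,7) by (subst sum_quot_sum) (auto simp: Collect_conj_eq Int_absorb2 image_subset_iff subsetI)
  ultimately show ?thesis using D unfolding inst_def by auto
qed

lemma extendable_cong:
  assumes "\<And>a b. a \<in> V \<Longrightarrow> b \<in> V \<Longrightarrow> a \<noteq> b \<Longrightarrow> \<mu> a b = \<mu>' a b"
    and "\<And>a. a \<in> V \<Longrightarrow> t a = t' a" and "\<And>a. a \<in> V - {z} \<Longrightarrow> \<psi> a = \<psi>' a"
  shows "extendable V z \<mu> t \<psi> \<longleftrightarrow> extendable V z \<mu>' t' \<psi>'"
proof -
  have "flow V \<mu> t f \<longleftrightarrow> flow V \<mu>' t' f" for f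
  proof -
    have "(\<forall>a\<in>V. \<forall>b\<in>V. a \<noteq> b \<longrightarrow> f a b \<in> netset (\<mu> a b)) \<longleftrightarrow>
        (\<forall>a\<in>V. \<forall>b\<in>V. a \<noteq> b \<longrightarrow> f a b \<in> netset (\<mu>' a b))"
      using assms(1) by auto
    moreover have "(\<forall>v\<in>V. 6 dvd sum (f v) V - t v) \<longleftrightarrow> (\<forall>v\<in>V. 6 dvd sum (f v) V - t' v)"
      using assms(2) by auto
    ultimately show ?thesis unfolding flow_def by argo
  qed
  then show ?thesis unfolding extendable_def using assms(3) by (metis (no_types, lifting))
qed

text \<open>With one vertex besides the tip, its condition follows from that of the tip, because all
  requirements sum to 0 modulo 6. Hence a preflow without an extension always leaves two vertices
  besides the tip, as the induction needs.\<close>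

lemma extendable_trivial:
  assumes I: "inst V z \<mu> t" and \<psi>: "preflow V z \<mu> t \<psi>" and c: "card (V - {z}) \<le> 1"
  shows "extendable V z \<mu> t \<psi>"
proof -
  note D = instD[OF I]
  define f where "f a b = (if a = z \<and> b \<noteq> z then \<psi> b else if b = z \<and> a \<noteq> z then - \<psi> a else 0)" for a b
  have "6 dvd sum (f v) V - t v" if "v \<in> V" for v
  proof (cases "v = z")
    case True
    have "sum (f z) V = sum (f z) (V - {z}) + f z z"
      using D by (simp add: sum.remove)
    also have "sum (f z) (V - {z}) = sum \<psi> (V - {z})"
      by (rule sum.cong) (auto simp: f_def)
    finally show ?thesis using \<psi> True by (simp add: preflow_def f_def)
  next
    case False
    moreover have "\<forall>x\<in>V - {z}. \<forall>y\<in>V - {z}. x = y"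
      using c D(2) card_le_Suc0_iff_eq[of "V - {z}"] by simp
    ultimately have V: "V - {z} = {v}" using that by auto
    have V': "V = {z, v}" using D(3) V by auto
    have "sum (f v) V = - \<psi> v" using False by (simp add: V' f_def)
    moreover have "6 dvd \<psi> v - t z" using \<psi> by (simp add: preflow_def V)
    moreover have "6 dvd t z + t v" using D(7) False by (simp add: V')
    ultimately show ?thesis by presburger
  qed
  moreover have "f a b \<in> netset (\<mu> a b)" if "a \<in> V" "b \<in> V" "a \<noteq> b" for a b
  proof (cases "a = z \<or> b = z")
    case True
    then show ?thesis using that \<psi> D(4) by (auto simp: f_def preflow_def netset_minus)
  next
    case False
    then have "a \<in> V - {z}" "b \<in> V - {z}" using that by auto
    then have "a = b" using c D(2)
      by (metis One_nat_def card_le_Suc0_iff_eq finite_Diff)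
    then show ?thesis using that by simp
  qed
  ultimately have "flow V \<mu> t f" unfolding flow_def by (auto simp: f_def)
  then show ?thesis unfolding extendable_def by (intro exI[of _ f]) (auto simp: f_def)
qed

lemma flowD:
  assumes "flow V \<mu> t f"
  shows "\<And>a b. a \<in> V \<Longrightarrow> b \<in> V \<Longrightarrow> f a b = - f b a"
    and "\<And>a b. a \<in> V \<Longrightarrow> b \<in> V \<Longrightarrow> a \<noteq> b \<Longrightarrow> f a b \<in> netset (\<mu> a b)"
    and "\<And>v. v \<in> V \<Longrightarrow> 6 dvd sum (f v) V - t v"
  using assms unfolding flow_def by blast+

lemma onto_tip_image: "A \<subseteq> V - {z} \<Longrightarrow> z \<in> V \<Longrightarrow> onto_tip z A ` V = insert z A"
  by (auto simp: onto_tip_def)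

lemma onto_tip_fiber:
  assumes "A \<subseteq> V - {z}" "z \<in> V"
  shows "a \<in> A \<Longrightarrow> {u \<in> V. onto_tip z A u = a} = {a}"
    and "{u \<in> V. onto_tip z A u = z} = V - A"
  using assms by (auto simp: onto_tip_def)

lemma quot_onto_tip:
  assumes "A \<subseteq> V - {z}" "z \<in> V"
  shows "a \<in> A \<Longrightarrow> b \<in> A \<Longrightarrow> quot_mult V (onto_tip z A) \<mu> a b = \<mu> a b"
    and "b \<in> A \<Longrightarrow> quot_mult V (onto_tip z A) \<mu> z b = (\<Sum>w\<in>V - A. \<mu> w b)"
    and "a \<in> A \<Longrightarrow> quot_sum V (onto_tip z A) t a = t a"
    and "quot_sum V (onto_tip z A) t z = sum t (V - A)"
  by (simp_all add: quot_mult_def quot_sum_def onto_tip_fiber[OF assms] ecount_def)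

lemma inst_onto_tip:
  assumes "inst V z \<mu> t" "A \<subseteq> V - {z}"
  shows "inst (insert z A) z (quot_mult V (onto_tip z A) \<mu>) (quot_sum V (onto_tip z A) t)"
proof -
  have "onto_tip z A z = z" by (simp add: onto_tip_def)
  then show ?thesis
    using inst_quot[OF assms(1), of "onto_tip z A"] onto_tip_image[OF assms(2) instD(3)[OF assms(1)]]
    by simp
qed

section \<open>Preflows in quotients and the gluing of flows\<close>

lemma preflow_quot:
  assumes I: "inst V z \<mu> t" and \<psi>: "preflow V z \<mu> t \<psi>"
    and h: "h z = z" "\<And>u. u \<in> V - {z} \<Longrightarrow> h u \<noteq> z"
  shows "preflow (h ` V) z (quot_mult V h \<mu>) (quot_sum V h t) (quot_sum (V - {z}) h \<psi>)"
proof -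
  note D = instD[OF I]
  have fib: "{u \<in> V. h u = z} = {z}" using h D(3) by auto
  have img: "h ` V - {z} = h ` (V - {z})" using h D(3) by auto
  have "quot_sum (V - {z}) h \<psi> b \<in> netset (quot_mult V h \<mu> z b)" if "b \<in> h ` V - {z}" for b
  proof -
    have "{w \<in> V. h w = b} = {w \<in> V - {z}. h w = b}" using that h by auto
    then show ?thesis
      unfolding quot_mult_def quot_sum_def ecount_def fib
      using \<psi> by (auto intro!: netset_sum simp: preflow_def)
  qed
  moreover have "sum (quot_sum (V - {z}) h \<psi>) (h ` V - {z}) = sum \<psi> (V - {z})"
    by (subst sum_quot_sum) (use D(2) in \<open>auto simp: img intro!: sum.cong\<close>)
  moreover have "quot_sum V h t z = t z" unfolding quot_sum_def fib by simp
  ultimately show ?thesis using \<psi> unfolding preflow_def by simp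
qed

definition collapse :: "'v set \<Rightarrow> 'v \<Rightarrow> 'v \<Rightarrow> 'v" where
  "collapse A a0 u = (if u \<in> A then a0 else u)"

text \<open>A flow of the contraction of \<open>A\<close> prescribes the edges leaving
  \<open>A\<close>. Distributed over the original edges they form a preflow of the instance on
  \<open>A\<close>, whose condition at the tip holds because all requirements sum to 0. By
  \<open>res\<close> it extends inside \<open>A\<close>, and the two flows fit together.\<close>

lemma extendable_glue:
  assumes I: "inst V z \<mu> t" and \<psi>: "preflow V z \<mu> t \<psi>"
    and A: "A \<subseteq> V - {z}" "a0 \<in> A"
    and con: "extendable (collapse A a0 ` V) z (quot_mult V (collapse A a0) \<mu>)
      (quot_sum V (collapse A a0) t) (quot_sum (V - {z}) (collapse A a0) \<psi>)"
    and res: "\<And>\<psi>'. preflow (insert z A) z (quot_mult V (onto_tip z A) \<mu>) (quot_sum V (onto_tip z A) t) \<psi>' \<Longrightarrow>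
      extendable (insert z A) z (quot_mult V (onto_tip z A) \<mu>) (quot_sum V (onto_tip z A) t) \<psi>'"
  shows "extendable V z \<mu> t \<psi>"
proof -
  note D = instD[OF I]
  let ?c = "collapse A a0"
  have z: "z \<in> V" "z \<notin> A" using A D by auto
  have fin: "finite A" "finite (V - A)"
    using A D(2) finite_subset[of A V] by auto
  have cV: "?c ` V = insert a0 (V - A)" using A by (auto simp: collapse_def)
  have fib0: "{u \<in> V. ?c u = a0} = A" using A by (auto simp: collapse_def)
  have fib: "{u \<in> V. ?c u = w} = {w}" if "w \<in> V - A" for w
    using A that by (auto simp: collapse_def)
  have q0: "quot_mult V ?c \<mu> w a0 = (\<Sum>a\<in>A. \<mu> w a)" if "w \<in> V - A" for w
    by (simp add: quot_mult_def fib0 fib[OF that] ecount_def)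
  have q: "quot_mult V ?c \<mu> w b = \<mu> w b" if "w \<in> V - A" "b \<in> V - A" for w b
    by (simp add: quot_mult_def fib[OF that(1)] fib[OF that(2)] ecount_def)
  obtain f' where f': "flow (?c ` V) (quot_mult V ?c \<mu>) (quot_sum V ?c t) f'"
    and f'z: "\<And>u. u \<in> ?c ` V - {z} \<Longrightarrow> f' z u = quot_sum (V - {z}) ?c \<psi> u"
    using con unfolding extendable_def by auto
  note F' = flowD[OF f']
  \<comment> \<open>The edges from \<open>w\<close> into \<open>A\<close> were merged into one
    bundle ending in \<open>a0\<close>. At the tip there is no freedom: their values have to be
    those of \<open>\<psi>\<close>.\<close>
  have "\<exists>g. (\<forall>a\<in>A. g a \<in> netset (\<mu> w a)) \<and> sum g A = f' w a0 \<and> (w = z \<longrightarrow> (\<forall>a\<in>A. g a = \<psi> a))"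
    if "w \<in> V - A" for w
  proof (cases "w = z")
    case True
    have "{u \<in> V - {z}. ?c u = a0} = A" using fib0 A by auto
    then have "f' z a0 = sum \<psi> A"
      using f'z[of a0] A z by (simp add: cV quot_sum_def) blast
    then show ?thesis using \<psi> A True unfolding preflow_def by (intro exI[of _ \<psi>]) auto
  next
    case False
    have "f' w a0 \<in> netset (\<Sum>a\<in>A. \<mu> w a)"
      using F'(2)[of w a0] that A by (auto simp: cV q0)
    then show ?thesis
      by (rule netset_split_sum[OF fin(1)]) (use D(5) False in auto)
  qed
  then obtain g where g: "\<And>w a. w \<in> V - A \<Longrightarrow> a \<in> A \<Longrightarrow> g w a \<in> netset (\<mu> w a)"
    "\<And>w. w \<in> V - A \<Longrightarrow> sum (g w) A = f' w a0" "\<And>a. a \<in> A \<Longrightarrow> g z a = \<psi> a"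
    using z by (metis DiffI)
  define \<psi>' where "\<psi>' a = (\<Sum>w\<in>V - A. g w a)" for a
  have "6 dvd sum \<psi>' A - sum t (V - A)"
  proof -
    have "sum \<psi>' A = (\<Sum>w\<in>V - A. f' w a0)"
      unfolding \<psi>'_def by (subst sum.swap) (simp add: g(2))
    also have "\<dots> = - (\<Sum>w\<in>V - A. f' a0 w)"
      unfolding sum_negf[symmetric] by (rule sum.cong[OF refl], rule F'(1)) (auto simp: cV)
    also have "(\<Sum>w\<in>V - A. f' a0 w) = sum (f' a0) (?c ` V)"
      using F'(1)[of a0 a0] fin A by (simp add: cV)
    finally have "sum \<psi>' A = - sum (f' a0) (?c ` V)" .
    moreover have "6 dvd sum (f' a0) (?c ` V) - sum t A"
      using F'(3)[of a0] by (simp add: cV quot_sum_def fib0)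
    moreover have "sum t V = sum t (V - A) + sum t A"
      using A D(2) by (intro sum.subset_diff) auto
    ultimately show ?thesis using D(7) by presburger
  qed
  then have "preflow (insert z A) z (quot_mult V (onto_tip z A) \<mu>) (quot_sum V (onto_tip z A) t) \<psi>'"
    unfolding preflow_def \<psi>'_def using z
    by (auto simp: quot_onto_tip[OF A(1) z(1)] intro!: netset_sum g)
  then obtain f'' where f'': "flow (insert z A) (quot_mult V (onto_tip z A) \<mu>) (quot_sum V (onto_tip z A) t) f''"
    and f''z: "\<And>a. a \<in> A \<Longrightarrow> f'' z a = \<psi>' a"
    using res z unfolding extendable_def by force
  note F'' = flowD[OF f'']
  define f where "f a b = (if a \<in> A then if b \<in> A then f'' a b else - g b a
    else if b \<in> A then g a b else f' a b)" for a b
  have VA: "sum k V = sum k (V - A) + sum k A" for k :: "_ \<Rightarrow> int"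
    using A D(2) by (intro sum.subset_diff) auto
  have "f a b = - f b a" if "a \<in> V" "b \<in> V" for a b
    using that F'(1)[of a b] F''(1)[of a b] by (auto simp: f_def cV)
  moreover have "f a b \<in> netset (\<mu> a b)" if "a \<in> V" "b \<in> V" "a \<noteq> b" for a b
    using that F'(2)[of a b] F''(2)[of a b] g(1)[of a b] g(1)[of b a] A
    by (auto simp: f_def cV q quot_onto_tip[OF A(1) z(1)] netset_minus D(4)[of a b])
  moreover have "6 dvd sum (f v) V - t v" if "v \<in> V" for v
  proof (cases "v \<in> A")
    case True
    have "sum (f v) V = (\<Sum>w\<in>V - A. - g w v) + sum (f'' v) A"
      unfolding VA by (intro arg_cong2[of _ _ _ _ "(+)"] sum.cong) (auto simp: f_def True)
    also have "(\<Sum>w\<in>V - A. - g w v) = f'' v z"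
      using F''(1)[of v z] f''z[OF True] True by (simp add: sum_negf \<psi>'_def)
    also have "f'' v z + sum (f'' v) A = sum (f'' v) (insert z A)"
      using z fin by simp
    finally show ?thesis
      using F''(3)[of v] True by (simp add: quot_onto_tip[OF A(1) z(1)])
  next
    case False
    have "sum (f v) V = sum (f' v) (V - A) + sum (g v) A"
      unfolding VA by (intro arg_cong2[of _ _ _ _ "(+)"] sum.cong) (auto simp: f_def False)
    also have "\<dots> = sum (f' v) (?c ` V)"
      using g(2)[of v] that False A fin by (simp add: cV)
    finally show ?thesis
      using F'(3)[of v] that False fib[of v] by (simp add: cV quot_sum_def)
  qed
  moreover have "f z u = \<psi> u" if "u \<in> V - {z}" for u
  proof (cases "u \<in> A")
    case False
    have "{w \<in> V - {z}. ?c w = u} = {u}" using fib[of u] that False by auto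
    then show ?thesis
      using f'z[of u] that False z by (simp add: f_def cV quot_sum_def)
  qed (use z g in \<open>simp add: f_def\<close>)
  ultimately show ?thesis unfolding extendable_def flow_def by blast
qed

text \<open>Take \<open>h\<close> with the smallest image. By the contrapositive of
  \<open>extendable_glue\<close>, a set violating criticality there could be collapsed without
  making the preflow extendable, and the image would shrink.\<close>

lemma critical_quotient:
  assumes I: "inst V z \<mu> t" and \<psi>: "preflow V z \<mu> t \<psi>" and ne: "\<not> extendable V z \<mu> t \<psi>"
  obtains h where "h z = z" "\<And>u. u \<in> V - {z} \<Longrightarrow> h u \<noteq> z"
    "critical (h ` V) z (quot_mult V h \<mu>) (quot_sum V h t)" "2 \<le> card (h ` V - {z})"
proof -
  note D = instD[OF I]
  define Q where "Q h \<longleftrightarrow> h z = z \<and> (\<forall>u\<in>V - {z}. h u \<noteq> z) \<and>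
    \<not> extendable (h ` V) z (quot_mult V h \<mu>) (quot_sum V h t) (quot_sum (V - {z}) h \<psi>)" for h
  have "extendable V z (quot_mult V id \<mu>) (quot_sum V id t) (quot_sum (V - {z}) id \<psi>) \<longleftrightarrow> extendable V z \<mu> t \<psi>"
  proof (rule extendable_cong)
    have fib: "{u \<in> X. id u = a} = {a}" if "a \<in> X" for a and X :: "'a set"
      using that by auto
    show "quot_mult V id \<mu> a b = \<mu> a b" if "a \<in> V" "b \<in> V" for a b
      by (simp only: quot_mult_def fib[OF that(1)] fib[OF that(2)] ecount_def) simp
    show "quot_sum V id t a = t a" if "a \<in> V" for a
      by (simp only: quot_sum_def fib[OF that]) simp
    show "quot_sum (V - {z}) id \<psi> a = \<psi> a" if "a \<in> V - {z}" for a
      by (simp only: quot_sum_def fib[OF that]) simp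
  qed
  then have "Q id" using ne by (simp add: Q_def)
  then obtain h where h: "Q h" and min: "\<And>h'. Q h' \<Longrightarrow> card (h ` V) \<le> card (h' ` V)"
    using ex_has_least_nat[of Q id "\<lambda>h. card (h ` V)"] by blast
  have hz: "h z = z" "\<And>u. u \<in> V - {z} \<Longrightarrow> h u \<noteq> z" using h by (auto simp: Q_def)
  have J: "inst (h ` V) z (quot_mult V h \<mu>) (quot_sum V h t)"
    using inst_quot[OF I, of h] hz by simp
  have J\<psi>: "preflow (h ` V) z (quot_mult V h \<mu>) (quot_sum V h t) (quot_sum (V - {z}) h \<psi>)"
    by (rule preflow_quot[OF I \<psi>]) (use hz in auto)
  have img: "h ` V - {z} = h ` (V - {z})" using hz D(3) by auto
  have crit: "critical (h ` V) z (quot_mult V h \<mu>) (quot_sum V h t)"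
    unfolding critical_def
  proof (intro allI impI, rule ccontr)
    fix A assume A: "A \<subseteq> h ` V - {z} \<and> 2 \<le> card A"
    assume no: "\<not> (\<exists>\<psi>'. preflow (insert z A) z (quot_mult (h ` V) (onto_tip z A) (quot_mult V h \<mu>))
        (quot_sum (h ` V) (onto_tip z A) (quot_sum V h t)) \<psi>' \<and>
        \<not> extendable (insert z A) z (quot_mult (h ` V) (onto_tip z A) (quot_mult V h \<mu>))
        (quot_sum (h ` V) (onto_tip z A) (quot_sum V h t)) \<psi>')"
    have finA: "finite A" using A by (metis card.infinite not_numeral_le_zero)
    obtain a0 where a0: "a0 \<in> A" using A by fastforce
    have "A \<noteq> {a0}" using A by auto
    then obtain a1 where a1: "a1 \<in> A" "a1 \<noteq> a0" using a0 by auto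
    let ?c = "collapse A a0"
    have "\<not> extendable (?c ` h ` V) z (quot_mult (h ` V) ?c (quot_mult V h \<mu>))
        (quot_sum (h ` V) ?c (quot_sum V h t)) (quot_sum (h ` V - {z}) ?c (quot_sum (V - {z}) h \<psi>))"
      using extendable_glue[OF J J\<psi> conjunct1[OF A] a0] h no unfolding Q_def by blast
    then have "\<not> extendable ((?c \<circ> h) ` V) z (quot_mult V (?c \<circ> h) \<mu>)
        (quot_sum V (?c \<circ> h) t) (quot_sum (V - {z}) (?c \<circ> h) \<psi>)"
      using D(2) by (simp add: quot_mult_comp quot_sum_comp img image_comp)
    moreover have "(?c \<circ> h) z = z" "\<And>u. u \<in> V - {z} \<Longrightarrow> (?c \<circ> h) u \<noteq> z"
      using A a0 hz unfolding comp_def collapse_def by (metis DiffE singletonI subsetD)+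
    ultimately have "Q (?c \<circ> h)" unfolding Q_def by blast
    then have "card (h ` V) \<le> card (?c ` h ` V)"
      using min by (metis image_comp)
    moreover have "?c ` h ` V \<subset> h ` V"
      using a0 a1 A by (auto simp: collapse_def)
    ultimately show False using D(2) by (meson finite_imageI leD psubset_card_mono)
  qed
  have "2 \<le> card (h ` V - {z})"
    using extendable_trivial[OF J J\<psi>] h unfolding Q_def by fastforce
  then show ?thesis using that hz crit by blast
qed

text \<open>Apply criticality to \<open>{x, y}\<close>. Two edges between them could carry whatever
  \<open>x\<close> still needs (\<open>netset_residue\<close>), and \<open>y\<close> is then
  satisfied because all requirements sum to 0; so every preflow would extend.\<close>

lemma critical_edge_mult:
  assumes I: "inst V z \<mu> t" and crit: "critical V z \<mu> t"
    and xy: "x \<in> V - {z}" "y \<in> V - {z}" "x \<noteq> y"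
  shows "\<mu> x y \<le> 1"
proof (rule ccontr)
  assume "\<not> \<mu> x y \<le> 1"
  note D = instD[OF I]
  let ?A = "{x, y}"
  let ?m = "quot_mult V (onto_tip z ?A) \<mu>" and ?t = "quot_sum V (onto_tip z ?A) t"
  have A: "?A \<subseteq> V - {z}" "z \<in> V" using xy D by auto
  obtain \<psi> where \<psi>: "preflow (insert z ?A) z ?m ?t \<psi>" and ne: "\<not> extendable (insert z ?A) z ?m ?t \<psi>"
    using crit A xy unfolding critical_def by (metis card_2_iff order_refl)
  have J: "inst (insert z ?A) z ?m ?t"
    by (rule inst_onto_tip[OF I A(1)])
  note DJ = instD[OF J]
  have zxy: "z \<noteq> x" "z \<noteq> y" using xy by auto
  have mxy: "?m x y = \<mu> x y" by (rule quot_onto_tip(1)[OF A]) auto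
  have par: "even (?m x y - (?t x + \<psi> x))"
  proof -
    have "insert z ?A - {x} = {z, y}" using xy by auto
    then have "cut (insert z ?A) ?m {x} = ?m x z + ?m x y"
      using zxy by (simp add: cut_def)
    moreover have "even (?m z x - \<psi> x)"
      using \<psi> zxy unfolding preflow_def netset_def by auto
    moreover have "even (?t x + cut (insert z ?A) ?m {x})" by (rule DJ(6)) auto
    ultimately show ?thesis using DJ(4)[of x z] by auto
  qed
  obtain s where s: "s \<in> netset (?m x y)" "6 dvd s - (?t x + \<psi> x)"
    by (rule netset_residue[OF _ par]) (use \<open>\<not> \<mu> x y \<le> 1\<close> mxy in auto)
  define f where "f a b = (if a = z \<and> b \<noteq> z then \<psi> b else if a \<noteq> z \<and> b = z then - \<psi> a
    else if a = x \<and> b = y then s else if a = y \<and> b = x then - s else 0)" for a b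
  have Uz: "insert z ?A - {z} = {x, y}" using zxy by auto
  have px: "6 dvd \<psi> x + \<psi> y - ?t z" using \<psi> xy(3) unfolding preflow_def Uz by simp
  have tot: "6 dvd ?t z + ?t x + ?t y" using DJ(7) zxy xy(3) by (simp add: add.assoc)
  have "6 dvd sum (f v) (insert z ?A) - ?t v" if "v \<in> insert z ?A" for v
  proof -
    have "sum (f v) (insert z ?A) = f v z + f v x + f v y" using zxy xy(3) by simp
    moreover have "- s - \<psi> y - ?t y = - (\<psi> x + \<psi> y - ?t z) - (s - (?t x + \<psi> x)) - (?t z + ?t x + ?t y)"
      by simp
    then have "6 dvd - s - \<psi> y - ?t y" using s(2) px tot by (simp only: dvd_diff dvd_minus_iff)
    moreover have "6 dvd - \<psi> x + s - ?t x" using s(2) by (simp add: algebra_simps)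
    ultimately show ?thesis using that zxy xy(3) px
      by (auto simp: f_def)
  qed
  moreover have "f a b \<in> netset (?m a b)" if "a \<in> insert z ?A" "b \<in> insert z ?A" "a \<noteq> b" for a b
  proof -
    have "\<psi> x \<in> netset (?m z x)" "\<psi> y \<in> netset (?m z y)" using \<psi> unfolding preflow_def Uz by auto
    moreover have "?m x z = ?m z x" "?m y z = ?m z y" "?m y x = ?m x y" by (rule DJ(4))+
    moreover have "a = z \<and> b = x \<or> a = x \<and> b = z \<or> a = z \<and> b = y \<or> a = y \<and> b = z \<or> a = x \<and> b = y \<or> a = y \<and> b = x"
      using that by auto
    ultimately show ?thesis
      using zxy xy(3) s(1) by (elim disjE conjE) (simp_all add: f_def netset_minus)
  qed
  moreover have "f a b = - f b a" for a b
    unfolding f_def using zxy xy(3) by simp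
  ultimately have "flow (insert z ?A) ?m ?t f"
    unfolding flow_def by blast
  then have "extendable (insert z ?A) z ?m ?t \<psi>"
    unfolding extendable_def using zxy by (intro exI[of _ f]) (auto simp: f_def)
  then show False using ne by blast
qed

section \<open>Reductions preserving non-extendability\<close>

text \<open>The common form of undoing a reduction: a flow of the reduced instance plus a fixed
  correction \<open>g\<close> is a flow of the original one. On tip edges \<open>net\<close> may use
  the value prescribed by \<open>\<psi>'\<close>, since an extension has no choice there.\<close>

lemma extendable_shift:
  assumes ext: "extendable V z \<mu>' t' \<psi>'"
    and g: "\<And>a b. g a b = - g b a"
    and net: "\<And>a b s. a \<in> V \<Longrightarrow> b \<in> V \<Longrightarrow> a \<noteq> b \<Longrightarrow> s \<in> netset (\<mu>' a b) \<Longrightarrow>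
      (a = z \<Longrightarrow> s = \<psi>' b) \<Longrightarrow> (b = z \<Longrightarrow> s = - \<psi>' a) \<Longrightarrow> s + g a b \<in> netset (\<mu> a b)"
    and sums: "\<And>v. v \<in> V \<Longrightarrow> sum (g v) V = t v - t' v"
    and tip: "\<And>u. u \<in> V - {z} \<Longrightarrow> \<psi> u = \<psi>' u + g z u"
    and z: "z \<in> V"
  shows "extendable V z \<mu> t \<psi>"
proof -
  obtain f where f: "flow V \<mu>' t' f" and fz: "\<And>u. u \<in> V - {z} \<Longrightarrow> f z u = \<psi>' u"
    using ext unfolding extendable_def by blast
  note F = flowD[OF f]
  define f' where "f' a b = f a b + g a b" for a b
  have "f' a b = - f' b a" if "a \<in> V" "b \<in> V" for a b
    using F(1)[OF that] g[of a b] by (simp add: f'_def)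
  moreover have "f' a b \<in> netset (\<mu> a b)" if "a \<in> V" "b \<in> V" "a \<noteq> b" for a b
    unfolding f'_def
    by (rule net[OF that F(2)[OF that]]) (use fz F(1)[OF that(1,2)] that z in auto)
  moreover have "6 dvd sum (f' v) V - t v" if "v \<in> V" for v
    using F(3)[OF that] sums[OF that] by (simp add: f'_def sum.distrib)
  ultimately have "flow V \<mu> t f'" unfolding flow_def by blast
  then show ?thesis
    unfolding extendable_def using fz tip by (intro exI[of _ f']) (auto simp: f'_def)
qed

definition del_star :: "'v \<Rightarrow> 'v set \<Rightarrow> ('v \<Rightarrow> 'v \<Rightarrow> int) \<Rightarrow> 'v \<Rightarrow> 'v \<Rightarrow> int" where
  "del_star z Y \<mu> a b = \<mu> a b - (if a = z \<and> b \<in> Y \<or> b = z \<and> a \<in> Y then 1 else 0)"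

text \<open>Every deleted edge has net value \<open>- s\<close> seen from the tip, so
  \<open>s = 1\<close> means directed into the tip. It contributed \<open>s\<close> to the outflow
  of its end \<open>y\<close> and \<open>- s\<close> to that of the tip, which \<open>t'\<close>
  takes back. Deleting several at once serves \<open>absorb\<close>.\<close>

lemma delete_tip_edges:
  fixes s :: int
  assumes I: "inst V z \<mu> t" and \<psi>: "preflow V z \<mu> t \<psi>" and ne: "\<not> extendable V z \<mu> t \<psi>"
    and Y: "Y \<subseteq> V - {z}" and s: "\<And>y. y \<in> Y \<Longrightarrow> \<psi> y + s \<in> netset (\<mu> z y - 1)"
    and t': "\<And>v. t' v = (if v = z then t z + s * int (card Y) else if v \<in> Y then t v - s else t v)"
    and s1: "odd s"
  obtains \<psi>' where "inst V z (del_star z Y \<mu>) t'" "preflow V z (del_star z Y \<mu>) t' \<psi>'"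
    "\<not> extendable V z (del_star z Y \<mu>) t' \<psi>'"
    "\<forall>A \<subseteq> V - {z}. cut V (del_star z Y \<mu>) A = cut V \<mu> A - int (card (Y \<inter> A))"
proof -
  note D = instD[OF I]
  let ?m = "del_star z Y \<mu>"
  define \<psi>' where "\<psi>' u = (if u \<in> Y then \<psi> u + s else \<psi> u)" for u
  have zY: "z \<notin> Y" and finY: "finite Y" using Y D(2) finite_subset[of Y V] by auto
  have pos: "1 \<le> \<mu> z y" if "y \<in> Y" for y using s[OF that] by (auto simp: netset_def)
  have mg: "multigraph V ?m"
  proof
    show "?m a b = ?m b a" for a b by (auto simp: del_star_def D(4)[of a b])
    show "0 \<le> ?m a b" for a b
      using D(5)[of a b] pos[of a] pos[of b] D(4)[of a z] by (auto simp: del_star_def)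
  qed (rule D(2))
  have cut: "cut V ?m A = cut V \<mu> A - int (card (Y \<inter> A))" if A: "A \<subseteq> V - {z}" for A
  proof -
    have finA: "finite A" using A D(2) finite_subset[of A V] by auto
    have "cut V ?m A = (\<Sum>a\<in>A. (\<Sum>b\<in>V - A. \<mu> a b) - (\<Sum>b\<in>V - A. if b = z then if a \<in> Y then 1 else 0 else 0))"
      unfolding cut_def sum_subtractf[symmetric]
      by (intro sum.cong refl) (use A in \<open>auto simp: del_star_def\<close>)
    also have "\<dots> = (\<Sum>a\<in>A. (\<Sum>b\<in>V - A. \<mu> a b) - (if a \<in> Y then 1 else 0))"
      by (intro sum.cong refl) (use A D in \<open>auto simp: sum.delta\<close>)
    also have "\<dots> = cut V \<mu> A - int (card (Y \<inter> A))"
      using finA by (simp add: cut_def sum_subtractf sum.If_cases Int_commute Int_def)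
    finally show ?thesis .
  qed
  have sumY: "(\<Sum>v\<in>V - {z}. if v \<in> Y then s else 0) = s * int (card Y)"
  proof -
    have "(V - {z}) \<inter> {v. v \<in> Y} = Y" using Y by auto
    then show ?thesis using D(2) by (simp add: sum.If_cases)
  qed
  have "even (t' v + cut V ?m {v})" if v: "v \<in> V" for v
  proof (cases "v = z")
    case True
    have "cut V ?m {z} = cut V \<mu> {z} - int (card Y)"
      using multigraph.cut_compl[OF mg, of "{z}"] multigraph.cut_compl[OF D(1), of "{z}"] cut[of "V - {z}"] Y D(3)
      by (simp add: Int_absorb2)
    then show ?thesis using D(6)[OF v] True s1 t' by simp
  next
    case False
    then have "cut V ?m {v} = cut V \<mu> {v} - (if v \<in> Y then 1 else 0)"
      using cut[of "{v}"] v by simp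
    then show ?thesis using D(6)[OF v] False s1 t' by simp
  qed
  moreover have "sum t' V = sum t V"
  proof -
    have "sum t' V = t' z + (\<Sum>v\<in>V - {z}. t v - (if v \<in> Y then s else 0))"
      using D(2,3) by (subst sum.remove[of _ z]) (auto simp: t' intro!: sum.cong split: if_splits)
    also have "\<dots> = t z + sum t (V - {z})" by (simp add: sum_subtractf sumY t')
    finally show ?thesis using D(2,3) by (simp add: sum.remove[of V z])
  qed
  ultimately have "inst V z ?m t'" unfolding inst_def using mg D(3,7) by auto
  moreover have "preflow V z ?m t' \<psi>'"
  proof -
    have "sum \<psi>' (V - {z}) = (\<Sum>v\<in>V - {z}. \<psi> v + (if v \<in> Y then s else 0))"
      by (intro sum.cong) (auto simp: \<psi>'_def)
    then have "sum \<psi>' (V - {z}) - t' z = sum \<psi> (V - {z}) - t z"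
      by (simp add: sum.distrib sumY t')
    then show ?thesis using \<psi> s zY unfolding preflow_def \<psi>'_def del_star_def by auto
  qed
  moreover have "\<not> extendable V z ?m t' \<psi>'"
  proof
    assume ext: "extendable V z ?m t' \<psi>'"
    define g where "g a b = (if a = z \<and> b \<in> Y then - s else if b = z \<and> a \<in> Y then s else 0)" for a b
    have "extendable V z \<mu> t \<psi>"
    proof (rule extendable_shift[OF ext, where g = g])
      show "g a b = - g b a" for a b using zY by (auto simp: g_def)
    next
      fix a b r
      assume ab: "a \<in> V" "b \<in> V" "a \<noteq> b" and r: "r \<in> netset (?m a b)"
        "a = z \<Longrightarrow> r = \<psi>' b" "b = z \<Longrightarrow> r = - \<psi>' a"
      consider "a = z" "b \<in> Y" | "b = z" "a \<in> Y" | "\<not> (a = z \<and> b \<in> Y)" "\<not> (b = z \<and> a \<in> Y)" by blast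
      then show "r + g a b \<in> netset (\<mu> a b)"
      proof cases
        case 1
        then show ?thesis using r Y \<psi> by (auto simp: g_def \<psi>'_def preflow_def)
      next
        case 2
        then have "r + g a b = - \<psi> a" using r zY by (auto simp: g_def \<psi>'_def)
        then show ?thesis using 2 Y \<psi> D(4)[of a z] by (auto simp: netset_minus preflow_def)
      next
        case 3
        then have "g a b = 0" "?m a b = \<mu> a b" by (auto simp: g_def del_star_def)
        then show ?thesis using r(1) by simp
      qed
    next
      fix v assume v: "v \<in> V"
      show "sum (g v) V = t v - t' v"
      proof (cases "v = z")
        case True
        have "sum (g v) V = - s * int (card (V \<inter> Y))"
          using D(2) True zY by (simp add: g_def sum.If_cases Int_def)
        moreover have "V \<inter> Y = Y" using Y by auto
        ultimately show ?thesis using True t' by simp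
      next
        case False
        have "sum (g v) V = (\<Sum>w\<in>V. if w = z then if v \<in> Y then s else 0 else 0)"
          by (intro sum.cong) (use False in \<open>auto simp: g_def\<close>)
        then show ?thesis using False D(2,3) t' by simp
      qed
    qed (use D Y zY in \<open>auto simp: g_def \<psi>'_def\<close>)
    then show False using ne by blast
  qed
  ultimately show ?thesis using that cut by blast
qed

section \<open>Changing the multiplicity of single edges\<close>

definition add_mult :: "'v \<Rightarrow> 'v \<Rightarrow> int \<Rightarrow> ('v \<Rightarrow> 'v \<Rightarrow> int) \<Rightarrow> 'v \<Rightarrow> 'v \<Rightarrow> int" where
  "add_mult x y d \<mu> a b = \<mu> a b + (if a = x \<and> b = y \<or> a = y \<and> b = x then d else 0)"

lemma add_mult_sym: "\<mu> a b = \<mu> b a \<Longrightarrow> add_mult x y d \<mu> a b = add_mult x y d \<mu> b a"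
  unfolding add_mult_def by (simp add: conj_commute disj_commute)

lemma cut_add_mult:
  assumes V: "finite V" "x \<in> V" "y \<in> V" "x \<noteq> y" and A: "A \<subseteq> V"
  shows "cut V (add_mult x y d \<mu>) A = cut V \<mu> A + (if (x \<in> A) \<noteq> (y \<in> A) then d else 0)"
proof -
  have fin: "finite A" "finite (V - A)" using V A finite_subset by auto
  have "cut V (add_mult x y d \<mu>) A = (\<Sum>a\<in>A. \<Sum>b\<in>V - A. \<mu> a b +
      ((if b = y then if a = x then d else 0 else 0) + (if b = x then if a = y then d else 0 else 0)))"
    unfolding cut_def by (intro sum.cong refl) (use V in \<open>auto simp: add_mult_def\<close>)
  also have "\<dots> = cut V \<mu> A + (\<Sum>a\<in>A. (if a = x then if y \<in> V - A then d else 0 else 0) +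
      (if a = y then if x \<in> V - A then d else 0 else 0))"
    unfolding cut_def sum.distrib using fin V
    by (auto simp: sum.delta intro!: arg_cong2[of _ _ _ _ "(+)"] sum.cong)
  also have "\<dots> = cut V \<mu> A + (if (x \<in> A) \<noteq> (y \<in> A) then d else 0)"
    unfolding sum.distrib using fin V by (simp add: sum.delta)
  finally show ?thesis .
qed

definition unit_flow :: "'v \<Rightarrow> 'v \<Rightarrow> 'v \<Rightarrow> 'v \<Rightarrow> int" where
  "unit_flow x y a b = (if a = x \<and> b = y then 1 else 0) - (if a = y \<and> b = x then 1 else 0)"

lemma unit_flow_anti: "unit_flow x y a b = - unit_flow x y b a"
  by (simp add: unit_flow_def conj_commute)

lemma sum_unit_flow:
  assumes "finite V" "x \<in> V" "y \<in> V"
  shows "sum (unit_flow x y v) V = (if v = x then 1 else 0) - (if v = y then 1 else 0)"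
proof -
  have "sum (unit_flow x y v) V = (\<Sum>w\<in>V. (if w = y then if v = x then 1 else 0 else 0) -
      (if w = x then if v = y then 1 else 0 else 0))"
    by (intro sum.cong) (auto simp: unit_flow_def)
  then show ?thesis using assms by (simp add: sum_subtractf)
qed

text \<open>The preflow says nothing about an edge between non-tip vertices, so its direction can be
  chosen before it is deleted, here from \<open>x\<close> to \<open>y\<close>. A flow of the rest is
  completed by putting it back in this direction.\<close>

lemma delete_edge:
  assumes I: "inst V z \<mu> t" and \<psi>: "preflow V z \<mu> t \<psi>" and ne: "\<not> extendable V z \<mu> t \<psi>"
    and xy: "x \<in> V - {z}" "y \<in> V - {z}" "x \<noteq> y" "1 \<le> \<mu> x y"
    and t': "t' = t(x := t x - 1, y := t y + 1)"
  shows "inst V z (add_mult x y (-1) \<mu>) t'" "preflow V z (add_mult x y (-1) \<mu>) t' \<psi>"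
    "\<not> extendable V z (add_mult x y (-1) \<mu>) t' \<psi>"
proof -
  note D = instD[OF I]
  let ?m = "add_mult x y (-1) \<mu>"
  have V: "x \<in> V" "y \<in> V" "x \<noteq> z" "y \<noteq> z" using xy by auto
  have mg: "multigraph V ?m"
  proof
    show "?m a b = ?m b a" for a b by (intro add_mult_sym D(4))
    show "0 \<le> ?m a b" for a b
      using D(5)[of a b] xy(4) D(4)[of x y] by (auto simp: add_mult_def)
  qed (rule D(2))
  have cut1: "cut V ?m {v} = cut V \<mu> {v} - (if v = x \<or> v = y then 1 else 0)" if "v \<in> V" for v
    using cut_add_mult[OF D(2) V(1,2) xy(3), of "{v}"] that xy(3) by auto
  have "even (t' v + cut V ?m {v})" if "v \<in> V" for v
    using D(6)[OF that] cut1[OF that] t' xy(3) by auto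
  moreover have "sum t' V = sum t V"
  proof -
    have "V - {x} - {y} = V - {x, y}" by auto
    have "sum k V = k x + (k y + sum k (V - {x, y}))" for k :: "_ \<Rightarrow> int"
      using D(2) V xy(3) sum.remove[of V x k] sum.remove[of "V - {x}" y k] \<open>V - {x} - {y} = _\<close> by simp
    moreover have "sum t' (V - {x, y}) = sum t (V - {x, y})" by (rule sum.cong) (auto simp: t')
    ultimately show ?thesis using xy(3) by (simp add: t')
  qed
  ultimately show "inst V z ?m t'" unfolding inst_def using mg D(3,7) by auto
  show "preflow V z ?m t' \<psi>" using \<psi> V t' unfolding preflow_def by (auto simp: add_mult_def)
  show "\<not> extendable V z ?m t' \<psi>"
  proof
    assume ext: "extendable V z ?m t' \<psi>"
    have "extendable V z \<mu> t \<psi>"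
    proof (rule extendable_shift[OF ext, where g = "unit_flow x y"])
      show "unit_flow x y a b = - unit_flow x y b a" for a b by (rule unit_flow_anti)
    next
      fix a b r assume r: "r \<in> netset (?m a b)"
      show "r + unit_flow x y a b \<in> netset (\<mu> a b)"
        using r xy(3) by (auto simp: unit_flow_def add_mult_def netset_def D(4)[of x y] split: if_splits)
    next
      fix v
      show "sum (unit_flow x y v) V = t v - t' v"
        using D(2) V xy(3) t' by (simp add: sum_unit_flow)
    qed (use D V in \<open>auto simp: unit_flow_def\<close>)
    then show False using ne by blast
  qed
qed

text \<open>Splitting off the pair of edges \<open>xa\<close>, \<open>xb\<close> at \<open>x\<close>
  in favour of a new edge \<open>ab\<close>.\<close>

definition lift_mult :: "'v \<Rightarrow> 'v \<Rightarrow> 'v \<Rightarrow> ('v \<Rightarrow> 'v \<Rightarrow> int) \<Rightarrow> 'v \<Rightarrow> 'v \<Rightarrow> int" where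
  "lift_mult x a b \<mu> = add_mult a b 1 (add_mult x b (-1) (add_mult x a (-1) \<mu>))"

lemma cut_lift:
  assumes "finite V" "x \<in> V" "a \<in> V" "b \<in> V" "x \<noteq> a" "x \<noteq> b" "a \<noteq> b" "A \<subseteq> V"
  shows "cut V (lift_mult x a b \<mu>) A = cut V \<mu> A -
    (if (a \<in> A) = (b \<in> A) \<and> (x \<in> A) \<noteq> (a \<in> A) then 2 else 0)"
  using assms by (auto simp: lift_mult_def cut_add_mult)

text \<open>
  A flow on the new edge \<open>ab\<close> is rerouted through \<open>x\<close> along whichever direction the new
  edges between \<open>a\<close> and \<open>b\<close> can spare; at the tip the direction is the one prescribed by \<open>\<psi>\<close>.
\<close>

lemma lift_edges:
  assumes I: "inst V z \<mu> t" and \<psi>: "preflow V z \<mu> t \<psi>" and ne: "\<not> extendable V z \<mu> t \<psi>"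
    and x: "x \<in> V - {z}" and ab: "a \<in> V" "b \<in> V - {z}" "a \<noteq> b" "x \<noteq> a" "x \<noteq> b"
    and m: "1 \<le> \<mu> x a" "1 \<le> \<mu> x b"
  obtains \<psi>' where "inst V z (lift_mult x a b \<mu>) t" "preflow V z (lift_mult x a b \<mu>) t \<psi>'"
    "\<not> extendable V z (lift_mult x a b \<mu>) t \<psi>'"
proof -
  note D = instD[OF I]
  let ?m = "lift_mult x a b \<mu>"
  have V: "x \<in> V" "b \<in> V" "x \<noteq> z" "b \<noteq> z" using x ab by auto
  have mval: "?m u w = (if u = x \<and> w = a \<or> u = a \<and> w = x \<or> u = x \<and> w = b \<or> u = b \<and> w = x then \<mu> u w - 1
      else if u = a \<and> w = b \<or> u = b \<and> w = a then \<mu> u w + 1 else \<mu> u w)" for u w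
    using ab by (auto simp: lift_mult_def add_mult_def)
  have mg: "multigraph V ?m"
  proof
    show "?m u w = ?m w u" for u w unfolding lift_mult_def by (intro add_mult_sym D(4))
    show "0 \<le> ?m u w" for u w
      using D(5)[of u w] m D(4)[of x a] D(4)[of x b] by (auto simp: mval)
  qed (rule D(2))
  have "even (t v + cut V ?m {v})" if "v \<in> V" for v
    using D(6)[OF that] that ab V by (simp add: cut_lift[OF D(2) V(1) ab(1) V(2) ab(4,5,3)])
  then have inst: "inst V z ?m t" unfolding inst_def using mg D(3,7) by auto
  \<comment> \<open>The closed walk from \<open>a\<close> over \<open>x\<close> and \<open>b\<close>
    back to \<open>a\<close>. Adding it keeps all net outflows and moves a unit \<open>e\<close>
    from the new edge \<open>ab\<close> to the two old edges at \<open>x\<close>.\<close>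
  define cyc where "cyc e u w = e * (unit_flow a x u w + unit_flow x b u w + unit_flow b a u w)" for e u w
  have cyc_anti: "cyc e u w = - cyc e w u" for e u w
    unfolding cyc_def using unit_flow_anti[of a x u w] unit_flow_anti[of x b u w] unit_flow_anti[of b a u w]
    by (simp add: algebra_simps)
  have cyc_sum: "sum (cyc e v) V = 0" for e v
    unfolding cyc_def sum_distrib_left[symmetric] sum.distrib
    using D(2) V ab by (simp add: sum_unit_flow)
  have net: "r + cyc e u w \<in> netset (\<mu> u w)"
    if "e = 1 \<or> e = -1" "r \<in> netset (?m u w)" "u = a \<and> w = b \<Longrightarrow> r - e \<in> netset (\<mu> a b)"
      "u = b \<and> w = a \<Longrightarrow> r + e \<in> netset (\<mu> a b)" for e r u w
  proof -
    consider "u = a \<and> w = b \<or> u = b \<and> w = a" | "u = x \<and> w = a \<or> u = a \<and> w = x \<or> u = x \<and> w = b \<or> u = b \<and> w = x"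
      | "\<not> (u = a \<and> w = b)" "\<not> (u = b \<and> w = a)" "\<not> (u = x \<and> w = a)" "\<not> (u = a \<and> w = x)"
        "\<not> (u = x \<and> w = b)" "\<not> (u = b \<and> w = x)"
      by argo
    then show ?thesis
    proof cases
      case 1
      then show ?thesis using that D(4)[of a b] ab by (auto simp: cyc_def unit_flow_def)
    next
      case 2
      then have "?m u w = \<mu> u w - 1" "cyc e u w = 1 \<or> cyc e u w = -1"
        using ab that(1) by (auto simp: mval cyc_def unit_flow_def)
      then show ?thesis using that(2) by (auto simp: netset_def)
    next
      case 3
      then have "cyc e u w = 0" "?m u w = \<mu> u w"
        unfolding cyc_def unit_flow_def mval by (simp_all only: if_False simp_thms) simp
      then show ?thesis using that(2) by simp
    qed
  qed
  show ?thesis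
  proof (cases "a = z")
    case False
    have "preflow V z ?m t \<psi>" using \<psi> False V unfolding preflow_def by (simp add: mval)
    moreover have "\<not> extendable V z ?m t \<psi>"
    proof
      assume ext: "extendable V z ?m t \<psi>"
      then obtain f where f: "flow V ?m t f" and fz: "\<And>u. u \<in> V - {z} \<Longrightarrow> f z u = \<psi> u"
        unfolding extendable_def by blast
      note F = flowD[OF f]
      have "f a b \<in> netset (\<mu> a b + 1)" using F(2)[of a b] ab by (auto simp: mval)
      then obtain e where e: "e = 1 \<or> e = -1" "f a b - e \<in> netset (\<mu> a b)"
        by (rule netset_step) (rule D(5))
      define f' where "f' u w = f u w + cyc e u w" for u w
      have fba: "f b a + e = - (f a b - e)" using F(1)[of b a] ab by simp
      have "f' u w = - f' w u" if "u \<in> V" "w \<in> V" for u w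
        using F(1)[OF that] cyc_anti[of e u w] by (simp add: f'_def)
      moreover have "f' u w \<in> netset (\<mu> u w)" if "u \<in> V" "w \<in> V" "u \<noteq> w" for u w
        unfolding f'_def
        by (rule net[OF e(1) F(2)[OF that]]) (use e(2) fba in \<open>auto simp only: netset_minus\<close>)
      moreover have "6 dvd sum (f' v) V - t v" if "v \<in> V" for v
        using F(3)[OF that] cyc_sum[of e v] by (simp add: f'_def sum.distrib)
      moreover have "f' z u = \<psi> u" if "u \<in> V - {z}" for u
        using fz[OF that] V False by (simp add: f'_def cyc_def unit_flow_def)
      ultimately have "extendable V z \<mu> t \<psi>" unfolding extendable_def flow_def by blast
      then show False using ne by blast
    qed
    ultimately show ?thesis using that inst by blast
  next
    case True
    have "\<psi> x \<in> netset (\<mu> z x)" using \<psi> x unfolding preflow_def by blast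
    then have "\<psi> x \<in> netset ((\<mu> x a - 1) + 1)" by (simp add: True D(4)[of x z])
    then obtain e where e: "e = 1 \<or> e = -1" "\<psi> x - e \<in> netset (\<mu> x a - 1)"
      by (rule netset_step) (use m in simp)
    define \<psi>' where "\<psi>' = \<psi>(x := \<psi> x - e, b := \<psi> b + e)"
    have \<psi>b: "\<psi> b \<in> netset (\<mu> a b)" using \<psi> ab(2) True unfolding preflow_def by auto
    have "preflow V z ?m t \<psi>'"
    proof -
      have "\<psi>' u \<in> netset (?m z u)" if "u \<in> V - {z}" for u
      proof -
        have \<psi>u: "\<psi> u \<in> netset (\<mu> a u)" using \<psi> that True unfolding preflow_def by blast
        consider "u = x" | "u = b" | "u \<noteq> x" "u \<noteq> b" by blast
        then show ?thesis
        proof cases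
          case 1
          then show ?thesis using e(2) ab D(4)[of a x] by (simp add: \<psi>'_def mval True[symmetric])
        next
          case 2
          then show ?thesis using e(1) \<psi>u ab by (auto simp: \<psi>'_def mval netset_def True[symmetric])
        next
          case 3
          then show ?thesis using \<psi>u ab that by (simp add: \<psi>'_def mval True[symmetric])
        qed
      qed
      moreover have "sum \<psi>' (V - {z}) = sum \<psi> (V - {z})"
      proof -
        have "\<psi>' u = \<psi> u - (if u = x then e else 0) + (if u = b then e else 0)" for u
          using ab by (simp add: \<psi>'_def)
        then show ?thesis using D(2) V by (simp add: sum.distrib sum_subtractf)
      qed
      ultimately show ?thesis using \<psi> unfolding preflow_def by simp
    qed
    moreover have "\<not> extendable V z ?m t \<psi>'"
    proof
      assume ext: "extendable V z ?m t \<psi>'"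
      have "extendable V z \<mu> t \<psi>"
      proof (rule extendable_shift[OF ext, where g = "cyc e"])
        fix u w r
        assume uw: "u \<in> V" "w \<in> V" "u \<noteq> w" and r: "r \<in> netset (?m u w)"
          "u = z \<Longrightarrow> r = \<psi>' w" "w = z \<Longrightarrow> r = - \<psi>' u"
        show "r + cyc e u w \<in> netset (\<mu> u w)"
        proof (rule net[OF e(1) r(1)])
          show "r - e \<in> netset (\<mu> a b)" if "u = a \<and> w = b"
            using r(2) that True \<psi>b by (simp add: \<psi>'_def)
          show "r + e \<in> netset (\<mu> a b)" if "u = b \<and> w = a"
          proof -
            have "r + e = - \<psi> b" using r(3) that True by (simp add: \<psi>'_def)
            then show ?thesis using \<psi>b by (simp only: netset_minus)
          qed
        qed
      next
        show "cyc e u w = - cyc e w u" for u w by (rule cyc_anti)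
        show "sum (cyc e v) V = t v - t v" for v using cyc_sum by simp
        show "z \<in> V" by (rule D(3))
        show "\<psi> u = \<psi>' u + cyc e z u" for u
          using ab by (auto simp: cyc_def unit_flow_def \<psi>'_def True[symmetric])
      qed
      then show False using ne by blast
    qed
    ultimately show ?thesis using that inst by blast
  qed
qed

lemma cut_onto_tip:
  assumes "finite V" "z \<in> V" "A \<subseteq> V - {z}" "B \<subseteq> A"
  shows "cut (insert z A) (quot_mult V (onto_tip z A) \<mu>) B = cut V \<mu> B"
proof -
  have "cut (onto_tip z A ` V) (quot_mult V (onto_tip z A) \<mu>) B = cut V \<mu> {u \<in> V. onto_tip z A u \<in> B}"
    by (rule cut_quot) (use assms in \<open>auto simp: onto_tip_image\<close>)
  moreover have "{u \<in> V. onto_tip z A u \<in> B} = B" using assms by (auto simp: onto_tip_def)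
  ultimately show ?thesis using onto_tip_image[OF assms(3,2)] by simp
qed

text \<open>Fixing an orientation \<open>\<xi>\<close> of the remaining edges at \<open>x\<close>
  can only make extending harder, so non-extendability survives, and these edges become tip edges.
  The second assumption on \<open>\<xi>\<close> is the condition at \<open>x\<close>, where the
  edges to the tip contribute \<open>- \<psi> x\<close>.\<close>

lemma merge_into_tip:
  assumes I: "inst V z \<mu> t" and \<psi>: "preflow V z \<mu> t \<psi>" and ne: "\<not> extendable V z \<mu> t \<psi>"
    and x: "x \<in> V - {z}"
    and \<xi>: "\<And>y. y \<in> V - {z, x} \<Longrightarrow> \<xi> y \<in> netset (\<mu> x y)" "6 dvd sum \<xi> (V - {z, x}) - \<psi> x - t x"
  defines "A \<equiv> V - {z, x}"
  shows "preflow (insert z A) z (quot_mult V (onto_tip z A) \<mu>) (quot_sum V (onto_tip z A) t) (\<lambda>y. \<psi> y + \<xi> y)"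
    and "\<not> extendable (insert z A) z (quot_mult V (onto_tip z A) \<mu>) (quot_sum V (onto_tip z A) t) (\<lambda>y. \<psi> y + \<xi> y)"
proof -
  note D = instD[OF I]
  have A: "A \<subseteq> V - {z}" "z \<in> V" using D by (auto simp: A_def)
  have VA: "V - A = {z, x}" "x \<noteq> z" "x \<in> V" using x D(3) by (auto simp: A_def)
  have V: "V = insert z (insert x A)" "x \<notin> A" "z \<notin> A" using x D(3) by (auto simp: A_def)
  have finA: "finite A" using D(2) by (simp add: A_def)
  have Uz: "V - {z} = insert x A" "insert z A - {z} = A" using V VA by auto
  have \<psi>A: "\<psi> y \<in> netset (\<mu> z y)" if "y \<in> A" for y
    using \<psi> that unfolding preflow_def Uz by auto
  have \<psi>x: "\<psi> x \<in> netset (\<mu> z x)" using \<psi> unfolding preflow_def Uz by auto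
  have \<xi>A: "\<xi> y \<in> netset (\<mu> x y)" if "y \<in> A" for y using \<xi>(1) that by (simp add: A_def)
  have \<psi>s: "6 dvd \<psi> x + sum \<psi> A - t z" using \<psi> V finA unfolding preflow_def Uz by simp
  have \<xi>s: "6 dvd sum \<xi> A - \<psi> x - t x" using \<xi>(2) by (simp add: A_def)
  note q = quot_onto_tip[OF A]
  show "preflow (insert z A) z (quot_mult V (onto_tip z A) \<mu>) (quot_sum V (onto_tip z A) t) (\<lambda>y. \<psi> y + \<xi> y)"
  proof -
    have "(\<Sum>y\<in>A. \<psi> y + \<xi> y) - (t z + t x) = (\<psi> x + sum \<psi> A - t z) + (sum \<xi> A - \<psi> x - t x)"
      by (simp add: sum.distrib)
    then have "6 dvd (\<Sum>y\<in>A. \<psi> y + \<xi> y) - (t z + t x)" using \<psi>s \<xi>s by (simp only: dvd_add)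
    moreover have "\<psi> y + \<xi> y \<in> netset (quot_mult V (onto_tip z A) \<mu> z y)" if "y \<in> A" for y
    proof -
      have "quot_mult V (onto_tip z A) \<mu> z y = \<mu> z y + \<mu> x y"
        using VA by (simp add: q(2)[OF that])
      then show ?thesis using netset_add[OF \<psi>A[OF that] \<xi>A[OF that]] by simp
    qed
    moreover have "quot_sum V (onto_tip z A) t z = t z + t x"
      using VA by (simp add: q(4))
    ultimately show ?thesis unfolding preflow_def Uz by simp
  qed
  show "\<not> extendable (insert z A) z (quot_mult V (onto_tip z A) \<mu>) (quot_sum V (onto_tip z A) t) (\<lambda>y. \<psi> y + \<xi> y)"
  proof
    assume "extendable (insert z A) z (quot_mult V (onto_tip z A) \<mu>) (quot_sum V (onto_tip z A) t) (\<lambda>y. \<psi> y + \<xi> y)"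
    then obtain f where f: "flow (insert z A) (quot_mult V (onto_tip z A) \<mu>) (quot_sum V (onto_tip z A) t) f"
      and fz: "\<And>y. y \<in> A \<Longrightarrow> f z y = \<psi> y + \<xi> y"
      unfolding extendable_def Uz by blast
    note F = flowD[OF f]
    define k where "k a b = (if a = z then if b = x then \<psi> x else if b \<in> A then \<psi> b else 0
      else if a = x \<and> b \<in> A then \<xi> b else 0)" for a b
    define f' where "f' a b = (if a \<in> A \<and> b \<in> A then f a b else k a b - k b a)" for a b
    have anti: "f' a b = - f' b a" if "a \<in> V" "b \<in> V" for a b
      using F(1)[of a b] by (auto simp: f'_def)
    moreover have "f' a b \<in> netset (\<mu> a b)" if "a \<in> V" "b \<in> V" "a \<noteq> b" for a b
    proof -
      have half: "f' a b \<in> netset (\<mu> a b)"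
        if "a = z \<and> b = x \<or> a = z \<and> b \<in> A \<or> a = x \<and> b \<in> A \<or> a \<in> A \<and> b \<in> A" "a \<noteq> b" for a b
        using that(1)
      proof (elim disjE conjE)
        assume "a = z" "b = x"
        then show ?thesis using V VA \<psi>x by (simp add: f'_def k_def)
      next
        assume "a = z" "b \<in> A"
        then show ?thesis using V VA \<psi>A[of b] by (auto simp: f'_def k_def)
      next
        assume "a = x" "b \<in> A"
        then show ?thesis using V VA \<xi>A[of b] by (auto simp: f'_def k_def)
      next
        assume "a \<in> A" "b \<in> A"
        then show ?thesis using F(2)[of a b] that(2) by (simp add: f'_def q)
      qed
      have "(a = z \<and> b = x \<or> a = z \<and> b \<in> A \<or> a = x \<and> b \<in> A \<or> a \<in> A \<and> b \<in> A) \<or>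
          (b = z \<and> a = x \<or> b = z \<and> a \<in> A \<or> b = x \<and> a \<in> A \<or> b \<in> A \<and> a \<in> A)"
        using that V by auto
      then show ?thesis
        using half[of a b] half[of b a] anti[of a b] that D(4)[of a b] by (metis netset_minus)
    qed
    moreover have "6 dvd sum (f' v) V - t v" if v: "v \<in> V" for v
    proof -
      have S: "sum (f' v) V = f' v z + (f' v x + sum (f' v) A)"
        unfolding V(1) using finA V VA by simp
      consider "v = z" | "v = x" | "v \<in> A" using v V(1) by blast
      then show ?thesis
      proof cases
        case 1
        have "sum (f' v) A = sum \<psi> A"
          by (rule sum.cong) (use 1 V VA in \<open>auto simp: f'_def k_def\<close>)
        then show ?thesis using S 1 \<psi>s V VA by (simp add: f'_def k_def)
      next
        case 2
        have "sum (f' v) A = sum \<xi> A"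
          by (rule sum.cong) (use 2 V VA in \<open>auto simp: f'_def k_def\<close>)
        then show ?thesis using S 2 \<xi>s V VA by (simp add: f'_def k_def)
      next
        case 3
        then have "v \<noteq> z" "v \<noteq> x" using V by auto
        have "sum (f' v) A = sum (f v) A"
          by (rule sum.cong) (use 3 in \<open>auto simp: f'_def\<close>)
        moreover have "f' v z = - \<psi> v" "f' v x = - \<xi> v" using 3 V VA \<open>v \<noteq> z\<close> \<open>v \<noteq> x\<close> by (auto simp: f'_def k_def)
        moreover have "sum (f v) (insert z A) = f v z + sum (f v) A" using V finA by simp
        moreover have "f v z = - (\<psi> v + \<xi> v)" using F(1)[of v z] 3 fz by simp
        ultimately have "sum (f' v) V = sum (f v) (insert z A)" using S by simp
        then show ?thesis using F(3)[of v] 3 by (simp add: q)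
      qed
    qed
    moreover have "f' z u = \<psi> u" if "u \<in> V - {z}" for u
      using that V VA unfolding Uz by (auto simp: f'_def k_def)
    ultimately have "extendable V z \<mu> t \<psi>" unfolding extendable_def flow_def by blast
    then show False using ne by blast
  qed
qed

section \<open>Critical instances\<close>

text \<open>All is expressed by the set of non-tip vertices: its cut is the degree of the tip, and
  its sum of requirements is \<open>- t z\<close> modulo 6, which has the same \<open>dist6\<close>.
  In this form the bound for the contraction \<open>onto_tip z A\<close> is a statement about
  \<open>A\<close> in the original instance.\<close>

definition tip_bound :: "'v set \<Rightarrow> 'v \<Rightarrow> ('v \<Rightarrow> 'v \<Rightarrow> int) \<Rightarrow> ('v \<Rightarrow> int) \<Rightarrow> bool" where
  "tip_bound V z \<mu> t \<longleftrightarrow> 6 + dist6 (sum t (V - {z})) \<le> cut V \<mu> (V - {z}) \<and>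
     (\<forall>v\<in>V - {z}. cut V \<mu> {v} + 2 \<le> cut V \<mu> (V - {z}) \<and>
       (cut V \<mu> {v} + 2 = cut V \<mu> (V - {z}) \<longrightarrow> (\<forall>u\<in>V - {z} - {v}. cut V \<mu> {u} = 4)))"

text \<open>The tip is left out because merging a vertex into it may raise its degree. The summand 1
  makes the removal of a vertex a strict decrease whatever its degree is.\<close>

definition weight :: "'v set \<Rightarrow> 'v \<Rightarrow> ('v \<Rightarrow> 'v \<Rightarrow> int) \<Rightarrow> int" where
  "weight V z \<mu> = (\<Sum>u\<in>V - {z}. cut V \<mu> {u} + 1)"

text \<open>\<open>P v\<close> is the part of \<open>v\<close> in a partition of the vertices other than the tip.\<close>

definition tip_bound_parts ::
    "'v set \<Rightarrow> 'v \<Rightarrow> ('v \<Rightarrow> 'v \<Rightarrow> int) \<Rightarrow> ('v \<Rightarrow> int) \<Rightarrow> ('v \<Rightarrow> 'v set) \<Rightarrow> bool" where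
  "tip_bound_parts V z \<mu> t P \<longleftrightarrow> 6 + dist6 (sum t (V - {z})) \<le> cut V \<mu> (V - {z}) \<and>
     (\<forall>v\<in>V - {z}. v \<in> P v \<and> P v \<subset> V - {z} \<and> cut V \<mu> (P v) + 2 \<le> cut V \<mu> (V - {z}) \<and>
       (cut V \<mu> (P v) + 2 = cut V \<mu> (V - {z}) \<longrightarrow> (\<forall>u\<in>V - {z} - P v. cut V \<mu> (P u) = 4)))"

lemma weight_quot:
  assumes I: "inst V z \<mu> t" and h: "h z = z" "\<And>u. u \<in> V - {z} \<Longrightarrow> h u \<noteq> z"
  shows "weight (h ` V) z (quot_mult V h \<mu>) \<le> weight V z \<mu>"
proof -
  note D = instD[OF I]
  interpret multigraph V \<mu> by (rule D(1))
  have img: "h ` V - {z} = h ` (V - {z})" using h D(3) by auto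
  have "cut (h ` V) (quot_mult V h \<mu>) {b} + 1 \<le> (\<Sum>u\<in>{u \<in> V - {z}. h u = b}. cut V \<mu> {u} + 1)"
    if b: "b \<in> h ` (V - {z})" for b
  proof -
    have b': "b \<in> h ` V" "b \<noteq> z" using b h by auto
    have fib: "{u \<in> V. h u \<in> {b}} = {u \<in> V - {z}. h u = b}" using h b' by auto
    have "cut (h ` V) (quot_mult V h \<mu>) {b} = cut V \<mu> {u \<in> V - {z}. h u = b}"
      using cut_quot[OF D(2), of "{b}" h \<mu>] b' unfolding fib by simp
    also have "\<dots> \<le> (\<Sum>u\<in>{u \<in> V - {z}. h u = b}. cut V \<mu> {u})"
      by (rule cut_sum_singles(1)) auto
    finally have "cut (h ` V) (quot_mult V h \<mu>) {b} \<le> (\<Sum>u\<in>{u \<in> V - {z}. h u = b}. cut V \<mu> {u})" .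
    moreover have "card {u \<in> V - {z}. h u = b} \<noteq> 0" using b D(2) by auto
    ultimately show ?thesis by (simp add: sum.distrib)
  qed
  then have "weight (h ` V) z (quot_mult V h \<mu>) \<le>
      (\<Sum>b\<in>h ` (V - {z}). \<Sum>u\<in>{u \<in> V - {z}. h u = b}. cut V \<mu> {u} + 1)"
    unfolding weight_def img by (rule sum_mono)
  also have "\<dots> = weight V z \<mu>"
    unfolding weight_def using D(2) by (subst sum_fibers) (auto intro!: sum.cong)
  finally show ?thesis .
qed

lemma onto_tip_comp: "B \<subseteq> A \<Longrightarrow> onto_tip z B \<circ> onto_tip z A = onto_tip z B"
  by (auto simp: onto_tip_def fun_eq_iff)

text \<open>Contracting onto \<open>A\<close> and then onto a subset \<open>B\<close> of
  \<open>A\<close> is the same as contracting onto \<open>B\<close> at once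
  (\<open>onto_tip_comp\<close>).\<close>

lemma critical_onto_tip:
  assumes I: "inst V z \<mu> t" and crit: "critical V z \<mu> t" and A: "A \<subseteq> V - {z}"
  shows "critical (insert z A) z (quot_mult V (onto_tip z A) \<mu>) (quot_sum V (onto_tip z A) t)"
  unfolding critical_def
proof (intro allI impI)
  fix B assume B: "B \<subseteq> insert z A - {z} \<and> 2 \<le> card B"
  then have BA: "B \<subseteq> A" by auto
  note D = instD[OF I]
  have img: "insert z A = onto_tip z A ` V" using onto_tip_image[OF A D(3)] by simp
  have "quot_mult (insert z A) (onto_tip z B) (quot_mult V (onto_tip z A) \<mu>) = quot_mult V (onto_tip z B) \<mu>"
    "quot_sum (insert z A) (onto_tip z B) (quot_sum V (onto_tip z A) t) = quot_sum V (onto_tip z B) t"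
    unfolding img by (simp_all add: quot_mult_comp quot_sum_comp D(2) onto_tip_comp[OF BA])
  then show "\<exists>\<psi>. preflow (insert z B) z (quot_mult (insert z A) (onto_tip z B) (quot_mult V (onto_tip z A) \<mu>))
      (quot_sum (insert z A) (onto_tip z B) (quot_sum V (onto_tip z A) t)) \<psi> \<and>
      \<not> extendable (insert z B) z (quot_mult (insert z A) (onto_tip z B) (quot_mult V (onto_tip z A) \<mu>))
      (quot_sum (insert z A) (onto_tip z B) (quot_sum V (onto_tip z A) t)) \<psi>"
    using crit B A BA unfolding critical_def by (metis subset_trans)
qed

text \<open>One step of the induction on \<open>weight\<close>, with the induction hypothesis as an
  assumption. The tip can stay fixed because all quotients in use fix it.\<close>

locale critical_step =
  fixes V :: "'v set" and z :: 'v and \<mu> :: "'v \<Rightarrow> 'v \<Rightarrow> int" and t :: "'v \<Rightarrow> int"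
  assumes I: "inst V z \<mu> t" and crit: "critical V z \<mu> t"
    and tame1: "v \<in> V - {z} \<Longrightarrow> 4 + dist6 (t v) \<le> cut V \<mu> {v}"
    and card2: "2 \<le> card (V - {z})"
    and IH: "\<lbrakk>weight V' z \<mu>' < weight V z \<mu>; inst V' z \<mu>' t'; critical V' z \<mu>' t';
      \<And>v. v \<in> V' - {z} \<Longrightarrow> 4 + dist6 (t' v) \<le> cut V' \<mu>' {v}; 2 \<le> card (V' - {z})\<rbrakk> \<Longrightarrow> tip_bound V' z \<mu>' t'"
begin

sublocale multigraph V \<mu>
  using instD(1)[OF I] .

abbreviation "U \<equiv> V - {z}"
abbreviation "d \<equiv> cut V \<mu>"

lemmas D = instD[OF I]

lemma finU: "A \<subseteq> U \<Longrightarrow> finite A"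
  using D(2) finite_subset[of A V] by auto

text \<open>This is the induction hypothesis for the contraction onto \<open>A\<close>, which is
  critical again and lighter because a vertex has gone. Compared with tameness it provides the slack
  of 2 that the reductions spend.\<close>

lemma sub_bound:
  assumes A: "A \<subset> U" "2 \<le> card A"
  shows "6 + dist6 (sum t A) \<le> d A"
    and "v \<in> A \<Longrightarrow> d {v} + 2 \<le> d A"
    and "v \<in> A \<Longrightarrow> d {v} + 2 = d A \<Longrightarrow> u \<in> A - {v} \<Longrightarrow> d {u} = 4"
proof -
  have AU: "A \<subseteq> U" using A by auto
  have zA: "insert z A - {z} = A" using A by auto
  let ?m = "quot_mult V (onto_tip z A) \<mu>" and ?t = "quot_sum V (onto_tip z A) t"
  have cut: "cut (insert z A) ?m B = d B" if "B \<subseteq> A" for B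
    by (rule cut_onto_tip[OF D(2,3) AU that])
  have ts: "?t v = t v" if "v \<in> A" for v by (rule quot_onto_tip(3)[OF AU D(3) that])
  obtain b where b: "b \<in> U - A" using A by auto
  have "weight (insert z A) z ?m = (\<Sum>v\<in>A. d {v} + 1)"
    unfolding weight_def zA by (rule sum.cong) (use cut in auto)
  also have "\<dots> < weight V z \<mu>"
    unfolding weight_def
  proof (rule sum_strict_mono2)
    show "finite U" using D(2) by simp
    show "b \<in> U - A" by (rule b)
    show "0 < d {b} + 1" using cut_nonneg[of "{b}"] by simp
    show "0 \<le> d {v} + 1" for v using cut_nonneg[of "{v}"] by simp
  qed (use A in auto)
  finally have tb: "tip_bound (insert z A) z ?m ?t"
  proof (rule IH[OF _ inst_onto_tip[OF I AU] critical_onto_tip[OF I crit AU]])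
    fix v assume "v \<in> insert z A - {z}"
    then have "v \<in> A" "v \<in> U" using AU by auto
    then show "4 + dist6 (?t v) \<le> cut (insert z A) ?m {v}"
      using cut[of "{v}"] ts[of v] tame1[of v] by simp
  qed (use zA A in auto)
  have "sum ?t A = sum t A" using ts by simp
  then show "6 + dist6 (sum t A) \<le> d A" and "v \<in> A \<Longrightarrow> d {v} + 2 \<le> d A"
    "v \<in> A \<Longrightarrow> d {v} + 2 = d A \<Longrightarrow> u \<in> A - {v} \<Longrightarrow> d {u} = 4"
    using tb cut unfolding tip_bound_def zA by auto
qed

lemma card_cases:
  assumes "A \<subseteq> U" "A \<noteq> {}"
  obtains a where "A = {a}" | "2 \<le> card A"
proof -
  have "card A \<noteq> 0" using assms finU by auto
  then consider "card A = 1" | "2 \<le> card A" by linarith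
  then show ?thesis using that card_1_singletonE by metis
qed

lemma tame_proper:
  assumes "A \<subset> U" "A \<noteq> {}"
  shows "4 + dist6 (sum t A) \<le> d A"
  by (rule card_cases[of A]) (use assms tame1 sub_bound(1)[of A] in auto)

lemma edge_le_1: "x \<in> U \<Longrightarrow> y \<in> U \<Longrightarrow> x \<noteq> y \<Longrightarrow> \<mu> x y \<le> 1"
  by (rule critical_edge_mult[OF I crit])

lemma nonextendable_preflow:
  obtains \<psi> where "preflow V z \<mu> t \<psi>" "\<not> extendable V z \<mu> t \<psi>"
proof -
  let ?m = "quot_mult V (onto_tip z U) \<mu>" and ?t = "quot_sum V (onto_tip z U) t"
  have V: "insert z U = V" "V - U = {z}" using D(3) by auto
  obtain \<psi> where \<psi>: "preflow V z ?m ?t \<psi>" "\<not> extendable V z ?m ?t \<psi>"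
    using crit card2 V unfolding critical_def by (metis order_refl)
  note q = quot_onto_tip[OF order_refl D(3)]
  have mz: "?m z b = \<mu> z b" if "b \<in> U" for b using q(2)[OF that] V by simp
  have tz: "?t a = t a" if "a \<in> V" for a using q(3,4) V that by (cases "a = z") auto
  have m: "?m a b = \<mu> a b" if "a \<in> V" "b \<in> V" "a \<noteq> b" for a b
  proof (cases "a = z \<or> b = z")
    case True
    then show ?thesis
      using mz[of a] mz[of b] that D(4) instD(4)[OF inst_onto_tip[OF I order_refl]] by (metis DiffI singletonD)
  next
    case False
    then show ?thesis using q(1)[of a b] that by auto
  qed
  have "preflow V z \<mu> t \<psi>" using \<psi>(1) mz tz D(3) unfolding preflow_def by auto
  moreover have "\<not> extendable V z \<mu> t \<psi>"
    using \<psi>(2) extendable_cong[of V ?m \<mu> ?t t z \<psi> \<psi>] m tz by blast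
  ultimately show ?thesis using that by blast
qed

text \<open>Tameness is asked of all proper nonempty sets because the vertices of the critical
  quotient are such sets, proper since there are at least two of them, and it is not known which
  ones. The conclusion is the bound for this quotient, pulled back along its parts.\<close>

lemma reduce:
  assumes I': "inst V' z \<mu>' t'" and \<psi>': "preflow V' z \<mu>' t' \<psi>'" and ne: "\<not> extendable V' z \<mu>' t' \<psi>'"
    and tame': "\<And>A. A \<subset> V' - {z} \<Longrightarrow> A \<noteq> {} \<Longrightarrow> 4 + dist6 (sum t' A) \<le> cut V' \<mu>' A"
    and w: "weight V' z \<mu>' < weight V z \<mu>"
  obtains P where "tip_bound_parts V' z \<mu>' t' P"
proof -
  note D' = instD[OF I']
  obtain h where h: "h z = z" "\<And>u. u \<in> V' - {z} \<Longrightarrow> h u \<noteq> z"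
    and crit': "critical (h ` V') z (quot_mult V' h \<mu>') (quot_sum V' h t')"
    and card': "2 \<le> card (h ` V' - {z})"
    using critical_quotient[OF I' \<psi>' ne] by blast
  let ?m = "quot_mult V' h \<mu>'" and ?t = "quot_sum V' h t'"
  define P where "P v = {u \<in> V' - {z}. h u = h v}" for v
  have img: "h ` V' - {z} = h ` (V' - {z})" using h D'(3) by auto
  have J: "inst (h ` V') z ?m ?t" using inst_quot[OF I', of h] h by simp
  have fib: "{u \<in> V'. h u \<in> {h v}} = P v" if "v \<in> V' - {z}" for v
    using h that D'(3) by (auto simp: P_def)
  have Pprop: "P v \<subset> V' - {z}" if v: "v \<in> V' - {z}" for v
  proof -
    have "\<not> h ` (V' - {z}) \<subseteq> {h v}"
    proof
      assume "h ` (V' - {z}) \<subseteq> {h v}"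
      then have "card (h ` (V' - {z})) \<le> card {h v}" by (rule card_mono[rotated]) simp
      then show False using card' img by simp
    qed
    then show ?thesis by (auto simp: P_def)
  qed
  have cut1: "cut (h ` V') ?m {h v} = cut V' \<mu>' (P v)" if v: "v \<in> V' - {z}" for v
    using cut_quot[OF D'(2), of "{h v}" h \<mu>'] v unfolding fib[OF v] by simp
  have t1: "?t (h v) = sum t' (P v)" if v: "v \<in> V' - {z}" for v
    using fib[OF v] by (simp add: quot_sum_def)
  have all: "{u \<in> V'. h u \<in> h ` V' - {z}} = V' - {z}" using h D'(3) by auto
  have cutU: "cut (h ` V') ?m (h ` V' - {z}) = cut V' \<mu>' (V' - {z})"
    using cut_quot[OF D'(2), of "h ` V' - {z}" h \<mu>'] unfolding all by simp
  have tU: "sum ?t (h ` V' - {z}) = sum t' (V' - {z})"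
    using sum_quot_sum[OF D'(2), of "h ` V' - {z}" h t'] D'(2) unfolding all by simp
  have "tip_bound (h ` V') z ?m ?t"
  proof (rule IH[OF _ J crit' _ card'])
    show "weight (h ` V') z ?m < weight V z \<mu>"
      using weight_quot[OF I', of h] h w by simp
    fix b assume "b \<in> h ` V' - {z}"
    then obtain v where v: "v \<in> V' - {z}" "b = h v" using img by auto
    then show "4 + dist6 (?t b) \<le> cut (h ` V') ?m {b}"
      using tame'[OF Pprop[OF v(1)]] by (auto simp: cut1 t1 P_def)
  qed
  then have tb: "6 + dist6 (sum t' (V' - {z})) \<le> cut V' \<mu>' (V' - {z})"
    "\<And>b. b \<in> h ` V' - {z} \<Longrightarrow> cut (h ` V') ?m {b} + 2 \<le> cut V' \<mu>' (V' - {z})"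
    "\<And>b c. b \<in> h ` V' - {z} \<Longrightarrow> cut (h ` V') ?m {b} + 2 = cut V' \<mu>' (V' - {z}) \<Longrightarrow>
      c \<in> h ` V' - {z} \<Longrightarrow> c \<noteq> b \<Longrightarrow> cut (h ` V') ?m {c} = 4"
    unfolding tip_bound_def cutU tU by blast+
  have hU: "h v \<in> h ` V' - {z}" if "v \<in> V' - {z}" for v using that img by blast
  have "tip_bound_parts V' z \<mu>' t' P"
    unfolding tip_bound_parts_def
  proof (intro conjI ballI impI)
    fix v assume v: "v \<in> V' - {z}"
    show "v \<in> P v" using v by (simp add: P_def)
    show "P v \<subset> V' - {z}" by (rule Pprop[OF v])
    show "cut V' \<mu>' (P v) + 2 \<le> cut V' \<mu>' (V' - {z})"
      using tb(2)[OF hU[OF v]] cut1[OF v] by simp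
    fix u assume eq: "cut V' \<mu>' (P v) + 2 = cut V' \<mu>' (V' - {z})" and "u \<in> V' - {z} - P v"
    then have u: "u \<in> V' - {z}" "h u \<noteq> h v" by (auto simp: P_def)
    show "cut V' \<mu>' (P u) = 4"
      using tb(3)[OF hU[OF v] _ hU[OF u(1)] u(2)] eq cut1[OF v] cut1[OF u(1)] by simp
  qed (rule tb(1))
  then show ?thesis by (rule that)
qed

end

lemma tip_bound_partsD:
  assumes "tip_bound_parts V z \<mu> t P"
  shows "6 + dist6 (sum t (V - {z})) \<le> cut V \<mu> (V - {z})"
    and "\<And>v. v \<in> V - {z} \<Longrightarrow> v \<in> P v" "\<And>v. v \<in> V - {z} \<Longrightarrow> P v \<subset> V - {z}"
    and "\<And>v. v \<in> V - {z} \<Longrightarrow> cut V \<mu> (P v) + 2 \<le> cut V \<mu> (V - {z})"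
    and "\<And>v u. v \<in> V - {z} \<Longrightarrow> cut V \<mu> (P v) + 2 = cut V \<mu> (V - {z}) \<Longrightarrow> u \<in> V - {z} \<Longrightarrow> u \<notin> P v \<Longrightarrow>
      cut V \<mu> (P u) = 4"
  using assms unfolding tip_bound_parts_def by blast+

section \<open>Splitting vertices of degree 4\<close>

lemma dist6_shift: "6 dvd b \<Longrightarrow> dist6 (a + b) = dist6 a"
  by (rule dist6_cong) simp

context critical_step
begin

lemma degree_split:
  assumes "x \<in> U"
  shows "d {x} = \<mu> z x + (\<Sum>y\<in>U - {x}. \<mu> x y)"
    and "d (U - {x}) = d U + d {x} - 2 * \<mu> z x"
    and "sum t U = sum t (U - {x}) + t x"
proof -
  have V: "V - {x} = insert z (U - {x})" "z \<notin> U - {x}" using assms D(3) by auto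
  show 1: "d {x} = \<mu> z x + (\<Sum>y\<in>U - {x}. \<mu> x y)"
    unfolding cut_single V(1) using D(2) D(4)[of x z] by simp
  have "insert x (U - {x}) = U" using assms by auto
  then have "d U = d (U - {x}) + d {x} - 2 * (\<Sum>y\<in>U - {x}. \<mu> x y)"
    using cut_insert[of x "U - {x}"] assms by auto
  then show "d (U - {x}) = d U + d {x} - 2 * \<mu> z x" using 1 by simp
  show "sum t U = sum t (U - {x}) + t x"
    using sum.remove[of U x t] assms D(2) by simp
qed

text \<open>By \<open>edge_le_1\<close> only edges to the tip can be parallel. With at most two of
  those, the four edges at \<open>x\<close> form the pairs \<open>a, b\<close> and
  \<open>c, e\<close>, each with distinct ends; the tip can occur only as \<open>a\<close> or
  \<open>c\<close>.\<close>

lemma four_edge_ends: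
  assumes x: "x \<in> U" "d {x} = 4" and m: "\<mu> x z \<le> 2"
  obtains a b c e where "b \<in> U - {x}" "e \<in> U - {x}" "a \<in> V - {x}" "c \<in> V - {x}" "a \<noteq> b" "c \<noteq> e" "b \<noteq> e"
    "\<forall>w\<in>V - {x}. \<mu> x w = of_bool (w = a) + of_bool (w = b) + of_bool (w = c) + of_bool (w = e)"
proof -
  define N where "N = {y \<in> U - {x}. \<mu> x y = 1}"
  have mu: "\<mu> x y = of_bool (y \<in> N)" if "y \<in> U - {x}" for y
    using that x edge_le_1[of x y] D(5)[of x y] by (auto simp: N_def)
  have finN: "finite N" using D(2) by (simp add: N_def)
  have "(\<Sum>y\<in>U - {x}. \<mu> x y) = int (card N)"
  proof -
    have "(\<Sum>y\<in>U - {x}. \<mu> x y) = (\<Sum>y\<in>U - {x}. of_bool (y \<in> N))" by (rule sum.cong) (use mu in auto)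
    also have "\<dots> = int (card ((U - {x}) \<inter> N))" using D(2) by (simp add: sum_of_bool_eq Int_def)
    also have "(U - {x}) \<inter> N = N" by (auto simp: N_def)
    finally show ?thesis .
  qed
  then have card: "\<mu> x z + int (card N) = 4"
    using degree_split(1)[OF x(1)] x(2) D(4)[of x z] by simp
  have muV: "\<mu> x w = (if w = z then \<mu> x z else of_bool (w \<in> N))" if "w \<in> V - {x}" for w
    using mu[of w] that by auto
  have NU: "N \<subseteq> U - {x}" "z \<in> V - {x}" "z \<notin> N" using x D(3) by (auto simp: N_def)
  have "\<mu> x z = 0 \<or> \<mu> x z = 1 \<or> \<mu> x z = 2" using m D(5)[of x z] by linarith
  then consider "\<mu> x z = 0" "card N = 4" | "\<mu> x z = 1" "card N = 3" | "\<mu> x z = 2" "card N = 2"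
    using card by force
  then show ?thesis
  proof cases
    case 1
    then obtain a where a: "a \<in> N" by fastforce
    then have "card (N - {a}) = 3" using 1 finN by simp
    then obtain b c e where bce: "N - {a} = {b, c, e}" "b \<noteq> c" "b \<noteq> e" "c \<noteq> e" by (auto simp: card_3_iff)
    have ane: "a \<noteq> b" "a \<noteq> c" "a \<noteq> e" using bce(1) by blast+
    have N: "N = {a, b, c, e}" using bce(1) a by blast
    have mem: "a \<in> U - {x}" "b \<in> U - {x}" "c \<in> U - {x}" "e \<in> U - {x}" using NU(1) N by blast+
    show ?thesis
    proof (rule that[of b e a c], rule_tac [8] ballI)
      fix w assume "w \<in> V - {x}"
      from muV[OF this] show "\<mu> x w = of_bool (w = a) + of_bool (w = b) + of_bool (w = c) + of_bool (w = e)"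
        using 1(1) ane bce(2-4) mem unfolding N by auto
    qed (use mem ane bce(2-4) in auto)
  next
    case 2
    then obtain b c e where bce: "N = {b, c, e}" "b \<noteq> c" "b \<noteq> e" "c \<noteq> e" by (auto simp: card_3_iff)
    have mem: "b \<in> U - {x}" "c \<in> U - {x}" "e \<in> U - {x}" using NU(1) bce(1) by blast+
    show ?thesis
    proof (rule that[of b e z c], rule_tac [8] ballI)
      fix w assume "w \<in> V - {x}"
      from muV[OF this] show "\<mu> x w = of_bool (w = z) + of_bool (w = b) + of_bool (w = c) + of_bool (w = e)"
        using 2(1) bce(2-4) mem unfolding bce(1) by auto
    qed (use mem NU(2) bce(2-4) in auto)
  next
    case 3
    then obtain b e where be: "N = {b, e}" "b \<noteq> e" by (auto simp: card_2_iff)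
    have mem: "b \<in> U - {x}" "e \<in> U - {x}" using NU(1) be(1) by blast+
    show ?thesis
    proof (rule that[of b e z z], rule_tac [8] ballI)
      fix w assume "w \<in> V - {x}"
      from muV[OF this] show "\<mu> x w = of_bool (w = z) + of_bool (w = b) + of_bool (w = z) + of_bool (w = e)"
        using 3(1) be(2) mem unfolding be(1) by auto
    qed (use mem NU(2) be(2) in auto)
  qed
qed

text \<open>Degree 4 forces residue 0. With three or more tip edges, moving \<open>x\<close> to the
  side of the tip lowers the tip degree by at least 2, and the bounds already known for the rest
  suffice. Otherwise splitting off two pairs isolates \<open>x\<close>, which can then be merged
  into the tip with the zero orientation.\<close>

lemma tip_bound_if_degree_4:
  assumes x: "x \<in> U" "d {x} = 4"
  shows "tip_bound V z \<mu> t"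
proof -
  have tx: "6 dvd t x"
    using tame1[OF x(1)] x(2) dist6_bounds[of "t x"] dist6_eq_0[of "t x"] by simp
  define A where "A = U - {x}"
  have AU: "A \<subset> U" "A \<noteq> {}"
  proof -
    show "A \<subset> U" using x by (auto simp: A_def)
    have "card A = card U - 1" using x D(2) by (simp add: A_def)
    then show "A \<noteq> {}" using card2 by auto
  qed
  have finA: "finite B" if "B \<subseteq> A" for B
    by (rule finU) (use that AU(1) in auto)
  have dA: "d A = d U + 4 - 2 * \<mu> z x" using degree_split(2)[OF x(1)] x(2) by (simp add: A_def)
  have tA: "dist6 (sum t U) = dist6 (sum t A)"
    using degree_split(3)[OF x(1)] dist6_shift[OF tx] by (simp add: A_def)
  have dx4: "4 \<le> d {u}" if "u \<in> U" for u using tame1[OF that] dist6_bounds(1)[of "t u"] by linarith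
  show ?thesis
  proof (cases "\<mu> x z \<le> 2")
    case False
    then have le: "d A \<le> d U - 2" using dA D(4)[of x z] by simp
    then have a: "6 + dist6 (sum t U) \<le> d U" using tame_proper[OF AU] tA by simp
    have v: "d {v} + 2 \<le> d U \<and> (d {v} + 2 = d U \<longrightarrow> (\<forall>u\<in>U - {v}. d {u} = 4))" if v: "v \<in> A" for v
    proof (rule card_cases[of A])
      fix w assume "A = {w}"
      then have "A = {v}" "U = {x, v}" using v x(1) by (auto simp: A_def)
      then show ?thesis using le x(2) by auto
    next
      assume "2 \<le> card A"
      then show ?thesis using sub_bound(2)[OF AU(1) _ v] le by auto
    qed (use AU in auto)
    have "d {x} + 2 \<le> d U" using a x(2) dist6_bounds(1)[of "sum t U"] by linarith
    moreover have "d {u} = 4" if "d {x} + 2 = d U" "u \<in> A" for u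
      using v[OF that(2)] that(1) x(2) dx4[of u] AU(1) that(2) by fastforce
    moreover have "w = x \<or> w \<in> A" if "w \<in> U" for w using that by (auto simp: A_def)
    ultimately show ?thesis unfolding tip_bound_def using a v x
      by (intro conjI ballI impI) (assumption | metis Diff_iff insertI1)+
  next
    case True
    obtain a b c e where ends: "b \<in> U - {x}" "e \<in> U - {x}" "a \<in> V - {x}" "c \<in> V - {x}" "a \<noteq> b" "c \<noteq> e" "b \<noteq> e"
      and all: "\<forall>w\<in>V - {x}. \<mu> x w = of_bool (w = a) + of_bool (w = b) + of_bool (w = c) + of_bool (w = e)"
      by (rule four_edge_ends[OF x True])
    note mux = bspec[OF all]
    obtain \<psi> where \<psi>: "preflow V z \<mu> t \<psi>" "\<not> extendable V z \<mu> t \<psi>" by (rule nonextendable_preflow)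
    let ?m1 = "lift_mult x a b \<mu>" and ?m2 = "lift_mult x c e (lift_mult x a b \<mu>)"
    have ne: "x \<noteq> a" "x \<noteq> b" "x \<noteq> c" "x \<noteq> e" using ends by auto
    have m1: "?m1 x w = of_bool (w = c) + of_bool (w = e)" if "w \<in> V - {x}" for w
      using mux[OF that] ne ends(5) by (auto simp: lift_mult_def add_mult_def)
    have m2: "?m2 x w = 0" if "w \<in> V - {x}" for w
      using m1[OF that] ne ends(6) by (auto simp: lift_mult_def[of x c e] add_mult_def)
    have "1 \<le> \<mu> x a" "1 \<le> \<mu> x b" using mux[of a] mux[of b] ends by auto
    then obtain \<psi>1 where I1: "inst V z ?m1 t" "preflow V z ?m1 t \<psi>1" "\<not> extendable V z ?m1 t \<psi>1"
      using lift_edges[OF I \<psi> x(1), of a b] ends ne by auto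
    have "1 \<le> ?m1 x c" "1 \<le> ?m1 x e" using m1[of c] m1[of e] ends by auto
    then obtain \<psi>2 where I2: "inst V z ?m2 t" "preflow V z ?m2 t \<psi>2" "\<not> extendable V z ?m2 t \<psi>2"
      using lift_edges[OF I1 x(1), of c e] ends ne by auto
    have A: "A = V - {z, x}" "A \<subseteq> V - {z}" by (auto simp: A_def)
    let ?V3 = "insert z A"
    let ?m3 = "quot_mult V (onto_tip z A) ?m2" and ?t3 = "quot_sum V (onto_tip z A) t"
    have "?m2 z x = 0" using m2[of z] x D(3) instD(4)[OF I2(1), of x z] by auto
    moreover have "\<psi>2 x \<in> netset (?m2 z x)" using I2(2) x(1) unfolding preflow_def by blast
    ultimately have "\<psi>2 x = 0" by (simp add: netset_0)
    then have I3: "preflow ?V3 z ?m3 ?t3 (\<lambda>y. \<psi>2 y + 0)" "\<not> extendable ?V3 z ?m3 ?t3 (\<lambda>y. \<psi>2 y + 0)"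
      unfolding A(1)
      using merge_into_tip[OF I2 x(1), of "\<lambda>_. 0"] m2 tx by (simp_all add: netset_0)
    have J: "inst ?V3 z ?m3 ?t3" by (rule inst_onto_tip[OF I2(1) A(2)])
    have V3: "?V3 - {z} = A" by (auto simp: A_def)
    \<comment> \<open>The number of new edges inside \<open>B\<close>. Each replaces two edges that
      left \<open>B\<close> towards \<open>x\<close>, so it lowers the cut by 2.\<close>
    define i where "i B = (of_bool (a \<in> B \<and> b \<in> B) + of_bool (c \<in> B \<and> e \<in> B) :: int)" for B
    have cut3: "cut ?V3 ?m3 B = d B - 2 * i B" if B: "B \<subseteq> A" for B
    proof -
      have "cut ?V3 ?m3 B = cut V ?m2 B" by (rule cut_onto_tip[OF D(2,3) A(2) B])
      moreover have "x \<notin> B" "B \<subseteq> V" using B by (auto simp: A_def)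
      ultimately show ?thesis
        using ends ne x by (auto simp: cut_lift D(2) i_def)
    qed
    have t3: "sum ?t3 B = sum t B" if B: "B \<subseteq> A" for B
      by (rule sum.cong) (use quot_onto_tip(3)[OF A(2) D(3)] B in auto)
    have i012: "i B = 0 \<or> i B = 1 \<or> i B = 2" for B by (auto simp: i_def)
    have i_card: "2 \<le> card B" if "i B \<noteq> 0" "finite B" for B
    proof -
      have "(a \<in> B \<and> b \<in> B) \<or> (c \<in> B \<and> e \<in> B)" using that(1) by (auto simp: i_def)
      then have "card {a, b} \<le> card B \<or> card {c, e} \<le> card B" using card_mono[OF that(2)] by auto
      then show ?thesis using ends by auto
    qed
    \<comment> \<open>If both new edges lie inside \<open>B\<close>, all four edges at
      \<open>x\<close> end in \<open>B\<close>. Then \<open>insert x B\<close> has in the old graph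
      the cut that \<open>B\<close> has in the new one, so its bounds can be used instead.\<close>
    have i2: "d (insert x B) = d B - 4" if "i B = 2" "B \<subseteq> A" for B
    proof -
      have B: "a \<in> B" "b \<in> B" "c \<in> B" "e \<in> B" using that(1) by (auto simp: i_def of_bool_def split: if_splits)
      have BV: "B \<subseteq> V - {x}" "finite B" using that(2) finA[OF that(2)] by (auto simp: A_def)
      have "(\<Sum>w\<in>B. \<mu> x w) = (\<Sum>w\<in>B. of_bool (w = a) + of_bool (w = b) + of_bool (w = c) + of_bool (w = e))"
        by (rule sum.cong[OF refl], rule mux) (use BV in auto)
      also have "\<dots> = 4" unfolding sum.distrib of_bool_def using B BV by simp
      finally show ?thesis using cut_insert[of x B] BV x by auto
    qed
    have ins: "insert x B \<subset> U" "2 \<le> card (insert x B)" if "B \<subset> A" "B \<noteq> {}" for B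
    proof -
      show "insert x B \<subset> U" using that(1) x by (auto simp: A_def)
      have "finite B" "x \<notin> B" using that finA[of B] by (auto simp: A_def)
      then show "2 \<le> card (insert x B)"
        using that(2) by (simp add: Suc_le_eq card_gt_0_iff)
    qed
    have sub6: "6 + dist6 (sum t B) \<le> d B" if "B \<subset> A" "2 \<le> card B" for B
      by (rule sub_bound(1)) (use that A(2) in auto)
    have tame3: "4 + dist6 (sum ?t3 B) \<le> cut ?V3 ?m3 B" if B: "B \<subset> ?V3 - {z}" "B \<noteq> {}" for B
    proof -
      have BA: "B \<subset> A" "B \<subseteq> A" "B \<subset> U" using B V3 A by auto
      have finB: "finite B" by (rule finA[OF BA(2)])
      have T: "sum ?t3 B = sum t B" and C: "cut ?V3 ?m3 B = d B - 2 * i B" using t3 cut3 BA by auto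
      consider "i B = 0" | "i B = 1" | "i B = 2" using i012 by blast
      then show ?thesis
      proof cases
        case 1
        then show ?thesis using tame_proper[OF BA(3) B(2)] T C by simp
      next
        case 2
        then show ?thesis using sub6[OF BA(1) i_card[OF _ finB]] T C by simp
      next
        case 3
        have "x \<notin> B" using BA by (auto simp: A_def)
        then have "dist6 (sum t (insert x B)) = dist6 (sum t B)"
          using finB dist6_shift[OF tx, of "sum t B"] by (simp add: add.commute)
        then show ?thesis
          using sub_bound(1)[OF ins[OF BA(1) B(2)]] i2[OF 3 BA(2)] T C 3 by simp
      qed
    qed
    have weight3: "weight ?V3 z ?m3 < weight V z \<mu>"
    proof -
      have "weight ?V3 z ?m3 \<le> (\<Sum>v\<in>A. d {v} + 1)"
        unfolding weight_def V3
      proof (rule sum_mono)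
        fix v assume "v \<in> A"
        then show "cut ?V3 ?m3 {v} + 1 \<le> d {v} + 1"
          using cut3[of "{v}"] i012[of "{v}"] by auto
      qed
      also have "\<dots> < weight V z \<mu>"
        unfolding weight_def using sum.remove[of U x "\<lambda>v. d {v} + 1"] x D(2) by (simp add: A_def)
      finally show ?thesis .
    qed
    obtain P where P: "tip_bound_parts ?V3 z ?m3 ?t3 P"
      by (rule reduce[OF J I3 tame3 weight3])
    note P = tip_bound_partsD[OF P, unfolded V3]
    \<comment> \<open>An edge from the tip to \<open>x\<close> is replaced by the new edge of its
      pair, so the tip keeps its degree.\<close>
    have kA: "cut ?V3 ?m3 A = d U"
    proof -
      have "\<mu> x z = of_bool (z = a) + of_bool (z = c)" using mux[of z] x D(3) ends by auto
      moreover have "i A = of_bool (a \<noteq> z) + of_bool (c \<noteq> z)" using ends by (auto simp: i_def A_def)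
      ultimately show ?thesis using cut3[of A] dA D(4)[of x z] by auto
    qed
    have Psub: "P v \<subset> A" "P v \<subseteq> A" "P v \<subset> U" "finite (P v)" "P v \<noteq> {}" "v \<in> P v" if "v \<in> A" for v
      using P(2,3)[OF that] AU(1) finA[of "P v"] by blast+
    have cutP: "cut ?V3 ?m3 (P v) = d (P v) - 2 * i (P v)" if "v \<in> A" for v
      using cut3 Psub(2)[OF that] by auto
    have a: "6 + dist6 (sum t U) \<le> d U" using P(1) kA t3[of A] tA by simp
    have part_ge: "d {v} \<le> cut ?V3 ?m3 (P v)" if v: "v \<in> A" for v
    proof -
      consider "i (P v) = 0" | "i (P v) = 1" | "i (P v) = 2" using i012 by blast
      then show ?thesis
      proof cases
        case 1
        have "d {v} \<le> d (P v)"
        proof (rule card_cases[of "P v"])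
          fix w assume "P v = {w}"
          then show ?thesis using Psub(6)[OF v] by simp
        next
          assume "2 \<le> card (P v)"
          then show ?thesis using sub_bound(2)[OF Psub(3)[OF v] _ Psub(6)[OF v]] by simp
        qed (use Psub(3,5)[OF v] in auto)
        then show ?thesis using cutP[OF v] 1 by simp
      next
        case 2
        then show ?thesis
          using sub_bound(2)[OF Psub(3)[OF v] i_card[OF _ Psub(4)[OF v]] Psub(6)[OF v]] cutP[OF v] by simp
      next
        case 3
        then show ?thesis
          using sub_bound(2)[OF ins[OF Psub(1,5)[OF v]], of v] Psub(6)[OF v] i2[OF 3 Psub(2)[OF v]] cutP[OF v] by simp
      qed
    qed
    have v_le: "d {v} + 2 \<le> d U" if "v \<in> A" for v
      using part_ge[OF that] P(4)[OF that] kA by simp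
    have dx: "d {x} + 2 \<le> d U" using a x(2) dist6_bounds(1)[of "sum t U"] by linarith
    \<comment> \<open>Equality at \<open>v\<close> passes to its part by \<open>part_ge\<close>, so
      the parts avoiding \<open>v\<close> have degree 4 in the quotient. A vertex \<open>u\<close>
      in a part of at least two vertices still has degree 4: exactly one new edge lies in that part,
      and then \<open>sub_bound\<close> is attained.\<close>
    have "d {u} = 4" if v: "v \<in> U" and eq: "d {v} + 2 = d U" and u: "u \<in> U - {v}" for u v
    proof (cases "v = x")
      case True
      then have "u \<in> A" "u \<in> U" using u by (auto simp: A_def)
      then show ?thesis using v_le[of u] dx4[of u] eq x(2) True by simp
    next
      case False
      then have vA: "v \<in> A" using v by (simp add: A_def)
      have Pv: "cut ?V3 ?m3 (P v) = d {v}" using part_ge[OF vA] P(4)[OF vA] kA eq by simp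
      show ?thesis
      proof (cases "u = x")
        case True
        then show ?thesis using x by simp
      next
        case False
        then have uA: "u \<in> A" "u \<in> U" using u by (auto simp: A_def)
        show ?thesis
        proof (cases "u \<in> P v")
          case True
          then have uv: "u \<in> P v - {v}" using u by auto
          then have "card {u, v} \<le> card (P v)" using Psub[OF vA] by (intro card_mono) auto
          then have c2: "2 \<le> card (P v)" using u by auto
          note sb = sub_bound[OF Psub(3)[OF vA] c2]
          consider "i (P v) = 0" | "i (P v) = 1" | "i (P v) = 2" using i012 by blast
          then show ?thesis
          proof cases
            case 1
            then show ?thesis using sb(2)[OF Psub(6)[OF vA]] Pv cutP[OF vA] by simp
          next
            case 2
            then show ?thesis using sb(3)[OF Psub(6)[OF vA] _ uv] Pv cutP[OF vA] by simp
          next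
            case 3
            then show ?thesis
              using sub_bound(2)[OF ins[OF Psub(1,5)[OF vA]], of v] Psub(6)[OF vA] i2[OF 3 Psub(2)[OF vA]]
                cutP[OF vA] Pv by simp
          qed
        next
          case notin: False
          have P4: "cut ?V3 ?m3 (P u) = 4"
            using P(5)[OF vA _ uA(1) notin] Pv eq kA by simp
          show ?thesis
          proof (rule card_cases[of "P u"])
            fix w assume "P u = {w}"
            then have Pu: "P u = {u}" using Psub(6)[OF uA(1)] by simp
            then have "i (P u) = 0" using ends by (auto simp: i_def)
            then show ?thesis using cutP[OF uA(1)] P4 Pu by simp
          next
            assume c2: "2 \<le> card (P u)"
            note sb = sub_bound[OF Psub(3)[OF uA(1)] c2]
            consider "i (P u) = 0" | "i (P u) = 1" | "i (P u) = 2" using i012 by blast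
            then show ?thesis
            proof cases
              case 1
              then show ?thesis
                using sb(1) dist6_bounds(1)[of "sum t (P u)"] P4 cutP[OF uA(1)] by simp
            next
              case 2
              then show ?thesis using sb(2)[OF Psub(6)[OF uA(1)]] P4 cutP[OF uA(1)] dx4[OF uA(2)] by simp
            next
              case 3
              then show ?thesis
                using sub_bound(2)[OF ins[OF Psub(1,5)[OF uA(1)]], of u] Psub(6)[OF uA(1)] i2[OF 3 Psub(2)[OF uA(1)]]
                  cutP[OF uA(1)] P4 dx4[OF uA(2)] by simp
            qed
          qed (use Psub(3,5)[OF uA(1)] in auto)
        qed
      qed
    qed
    moreover have "d {v} + 2 \<le> d U" if "v \<in> U" for v
      using v_le[of v] dx that by (cases "v = x") (auto simp: A_def)
    ultimately show ?thesis unfolding tip_bound_def using a by blast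
  qed
qed

end

section \<open>Graphs without vertices of degree 4\<close>

lemma dist6_decrease:
  assumes "1 \<le> dist6 a"
  obtains s :: int where "s = 1 \<or> s = - 1" "6 dvd a - s * dist6 a" "dist6 (a - s) = dist6 a - 1"
proof -
  note b = dist6_bounds[of a]
  have small: "dist6 (dist6 a - 1) = dist6 a - 1" using dist6_small[of "dist6 a - 1"] b assms by simp
  show ?thesis
  proof (rule dist6_witness[of a])
    fix q assume q: "a = 6 * q + dist6 a"
    have "6 dvd a - dist6 a" using q by (metis add_diff_cancel_right' dvd_triv_left)
    moreover have "dist6 (a - 1) = dist6 (dist6 a - 1)"
      by (rule dist6_cong) (use \<open>6 dvd a - dist6 a\<close> in simp)
    ultimately show ?thesis using that[of 1] small by simp
  next
    fix q assume q: "a = 6 * q - dist6 a"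
    have "6 dvd a + dist6 a" using q by (metis diff_add_cancel dvd_triv_left)
    moreover have "dist6 (a + 1) = dist6 (- (dist6 a - 1))"
      by (rule dist6_cong) (use \<open>6 dvd a + dist6 a\<close> in simp)
    ultimately show ?thesis using that[of "- 1"] small dist6_minus[of "dist6 a - 1"] by simp
  qed
qed

lemma dist6_step: "s = 1 \<or> s = - 1 \<Longrightarrow> dist6 (a - s) \<le> dist6 a + 1"
  using dist6_diff[of a s] dist6_le_abs[of s] by auto

text \<open>If none of the \<open>m\<close> parallel edges has net value \<open>- s\<close>, then
  each of them has value \<open>s\<close>.\<close>

lemma netset_extreme:
  assumes "r \<in> netset m" "s = 1 \<or> s = - 1" "r + s \<notin> netset (m - 1)"
  shows "r = s * m"
proof -
  have r: "\<bar>r\<bar> \<le> m" "even (m - r)" using assms(1) by (auto simp: netset_def)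
  then have "even (m - 1 - (r + s))" using assms(2) by auto
  then have gt: "\<bar>r + s\<bar> > m - 1" using assms(3) by (auto simp: netset_def)
  have "even (m - s * r)" using r(2) assms(2) by auto
  then obtain k where k: "m - s * r = 2 * k" by (elim evenE)
  have "k = 0" using assms(2) gt r(1) k by (elim disjE; simp; linarith)
  then show ?thesis using k assms(2) by auto
qed

text \<open>Both ways of violating \<open>tip_bound\<close> are treated at once. Either
  \<open>v\<close> is a vertex of too large degree, or the tip degree is too small, and then
  \<open>v\<close> lies outside \<open>U\<close> and \<open>W\<close> is all of \<open>U\<close>.
  Without vertices of degree 4 already \<open>d U = d {v} + 2\<close> is a violation.\<close>

locale violation = critical_step V z \<mu> t
  for V :: "'v set" and z \<mu> t +
  fixes \<psi> :: "'v \<Rightarrow> int" and v :: 'v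
  assumes no4: "u \<in> V - {z} \<Longrightarrow> cut V \<mu> {u} \<noteq> 4"
    and pre: "preflow V z \<mu> t \<psi>" and nonext: "\<not> extendable V z \<mu> t \<psi>"
    and viol: "(v \<notin> V - {z} \<and> cut V \<mu> (V - {z}) \<le> 4 + dist6 (sum t (V - {z}))) \<or>
      (v \<in> V - {z} \<and> 6 \<le> cut V \<mu> (V - {z}) \<and> cut V \<mu> (V - {z}) \<le> cut V \<mu> {v} + 2)"
begin

abbreviation "W \<equiv> U - {v}"

lemma five: "u \<in> U \<Longrightarrow> 5 \<le> d {u}"
  using tame1[of u] no4[of u] dist6_bounds(1)[of "t u"] by force

text \<open>Equality in \<open>sub_bound\<close> would need another vertex of degree 4, so its 2
  becomes 3.\<close>

lemma sub3:
  assumes A: "A \<subset> U" "2 \<le> card A" and u: "u \<in> A"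
  shows "d {u} + 3 \<le> d A"
proof -
  have "A \<noteq> {u}" using A(2) by auto
  then obtain w where w: "w \<in> A - {u}" using u by blast
  then have "d {w} \<noteq> 4" using A no4 by blast
  then have "d {u} + 2 \<noteq> d A" using sub_bound(3)[OF A u _ w] by blast
  then show ?thesis using sub_bound(2)[OF A u] by simp
qed

lemma sub8:
  assumes A: "A \<subset> U" "2 \<le> card A"
  shows "8 \<le> d A"
proof -
  obtain u where "u \<in> A" using A(2) by fastforce
  moreover from this have "u \<in> U" using A by blast
  ultimately show ?thesis using sub3[OF A, of u] five[of u] by simp
qed

lemma parity: "A \<subseteq> U \<Longrightarrow> even (sum t A + d A)"
  by (rule inst_parity[OF I]) auto

lemma W_nonempty: "W \<noteq> {}"
proof
  assume "W = {}"
  then have "card U \<le> card {v}" by (intro card_mono) auto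
  then show False using card2 by simp
qed

text \<open>The smallest case: an edge between non-tip vertices is simple and degrees are at least
  5, so one further vertex already pushes \<open>d U\<close> above \<open>d {v} + 2\<close>. The
  next lemma does the same for two further vertices.\<close>

lemma two_vertices:
  assumes v: "v \<in> U" and W: "W \<subseteq> {x}"
  shows False
proof -
  have "W = {x}" using W W_nonempty by auto
  then have U: "U = insert v {x}" "v \<noteq> x" "x \<in> U" using v by auto
  have "d U = d {x} + d {v} - 2 * \<mu> v x"
    using cut_insert[of v "{x}"] U by auto
  then show False using five[OF U(3)] edge_le_1[OF v U(3,2)] viol v by auto
qed

lemma three_vertices:
  assumes v: "v \<in> U" and xy: "x \<in> W" "y \<in> W" "x \<noteq> y" and W: "W \<subseteq> {x, y}"
  shows False
proof -
  have U: "U = insert v (insert x {y})" "v \<noteq> x" "v \<noteq> y" "x \<in> U" "y \<in> U" using v xy W by auto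
  have "d {x, y} = d {y} + d {x} - 2 * \<mu> x y"
    using cut_insert[of x "{y}"] U xy by auto
  moreover have "d U = d {x, y} + d {v} - 2 * (\<mu> v x + \<mu> v y)"
    using cut_insert[of v "{x, y}"] U xy by auto
  ultimately show False
    using five[OF U(4)] five[OF U(5)] edge_le_1[OF v U(4,2)] edge_le_1[OF v U(5,3)] edge_le_1[OF U(4,5) xy(3)] viol v
    by auto
qed

text \<open>The violation survives a reduction that removes \<open>e\<close> tip edges, so the bound
  for the quotient can only hold with equality: \<open>v\<close> is a part of its own and all of
  \<open>W\<close> has degree 4 afterwards. As no vertex had degree 4 before, a reduction that
  alters few vertices of \<open>W\<close> is impossible.\<close>

lemma parts_degree_4:
  assumes P: "tip_bound_parts V z \<mu>' t' P"
    and e: "0 \<le> e" and k: "cut V \<mu>' U = d U - e" "dist6 (sum t U) \<le> dist6 (sum t' U) + e"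
    and cut': "\<And>A. A \<subseteq> U \<Longrightarrow> d A - 2 \<le> cut V \<mu>' A" "v \<in> U \<Longrightarrow> d {v} - e \<le> cut V \<mu>' {v}"
  shows "v \<in> U" and "cut V \<mu>' {v} = d {v} - e" and "w \<in> W \<Longrightarrow> cut V \<mu>' {w} = 4"
proof -
  note P = tip_bound_partsD[OF P]
  show v: "v \<in> U" using P(1) k viol by auto
  have le: "d U \<le> d {v} + 2" using viol v by blast
  have "P v = {v}"
  proof (rule card_cases[of "P v"])
    fix a assume "P v = {a}"
    then show ?thesis using P(2)[OF v] by simp
  next
    assume "2 \<le> card (P v)"
    then have "d {v} + 3 \<le> d (P v)" by (rule sub3[OF P(3)[OF v] _ P(2)[OF v]])
    moreover have "d (P v) - 2 \<le> cut V \<mu>' (P v)" using cut'(1) P(3)[OF v] by blast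
    ultimately show ?thesis using P(4)[OF v] k(1) e le by linarith
  qed (use P(2,3)[OF v] in auto)
  then show eq: "cut V \<mu>' {v} = d {v} - e" using P(4)[OF v] k(1) le cut'(2)[OF v] by simp
  assume w: "w \<in> W"
  have U2: "cut V \<mu>' (P v) + 2 = cut V \<mu>' U"
    using P(4)[OF v] k(1) le eq \<open>P v = {v}\<close> by simp
  have w4: "cut V \<mu>' (P w) = 4"
    by (rule P(5)[OF v U2]) (use w \<open>P v = {v}\<close> in auto)
  have wU: "w \<in> U" using w by blast
  show "cut V \<mu>' {w} = 4"
  proof (rule card_cases[of "P w"])
    fix a assume "P w = {a}"
    then show ?thesis using P(2)[OF wU] w4 by simp
  next
    assume "2 \<le> card (P w)"
    then have "8 \<le> d (P w)" by (rule sub8[OF P(3)[OF wU]])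
    moreover have "d (P w) - 2 \<le> cut V \<mu>' (P w)" using cut'(1) P(3)[OF wU] by blast
    ultimately show ?thesis using w4 by simp
  qed (use P(2,3)[OF wU] in auto)
qed

lemma weight_decrease:
  assumes "\<And>u. u \<in> U \<Longrightarrow> cut V \<mu>' {u} \<le> d {u}" "x \<in> U" "cut V \<mu>' {x} < d {x}"
  shows "weight V z \<mu>' < weight V z \<mu>"
  unfolding weight_def
proof (rule sum_strict_mono_ex1)
  show "\<exists>a\<in>U. cut V \<mu>' {a} + 1 < d {a} + 1" by (rule bexI[of _ x]) (use assms in auto)
qed (use assms D(2) in auto)

text \<open>Otherwise this edge could be deleted: sets of at least two vertices have a slack of 2
  and lose one unit of the cut and at most one of the residue. Then \<open>parts_degree_4\<close>
  forces \<open>y = v\<close>, but in that case the degrees in \<open>W\<close> are unchanged and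
  none of them is 4.\<close>

lemma no_spare_tip_edge:
  assumes y: "y \<in> U" and s: "s = 1 \<or> s = - 1" and edge: "\<psi> y + s \<in> netset (\<mu> z y - 1)"
  shows "d {y} - 1 < 4 + dist6 (t y - s)"
proof (rule ccontr)
  assume "\<not> ?thesis"
  then have good: "4 + dist6 (t y - s) \<le> d {y} - 1" by simp
  define t' where "t' u = (if u = z then t z + s * int (card {y}) else if u \<in> {y} then t u - s else t u)" for u
  let ?m = "del_star z {y} \<mu>"
  have s_odd: "odd s" using s by auto
  obtain \<psi>' where J: "inst V z ?m t'" "preflow V z ?m t' \<psi>'" "\<not> extendable V z ?m t' \<psi>'"
    and cut': "\<forall>A\<subseteq>U. cut V ?m A = d A - int (card ({y} \<inter> A))"
  proof (rule delete_tip_edges[OF I pre nonext _ _ t'_def s_odd])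
    show "{y} \<subseteq> U" "\<And>a. a \<in> {y} \<Longrightarrow> \<psi> a + s \<in> netset (\<mu> z a - 1)" using y edge by auto
  qed
  have c: "cut V ?m A = d A - of_bool (y \<in> A)" if "A \<subseteq> U" for A
    using cut' that by (cases "y \<in> A") auto
  have tA: "sum t' A = sum t A - (if y \<in> A then s else 0)" if "A \<subseteq> U" for A
  proof -
    have "sum t' A = (\<Sum>u\<in>A. t u - (if u = y then s else 0))"
      by (rule sum.cong) (use that in \<open>auto simp: t'_def\<close>)
    then show ?thesis using finU[OF that] by (simp add: sum_subtractf)
  qed
  have tame': "4 + dist6 (sum t' A) \<le> cut V ?m A" if A: "A \<subset> U" "A \<noteq> {}" for A
  proof (rule card_cases[of A])
    fix a assume a: "A = {a}"
    then have "a \<in> U" using A by blast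
    then show ?thesis
      unfolding a using good c[of "{a}"] tA[of "{a}"] tame1[of a] by (cases "y = a") auto
  next
    assume "2 \<le> card A"
    then show ?thesis
      using sub_bound(1)[OF A(1)] c[of A] tA[of A] A dist6_step[OF s, of "sum t A"] by auto
  qed (use A in auto)
  have "weight V z ?m < weight V z \<mu>"
    by (rule weight_decrease[of _ y]) (use c y in auto)
  then obtain P where P: "tip_bound_parts V z ?m t' P"
    using reduce[OF J tame'] by blast
  have k: "cut V ?m U = d U - 1" using c[of U] y by simp
  have \<tau>: "dist6 (sum t U) \<le> dist6 (sum t' U) + 1"
    using dist6_step[of "- s" "sum t' U"] s tA[of U] y by auto
  have c2: "d A - 2 \<le> cut V ?m A" if "A \<subseteq> U" for A using c[OF that] by simp
  have cv: "d {v} - 1 \<le> cut V ?m {v}" if "v \<in> U" using c[of "{v}"] that by simp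
  note * = parts_degree_4[OF P zero_le_one k \<tau> c2 cv]
  then have "y = v" using c[of "{v}"] by (auto split: if_splits)
  obtain w where "w \<in> W" using W_nonempty by auto
  then show False using *(3)[of w] c[of "{w}"] no4[of w] \<open>y = v\<close> by auto
qed

text \<open>Otherwise the edge could be directed from \<open>x\<close> to \<open>y\<close> and
  deleted. No other degree changes, so \<open>parts_degree_4\<close> puts \<open>W\<close> inside
  \<open>{x, y}\<close>, which \<open>three_vertices\<close> excludes.\<close>

lemma no_spare_edge:
  assumes xy: "x \<in> W" "y \<in> W" "x \<noteq> y" "1 \<le> \<mu> x y" and x: "4 + dist6 (t x - 1) \<le> d {x} - 1"
  shows "d {y} - 1 < 4 + dist6 (t y + 1)"
proof (rule ccontr)
  assume "\<not> ?thesis"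
  then have y: "4 + dist6 (t y + 1) \<le> d {y} - 1" by simp
  define t' where "t' = t(x := t x - 1, y := t y + 1)"
  let ?m = "add_mult x y (- 1) \<mu>"
  have xyU: "x \<in> U" "y \<in> U" using xy by auto
  note J = delete_edge[OF I pre nonext xyU xy(3,4) t'_def]
  have c: "cut V ?m A = d A - of_bool ((x \<in> A) \<noteq> (y \<in> A))" if "A \<subseteq> U" for A
  proof -
    have "x \<in> V" "y \<in> V" "A \<subseteq> V" using xyU that by auto
    then show ?thesis using cut_add_mult[OF D(2) _ _ xy(3), of A "- 1" \<mu>] by simp
  qed
  have tA: "sum t' A = sum t A - of_bool (x \<in> A) + of_bool (y \<in> A)" if "A \<subseteq> U" for A
  proof -
    have "sum t' A = (\<Sum>u\<in>A. t u - (if u = x then 1 else 0) + (if u = y then 1 else 0))"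
      by (rule sum.cong) (use xy(3) in \<open>auto simp: t'_def\<close>)
    then show ?thesis using finU[OF that] by (simp add: sum_subtractf sum.distrib)
  qed
  have tame': "4 + dist6 (sum t' A) \<le> cut V ?m A" if A: "A \<subset> U" "A \<noteq> {}" for A
  proof (rule card_cases[of A])
    fix a assume a: "A = {a}"
    then have "a \<in> U" using A by blast
    then show ?thesis
      unfolding a using x y c[of "{a}"] tA[of "{a}"] tame1[of a] xy(3) by (cases "x = a"; cases "y = a") auto
  next
    assume "2 \<le> card A"
    then show ?thesis
      using sub_bound(1)[OF A(1)] c[of A] tA[of A] A dist6_step[of 1 "sum t A"] dist6_step[of "- 1" "sum t A"]
      by auto
  qed (use A in auto)
  have "weight V z ?m < weight V z \<mu>"
    by (rule weight_decrease[of _ x]) (use c xyU xy in auto)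
  then obtain P where P: "tip_bound_parts V z ?m t' P"
    using reduce[OF J tame'] by blast
  have k: "cut V ?m U = d U - 0" using c[of U] xyU by simp
  have \<tau>: "dist6 (sum t U) \<le> dist6 (sum t' U) + 0" using tA[of U] xyU by simp
  have cv: "d {v} - 0 \<le> cut V ?m {v}" if "v \<in> U" using c[of "{v}"] that xy by auto
  have c2: "d A - 2 \<le> cut V ?m A" if "A \<subseteq> U" for A using c[OF that] by simp
  note * = parts_degree_4(1,3)[OF P order_refl k \<tau> c2 cv]
  have "W \<subseteq> {x, y}"
  proof
    fix w assume "w \<in> W"
    then show "w \<in> {x, y}" using *(2)[of w] c[of "{w}"] no4[of w] by (cases "w = x"; cases "y = w") auto
  qed
  then show False using three_vertices[OF *(1) xy(1-3)] by blast
qed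

text \<open>Without such an edge \<open>d U\<close> is the sum of the cuts of both sides, each at
  least 4 plus its residue. That is at least 8 plus the residue of \<open>U\<close>; and if
  \<open>v\<close> is in \<open>U\<close>, the side of \<open>v\<close> has cut at least
  \<open>d {v}\<close>, so the sum is at least \<open>d {v} + 4\<close>. Either way there is no
  violation.\<close>

lemma connected:
  assumes X: "X \<subset> U" "X \<noteq> {}"
  obtains a b where "a \<in> X" "b \<in> U - X" "1 \<le> \<mu> a b"
proof (rule ccontr)
  assume no: "\<not> thesis"
  note witness = that
  have "\<mu> a b = 0" if "a \<in> X" "b \<in> U - X" for a b
  proof (rule ccontr)
    assume "\<mu> a b \<noteq> 0"
    then have "1 \<le> \<mu> a b" using D(5)[of a b] by linarith
    then show False using no witness that by blast
  qed
  then have "ecount \<mu> X (U - X) = 0" unfolding ecount_def by (simp add: sum.neutral)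
  moreover have "X \<union> (U - X) = U" using X by auto
  ultimately have dU: "d U = d X + d (U - X)" using cut_Un[of X "U - X"] X by auto
  have Y: "U - X \<subset> U" "U - X \<noteq> {}" using X by auto
  have part: "d {v} \<le> d A" if "v \<in> A" "A \<subset> U" for A
    by (rule card_cases[of A]) (use that sub3[of A v] in auto)
  note tX = tame_proper[OF X] and tY = tame_proper[OF Y]
  note b = dist6_bounds(1)[of "sum t X"] dist6_bounds(1)[of "sum t (U - X)"]
  show False
  proof (cases "v \<in> U")
    case False
    have "sum t U = sum t (U - X) + sum t X" using X D(2) by (intro sum.subset_diff) auto
    moreover have "d U \<le> 4 + dist6 (sum t U)" using viol False by blast
    ultimately show False
      using dist6_add[of "sum t (U - X)" "sum t X"] tX tY dU by simp
  next
    case True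
    then have "d {v} \<le> d X \<or> d {v} \<le> d (U - X)" using part[of X] part[of "U - X"] X Y by blast
    moreover have "d U \<le> d {v} + 2" using viol True by blast
    ultimately show False using tX tY b dU by linarith
  qed
qed

text \<open>By parity the alternative is a slack of 2 at \<open>x\<close>, which pays for splitting
  off a pair of its edges. Among the degrees of non-tip vertices only that of \<open>x\<close>
  changes, so \<open>parts_degree_4\<close> puts \<open>W\<close> inside \<open>{x}\<close>. The
  residue is not 0 because degree 4 is excluded.\<close>

lemma tight:
  assumes x: "x \<in> W"
  shows "d {x} = 4 + dist6 (t x)" and "1 \<le> dist6 (t x)"
proof -
  have xU: "x \<in> U" using x by blast
  have sgl: "{x} \<subset> U" "{x} \<noteq> {}"
  proof -
    have "card U \<noteq> card {x}" using card2 by simp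
    then have "{x} \<noteq> U" by metis
    moreover have "{x} \<subseteq> U" using xU by blast
    ultimately show "{x} \<subset> U" by blast
  qed auto
  show eq: "d {x} = 4 + dist6 (t x)"
  proof (rule ccontr)
    assume "\<not> ?thesis"
    then have slack: "6 + dist6 (t x) \<le> d {x}"
    proof -
      have "even (d {x} - dist6 (t x))" using D(6)[of x] xU dist6_even[of "t x"] by auto
      then obtain k where k: "d {x} - dist6 (t x) = 2 * k" by (elim evenE)
      then have "k \<noteq> 2" using \<open>d {x} \<noteq> 4 + dist6 (t x)\<close> by auto
      then show ?thesis using tame1[OF xU] k by linarith
    qed
    obtain b where b: "b \<in> U - {x}" "1 \<le> \<mu> x b"
      using connected[OF sgl] by blast
    obtain a where a: "a \<in> V - {x}" "a \<noteq> b" "1 \<le> \<mu> x a"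
    proof (rule ccontr)
      assume no: "\<not> thesis"
      note witness = that
      have zero: "\<mu> x w = 0" if w: "w \<in> V - {x} - {b}" for w
      proof (rule ccontr)
        assume "\<mu> x w \<noteq> 0"
        then have "1 \<le> \<mu> x w" using D(5)[of x w] by linarith
        then show False using no witness[of w] w by blast
      qed
      have "d {x} = \<mu> x b + (\<Sum>w\<in>V - {x} - {b}. \<mu> x w)"
        unfolding cut_single using b D(2) by (intro sum.remove) auto
      then have "d {x} = \<mu> x b" using zero by simp
      then show False using edge_le_1[of x b] b xU five[OF xU] by auto
    qed
    have ne: "x \<noteq> a" "x \<noteq> b" "a \<in> V" "b \<in> U" using a b by auto
    let ?m = "lift_mult x a b \<mu>"
    obtain \<psi>' where J: "inst V z ?m t" "preflow V z ?m t \<psi>'" "\<not> extendable V z ?m t \<psi>'"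
      by (rule lift_edges[OF I pre nonext xU ne(3,4) a(2) ne(1,2) a(3) b(2)])
    have c: "cut V ?m A = d A - (if (a \<in> A) = (b \<in> A) \<and> (x \<in> A) \<noteq> (a \<in> A) then 2 else 0)" if "A \<subseteq> U" for A
      by (rule cut_lift) (use D(2) xU ne a(2) that in auto)
    have tame': "4 + dist6 (sum t A) \<le> cut V ?m A" if A: "A \<subset> U" "A \<noteq> {}" for A
    proof (rule card_cases[of A])
      fix w assume w: "A = {w}"
      then have "w \<in> U" using A by blast
      then show ?thesis
        unfolding w using slack c[of "{w}"] tame1[of w] a(2) by (cases "x = w") auto
    next
      assume "2 \<le> card A"
      then show ?thesis using sub_bound(1)[OF A(1)] c[of A] A by auto
    qed (use A in auto)
    have "weight V z ?m < weight V z \<mu>"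
      by (rule weight_decrease[of _ x]) (use c xU ne in auto)
    then obtain P where P: "tip_bound_parts V z ?m t P"
      using reduce[OF J tame'] by blast
    have k: "cut V ?m U = d U - 0" using c[of U] xU ne by auto
    have \<tau>: "dist6 (sum t U) \<le> dist6 (sum t U) + 0" by simp
    have cv: "d {v} - 0 \<le> cut V ?m {v}" if "v \<in> U" using c[of "{v}"] that x a(2) by auto
    have c2: "d A - 2 \<le> cut V ?m A" if "A \<subseteq> U" for A using c[OF that] by auto
    note * = parts_degree_4(1,3)[OF P order_refl k \<tau> c2 cv]
    have "W \<subseteq> {x}"
    proof
      fix w assume w: "w \<in> W"
      then show "w \<in> {x}" using *(2)[of w] c[of "{w}"] no4[of w] a(2) by (auto split: if_splits)
    qed
    then show False using two_vertices[OF *(1)] by blast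
  qed
  then show "1 \<le> dist6 (t x)" using no4[OF xU] dist6_bounds(1)[of "t x"] by linarith
qed

end

section \<open>The direction asked for by a tight vertex\<close>

context violation
begin

text \<open>For \<open>s = 1\<close>, deleting an edge that leaves \<open>x\<close> lowers the
  residue at \<open>x\<close>; for \<open>s = - 1\<close>, deleting one that enters
  \<open>x\<close>. At distance 3 both hold.\<close>

definition good :: "int \<Rightarrow> 'v \<Rightarrow> bool" where
  "good s x \<longleftrightarrow> dist6 (t x - s) = dist6 (t x) - 1"

lemma good_exists:
  assumes "x \<in> W"
  obtains s where "s = 1 \<or> s = - 1" "good s x" "6 dvd t x - s * dist6 (t x)"
  using dist6_decrease[OF tight(2)[OF assms]] unfolding good_def by metis

text \<open>A tip edge of the opposite direction could be deleted: at a tight vertex the loss of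
  degree is matched by the loss of residue.\<close>

lemma good_tip:
  assumes x: "x \<in> W" and s: "s = 1 \<or> s = - 1" and g: "good s x"
  shows "\<psi> x = s * \<mu> z x"
proof (rule netset_extreme[OF _ s])
  have xU: "x \<in> U" using x by blast
  show "\<psi> x \<in> netset (\<mu> z x)" using pre xU unfolding preflow_def by blast
  show "\<psi> x + s \<notin> netset (\<mu> z x - 1)"
    using no_spare_tip_edge[OF xU s] tight(1)[OF x] g unfolding good_def by auto
qed

text \<open>The preflow does not orient the edge between \<open>x\<close> and \<open>y\<close>. If
  the two vertices asked for opposite net directions, it could be directed to suit both and deleted.
  So \<open>y\<close> cannot ask for \<open>- s\<close>, not even as one of two choices.\<close>

lemma good_adjacent:
  assumes xy: "x \<in> W" "y \<in> W" "x \<noteq> y" "1 \<le> \<mu> x y" and s: "s = 1 \<or> s = - 1" and g: "good s x"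
  shows "good s y" and "\<not> good (- s) y"
proof -
  have no: "\<not> (good 1 a \<and> good (- 1) b)" if "a \<in> W" "b \<in> W" "a \<noteq> b" "1 \<le> \<mu> a b" for a b
    using no_spare_edge[OF that] tight(1)[OF that(1)] tight(1)[OF that(2)] unfolding good_def by auto
  have "1 \<le> \<mu> y x" using xy(4) D(4)[of x y] by simp
  then show ng: "\<not> good (- s) y" using no[OF xy] no[OF xy(2,1)] xy(3) s g by auto
  obtain s' where "s' = 1 \<or> s' = - 1" "good s' y" using good_exists[OF xy(2)] by blast
  then show "good s y" using ng s by auto
qed

text \<open>3 and -3 agree modulo 6, so at distance 3 both signs would be good.\<close>

lemma one_sided:
  assumes x: "x \<in> W" and s: "s = 1 \<or> s = - 1" and g: "good s x" "\<not> good (- s) x"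
  shows "6 dvd t x - s * dist6 (t x)" and "dist6 (t x) = 1 \<or> dist6 (t x) = 2"
proof -
  obtain s' where s': "s' = 1 \<or> s' = - 1" "good s' x" "6 dvd t x - s' * dist6 (t x)"
    by (rule good_exists[OF x])
  then have "s' = s" using s g by auto
  then show ts: "6 dvd t x - s * dist6 (t x)" using s'(3) by simp
  have "dist6 (t x) \<noteq> 3"
  proof
    assume 3: "dist6 (t x) = 3"
    have "dist6 (t x + s) = dist6 (s * 4)"
      by (rule dist6_cong) (use ts 3 in \<open>simp add: algebra_simps\<close>)
    also have "\<dots> = 2"
      using s dist6_cong[of 4 "-2"] dist6_cong[of "-4" 2] dist6_small[of 2] dist6_small[of "-2"] by auto
    finally show False using g(2) 3 unfolding good_def by simp
  qed
  then show "dist6 (t x) = 1 \<or> dist6 (t x) = 2"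
    using tight(2)[OF x] dist6_bounds(2)[of "t x"] by linarith
qed

text \<open>
  A tight vertex \<open>x\<close> all of whose tip edges point the wrong way can have five of its edges
  pointing that way (here \<open>s = 1\<close> means "into \<open>x\<close>").  Orienting it like this and merging it into the
  tip turns the remaining ones among these five into deletable tip edges, and deleting enough
  of them restores the old degree of the tip.
\<close>

lemma absorb:
  assumes x: "x \<in> W" and s: "s = 1 \<or> s = - 1" and g: "good s x" "\<not> good (- s) x"
    and m: "1 \<le> \<mu> z x" "\<mu> z x \<le> 2"
  shows "6 \<le> d U" and "v \<in> U \<Longrightarrow> d U = d {v} + 2 \<and> \<mu> z x = 1 \<and> \<mu> v x = 1"
proof -
  define \<tau> where "\<tau> = dist6 (t x)"
  define m where "m = \<mu> z x"
  have xU: "x \<in> U" "x \<noteq> v" using x by auto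
  have ts: "6 dvd t x - s * \<tau>" and \<tau>12: "\<tau> = 1 \<or> \<tau> = 2"
    using one_sided[OF x s g] by (auto simp: \<tau>_def)
  have dx: "d {x} = 4 + \<tau>" using tight(1)[OF x] by (simp add: \<tau>_def)
  have m12: "m = 1 \<or> m = 2" using m by (auto simp: m_def)
  have \<psi>x: "\<psi> x = s * m" using good_tip[OF x s g(1)] by (simp add: m_def)
  define A where "A = U - {x}"
  have AU: "A \<subset> U" using xU by (auto simp: A_def)
  have A0: "A \<noteq> {}"
  proof
    assume "A = {}"
    then have "card U \<le> card {x}" by (intro card_mono) (auto simp: A_def)
    then show False using card2 by simp
  qed
  have finA: "finite B" if "B \<subseteq> A" for B by (rule finU) (use that AU in auto)
  have A': "A = V - {z, x}" "A \<subseteq> V - {z}" by (auto simp: A_def)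
  define N where "N = {y \<in> A. \<mu> x y = 1}"
  have NA: "N \<subseteq> A" by (auto simp: N_def)
  have mu: "\<mu> x y = of_bool (y \<in> N)" if "y \<in> A" for y
    using that xU edge_le_1[of x y] D(5)[of x y] by (auto simp: N_def A_def)
  have muB: "(\<Sum>y\<in>B. \<mu> x y) = int (card (N \<inter> B))" if "B \<subseteq> A" for B
  proof -
    have "(\<Sum>y\<in>B. \<mu> x y) = (\<Sum>y\<in>B. of_bool (y \<in> N))"
      by (rule sum.cong[OF refl], rule mu) (use that in auto)
    then show ?thesis using finA[OF that] by (simp add: sum_of_bool_eq Int_def conj_commute)
  qed
  have cardN: "int (card N) = 4 + \<tau> - m"
    using degree_split(1)[OF xU(1)] muB[of A] NA dx by (simp add: A_def[symmetric] m_def Int_absorb2)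
  have finN: "finite N" using finA[OF NA] .
  \<comment> \<open>The end of the one edge that points the other way when
    \<open>\<tau> = 2\<close>. Taking \<open>v\<close> for it whenever possible keeps enough
    deletable edges away from \<open>v\<close>.\<close>
  obtain y0 where y0: "y0 \<in> N" "v \<in> N \<Longrightarrow> y0 = v"
  proof (cases "v \<in> N")
    case False
    have "N \<noteq> {}" using cardN \<tau>12 m12 by auto
    then show ?thesis using that False by blast
  qed (use that in blast)
  \<comment> \<open>Together with the \<open>m\<close> tip edges these are five edges pointing the
    wrong way. The net outflow of \<open>x\<close> is \<open>- 5 * s\<close> for
    \<open>\<tau> = 1\<close> and, with the edge to \<open>y0\<close>, \<open>- 4 * s\<close> for
    \<open>\<tau> = 2\<close>; modulo 6 both equal \<open>s * \<tau>\<close>.\<close>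
  define N' where "N' = (if \<tau> = 2 then N - {y0} else N)"
  have N'N: "N' \<subseteq> N" by (auto simp: N'_def)
  have cardN': "int (card N') = 5 - m"
    using cardN \<tau>12 m12 y0 finN by (auto simp: N'_def card_Diff_singleton)
  have cardN'v: "4 + \<tau> - 2 * m \<le> int (card (N' - {v}))"
  proof (cases "v \<in> N'")
    case True
    then have "\<tau> = 1" using \<tau>12 y0 N'N by (auto simp: N'_def split: if_splits)
    then show ?thesis using cardN' True m12 finite_subset[OF N'N finN] by (auto simp: card_Diff_singleton)
  next
    case False
    then show ?thesis using cardN' m12 \<tau>12 by auto
  qed
  then have "nat (4 + \<tau> - 2 * m) \<le> card (N' - {v})" by simp
  \<comment> \<open>Merging \<open>x\<close> raises the tip degree by \<open>d {x} - 2 * m\<close>,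
    that is by \<open>4 + \<tau> - 2 * m\<close>; exactly as many edges are deleted.\<close>
  then obtain Y where Y: "Y \<subseteq> N' - {v}" "card Y = nat (4 + \<tau> - 2 * m)" "finite Y"
    by (rule obtain_subset_with_card_n)
  have cardY: "int (card Y) = 4 + \<tau> - 2 * m" using Y(2) \<tau>12 m12 by auto
  have YN: "Y \<subseteq> N" "Y \<subseteq> A" "v \<notin> Y" using Y(1) N'N NA by auto
  define \<xi> where "\<xi> y = (if y \<in> N' then - s else if y \<in> N then s else 0)" for y
  have sum\<xi>: "sum \<xi> A = - s * (5 - m) + (if \<tau> = 2 then s else 0)"
  proof -
    have "sum \<xi> A = sum \<xi> N"
      by (rule sum.mono_neutral_right) (use NA N'N finA in \<open>auto simp: \<xi>_def\<close>)
    also have "\<dots> = sum \<xi> (N - N') + sum \<xi> N'"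
      by (rule sum.subset_diff[OF N'N finN])
    also have "sum \<xi> N' = - s * int (card N')" by (simp add: \<xi>_def)
    also have "sum \<xi> (N - N') = (if \<tau> = 2 then s else 0)"
    proof -
      have "N - N' = (if \<tau> = 2 then {y0} else {})" using y0 by (auto simp: N'_def)
      then show ?thesis using y0 by (auto simp: \<xi>_def N'_def)
    qed
    finally show ?thesis using cardN' by simp
  qed
  let ?V = "insert z A" and ?m1 = "quot_mult V (onto_tip z A) \<mu>" and ?t1 = "quot_sum V (onto_tip z A) t"
  have VA: "?V - {z} = A" "V - A = {z, x}" using xU D(3) by (auto simp: A_def)
  have \<xi>net: "\<xi> y \<in> netset (\<mu> x y)" if "y \<in> V - {z, x}" for y
    using that mu[of y] s N'N by (auto simp: \<xi>_def netset_def A'(1)[symmetric])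
  have \<xi>6: "6 dvd sum \<xi> (V - {z, x}) - \<psi> x - t x"
  proof -
    have "sum \<xi> A - \<psi> x - t x = - (t x - s * \<tau>) - 6 * s"
      using \<tau>12 by (auto simp: sum\<xi> \<psi>x algebra_simps)
    moreover have "6 dvd - (t x - s * \<tau>) - 6 * s" using ts by (metis dvd_diff dvd_minus_iff dvd_triv_left)
    ultimately show ?thesis by (simp only: A'(1)[symmetric])
  qed
  define \<psi>1 where "\<psi>1 y = \<psi> y + \<xi> y" for y
  have I1: "inst ?V z ?m1 ?t1" by (rule inst_onto_tip[OF I A'(2)])
  have pre1: "preflow ?V z ?m1 ?t1 \<psi>1" "\<not> extendable ?V z ?m1 ?t1 \<psi>1"
    using merge_into_tip[OF I pre nonext xU(1) \<xi>net \<xi>6] unfolding \<psi>1_def A'(1) by auto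
  note q = quot_onto_tip[OF A'(2) D(3)]
  have m1z: "?m1 z y = \<mu> z y + \<mu> x y" if "y \<in> A" for y
  proof -
    have "z \<noteq> x" using xU by auto
    then show ?thesis using q(2)[OF that, of \<mu>] by (simp add: VA(2))
  qed
  define t2 where "t2 u = (if u = z then ?t1 z + s * int (card Y) else if u \<in> Y then ?t1 u - s else ?t1 u)" for u
  let ?m2 = "del_star z Y ?m1"
  have s_odd: "odd s" using s by auto
  obtain \<psi>2 where J: "inst ?V z ?m2 t2" "preflow ?V z ?m2 t2 \<psi>2" "\<not> extendable ?V z ?m2 t2 \<psi>2"
    and del: "\<forall>B\<subseteq>?V - {z}. cut ?V ?m2 B = cut ?V ?m1 B - int (card (Y \<inter> B))"
  proof (rule delete_tip_edges[OF I1 pre1 _ _ t2_def s_odd])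
    show "Y \<subseteq> ?V - {z}" using YN VA by simp
    fix y assume "y \<in> Y"
    then have y: "y \<in> A" "y \<in> N'" "\<mu> x y = 1" using YN Y(1) by (auto simp: N_def)
    then have "\<psi> y \<in> netset (\<mu> z y)" using pre A' unfolding preflow_def by blast
    then show "\<psi>1 y + s \<in> netset (?m1 z y - 1)" using y by (simp add: \<psi>1_def \<xi>_def m1z)
  qed
  define i where "i B = int (card (Y \<inter> B))" for B
  have c2: "cut ?V ?m2 B = d B - i B" if B: "B \<subseteq> A" for B
    using del B cut_onto_tip[OF D(2,3) A'(2) B, of \<mu>] VA(1) by (simp add: i_def)
  have t2: "sum t2 B = sum t B - s * i B" if B: "B \<subseteq> A" for B
  proof -
    have "sum t2 B = (\<Sum>u\<in>B. t u - (if u \<in> Y then s else 0))"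
      by (rule sum.cong) (use B VA(1) q(3) in \<open>auto simp: t2_def A'(1)\<close>)
    also have "\<dots> = sum t B - (\<Sum>u\<in>B. if u \<in> Y then s else 0)" by (simp add: sum_subtractf)
    also have "(\<Sum>u\<in>B. if u \<in> Y then s else 0) = s * i B"
      using finA[OF B] by (simp add: sum.If_cases i_def Int_def conj_commute)
    finally show ?thesis .
  qed
  have i0: "0 \<le> i B" for B by (simp add: i_def)
  have iN: "i B \<le> int (card (N \<inter> B))" for B
    unfolding i_def using YN finN by (intro of_nat_mono card_mono) auto
  have ins: "d (insert x B) = d B + 4 + \<tau> - 2 * int (card (N \<inter> B))" if B: "B \<subseteq> A" for B
  proof -
    have "insert x B \<subseteq> V" "x \<notin> B" using B xU by (auto simp: A_def)
    then show ?thesis using cut_insert[of x B] dx muB[OF B] by simp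
  qed
  have insU: "insert x B \<subset> U" "2 \<le> card (insert x B)" if "B \<subset> A" "2 \<le> card B" for B
    using that xU finA[of B] by (auto simp: A_def card_insert_if)
  \<comment> \<open>If more than two deleted edges end in \<open>B\<close>, then many edges join
    \<open>x\<close> to \<open>B\<close>, and \<open>sub3\<close> for \<open>insert x B\<close>
    makes \<open>d B\<close> large enough.\<close>
  have large: "6 \<le> d B - i B" if B: "B \<subset> A" "2 \<le> card B" for B
  proof (cases "i B \<le> 2")
    case True
    have "8 \<le> d B" by (rule sub8) (use B AU in auto)
    then show ?thesis using True by simp
  next
    case False
    have "d {x} + 3 \<le> d (insert x B)" by (rule sub3[OF insU[OF B]]) simp
    then show ?thesis using ins[of B] B iN[of B] dx False by auto
  qed
  have tame2: "4 + dist6 (sum t2 B) \<le> cut ?V ?m2 B" if B': "B \<subset> ?V - {z}" "B \<noteq> {}" for B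
  proof -
    have B: "B \<subset> A" "B \<subseteq> A" "B \<subseteq> U" "B \<subset> U" using B' VA(1) AU by auto
    show ?thesis
    proof (rule card_cases[OF B(3) B'(2)])
      fix w assume w: "B = {w}"
      have wA: "w \<in> A" "w \<in> U" using B w by auto
      show ?thesis
      proof (cases "w \<in> Y")
        case True
        then have "w \<in> W" "w \<noteq> x" "1 \<le> \<mu> x w" using wA YN by (auto simp: N_def A_def)
        then have "good s w" "d {w} = 4 + dist6 (t w)"
          using good_adjacent(1)[OF x _ _ _ s g(1)] tight(1) by auto
        then show ?thesis using c2[OF B(2)] t2[OF B(2)] True unfolding w good_def i_def by simp
      next
        case False
        then show ?thesis using c2[OF B(2)] t2[OF B(2)] tame1[OF wA(2)] unfolding w i_def by simp
      qed
    next
      assume cB: "2 \<le> card B"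
      note lg = large[OF B(1) cB]
      note b = dist6_bounds(2)[of "sum t2 B"]
      have ev: "even (dist6 (sum t2 B) + (d B - i B))"
        using parity[OF B(3)] s_odd t2[OF B(2)] dist6_even[of "sum t2 B"] by auto
      \<comment> \<open>The cut is at least 6 and the residue at most 3, so tameness could fail only
        for 6 and 3, which differ in parity.\<close>
      have "\<not> (dist6 (sum t2 B) = 3 \<and> d B - i B = 6)"
      proof
        assume "dist6 (sum t2 B) = 3 \<and> d B - i B = 6"
        then have "even (3 + 6 :: int)" using ev by (simp only:)
        then show False by simp
      qed
      then show ?thesis using lg b c2[OF B(2)] by linarith
    qed
  qed
  have weight2: "weight ?V z ?m2 < weight V z \<mu>"
  proof -
    have "weight ?V z ?m2 \<le> (\<Sum>u\<in>A. d {u} + 1)"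
      unfolding weight_def VA(1)
    proof (rule sum_mono)
      fix u assume "u \<in> A"
      then show "cut ?V ?m2 {u} + 1 \<le> d {u} + 1" using c2[of "{u}"] i0[of "{u}"] by simp
    qed
    also have "\<dots> < weight V z \<mu>"
      unfolding weight_def using sum.remove[of U x "\<lambda>v. d {v} + 1"] xU D(2) dx \<tau>12 by (auto simp: A_def)
    finally show ?thesis .
  qed
  obtain P where "tip_bound_parts ?V z ?m2 t2 P"
    using reduce[OF J tame2 weight2] by blast
  note P = tip_bound_partsD[OF this, unfolded VA(1)]
  have "i A = 4 + \<tau> - 2 * m" using YN cardY by (simp add: i_def Int_absorb2)
  then have k2: "cut ?V ?m2 A = d U"
    using c2[of A] degree_split(2)[OF xU(1)] dx by (simp add: A_def[symmetric] m_def)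
  show "6 \<le> d U" using P(1) k2 dist6_bounds(1)[of "sum t2 A"] by simp
  assume vU: "v \<in> U"
  then have vA: "v \<in> A" using xU by (simp add: A_def)
  have le: "d U \<le> d {v} + 2" using viol vU by blast
  have Pv: "P v \<subset> A" "v \<in> P v" using P(2,3)[OF vA] by auto
  have cPv: "cut ?V ?m2 (P v) = d (P v) - i (P v)" using c2 Pv by auto
  have big: "d {v} + 1 + (2 * int (card (N \<inter> P v)) - i (P v)) - 2 - \<tau> \<le> d (P v) - i (P v)"
    "i (P v) \<le> 2 \<Longrightarrow> d {v} + 1 \<le> d (P v) - i (P v)" if "2 \<le> card (P v)"
  proof -
    have "d {v} + 3 \<le> d (insert x (P v))" by (rule sub3[OF insU[OF Pv(1) that]]) (use Pv in simp)
    then show "d {v} + 1 + (2 * int (card (N \<inter> P v)) - i (P v)) - 2 - \<tau> \<le> d (P v) - i (P v)"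
      using ins[of "P v"] Pv by auto
    have "d {v} + 3 \<le> d (P v)" by (rule sub3) (use Pv AU that in auto)
    then show "i (P v) \<le> 2 \<Longrightarrow> d {v} + 1 \<le> d (P v) - i (P v)" by simp
  qed
  have ge: "d {v} \<le> cut ?V ?m2 (P v)"
  proof (rule card_cases[of "P v"])
    fix w assume "P v = {w}"
    then have "P v = {v}" using Pv(2) by simp
    then show ?thesis using cPv YN(3) by (simp add: i_def)
  next
    assume "2 \<le> card (P v)"
    note bg = big[OF this]
    show ?thesis
    proof (cases "i (P v) \<le> 2")
      case True
      then show ?thesis using bg(2) cPv by simp
    next
      case False
      then show ?thesis using bg(1) cPv iN[of "P v"] \<tau>12 by auto
    qed
  qed (use Pv AU in auto)
  have eq: "cut ?V ?m2 (P v) = d {v}" "d U = d {v} + 2" using ge P(4)[OF vA] k2 le by auto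
  \<comment> \<open>A part of degree 4 is a single vertex by \<open>large\<close>. It had another
    degree before, so it lost an edge to the deletion.\<close>
  have other: "u \<in> Y" if u: "u \<in> A" "u \<notin> P v" for u
  proof -
    have Pu: "P u \<subset> A" "u \<in> P u" using P(2,3)[OF u(1)] by auto
    have u4: "d (P u) - i (P u) = 4"
      using P(5)[OF vA _ u] k2 eq c2[of "P u"] Pu by auto
    show ?thesis
    proof (rule card_cases[of "P u"])
      fix w assume "P u = {w}"
      then have "P u = {u}" using Pu(2) by simp
      moreover have "u \<in> U" using u AU by blast
      ultimately show ?thesis using u4 no4[of u] by (auto simp: i_def)
    next
      assume "2 \<le> card (P u)"
      then show ?thesis using large[OF Pu(1)] u4 by simp
    qed (use Pu AU in auto)
  qed
  \<comment> \<open>By \<open>other\<close> every neighbour of \<open>x\<close> in \<open>A\<close>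
    outside \<open>P v\<close> lies in \<open>Y\<close>. With the sizes of \<open>N\<close> and
    \<open>Y\<close> this says that \<open>m\<close> is at most \<open>card (N \<inter> P v)\<close>
    minus \<open>i (P v)\<close>, which leads to \<open>P v = {v}\<close> and then to
    \<open>m = 1\<close> and \<open>v \<in> N\<close>.\<close>
  have Ncard: "int (card N) \<le> int (card (N \<inter> P v)) + int (card Y) - i (P v)"
  proof -
    have "N \<subseteq> (N \<inter> P v) \<union> (Y - P v)" using other NA by blast
    then have "card N \<le> card ((N \<inter> P v) \<union> (Y - P v))" using finN Y(3) by (intro card_mono) auto
    also have "\<dots> \<le> card (N \<inter> P v) + card (Y - P v)" by (rule card_Un_le)
    finally have "int (card N) \<le> int (card (N \<inter> P v)) + int (card (Y - P v))" by simp
    moreover have "int (card (Y - P v)) = int (card Y) - i (P v)"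
      unfolding i_def using card_Diff_subset_Int[of Y "P v"] Y(3) card_mono[of Y "Y \<inter> P v"] by (simp add: of_nat_diff)
    ultimately show ?thesis by simp
  qed
  have "P v = {v}"
  proof (rule card_cases[of "P v"])
    fix w assume "P v = {w}"
    then show ?thesis using Pv(2) by simp
  next
    assume "2 \<le> card (P v)"
    note bg = big[OF this]
    have "\<not> i (P v) \<le> 2" using bg(2) eq(1) cPv by auto
    moreover have "2 * int (card (N \<inter> P v)) - i (P v) \<le> 1 + \<tau>" using bg(1) eq(1) cPv by simp
    ultimately show ?thesis using Ncard cardN cardY iN[of "P v"] m12 \<tau>12 by linarith
  qed (use Pv AU in auto)
  then have "i (P v) = 0" "N \<inter> P v = (if v \<in> N then {v} else {})" using YN by (auto simp: i_def)
  then have "m = 1 \<and> v \<in> N"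
    using Ncard cardN cardY m12 by (auto split: if_splits)
  then show "d U = d {v} + 2 \<and> \<mu> z x = 1 \<and> \<mu> v x = 1"
    using eq(2) D(4)[of v x] by (auto simp: m_def N_def)
qed

end

section \<open>The contradiction at the neighbours of the tip\<close>

context violation
begin

lemma d_U: "d U = (\<Sum>u\<in>U. \<mu> z u)"
  using cut_compl[of "{z}"] D(3) by (simp add: cut_single)

lemma singleton_complement:
  assumes "x \<in> U"
  shows "U - {x} \<subset> U" "U - {x} \<noteq> {}"
proof -
  show "U - {x} \<subset> U" using assms by blast
  show "U - {x} \<noteq> {}"
  proof
    assume "U - {x} = {}"
    then have "card U \<le> card {x}" by (intro card_mono) auto
    then show False using card2 by simp
  qed
qed

lemma neighbour_in_W:
  assumes v: "v \<notin> U" and x: "x \<in> U"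
  obtains y where "y \<in> U" "y \<noteq> x" "1 \<le> \<mu> x y"
proof -
  have "{x} \<subset> U" "{x} \<noteq> {}" using singleton_complement[OF x] x by blast+
  then show ?thesis using connected[of "{x}"] that by blast
qed

text \<open>With \<open>v\<close> outside \<open>U\<close> all of \<open>U\<close> is tight, and the
  sign spreads along the edges of the connected \<open>U\<close>. Each vertex has a neighbour there,
  which excludes the opposite sign.\<close>

lemma uniform_sign:
  assumes v: "v \<notin> U"
  obtains s where "s = 1 \<or> s = - 1" "\<And>u. u \<in> U \<Longrightarrow> good s u \<and> \<not> good (- s) u"
proof -
  have WU: "u \<in> W \<longleftrightarrow> u \<in> U" for u using v by blast
  define X where "X = {u \<in> U. good 1 u}"
  have "X = {} \<or> X = U"
  proof (rule ccontr)
    assume no: "\<not> ?thesis"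
    have "X \<subset> U" using no by (auto simp: X_def)
    then obtain a b where ab: "a \<in> X" "b \<in> U - X" "1 \<le> \<mu> a b"
      using connected[of X] no by blast
    then have "good 1 b" using good_adjacent(1)[of a b 1] WU by (auto simp: X_def)
    then show False using ab by (auto simp: X_def)
  qed
  then obtain s where s: "s = 1 \<or> s = - 1" "\<And>u. u \<in> U \<Longrightarrow> good s u"
  proof
    assume "X = {}"
    then have "good (- 1) u" if "u \<in> U" for u
      using good_exists[of u] WU that by (auto simp: X_def)
    then show thesis using that by blast
  next
    assume "X = U"
    then have "good 1 u" if "u \<in> U" for u using that by (auto simp: X_def)
    then show thesis using that by blast
  qed
  have "\<not> good (- s) u" if u: "u \<in> U" for u
  proof -
    obtain y where y: "y \<in> U" "y \<noteq> u" "1 \<le> \<mu> u y" by (rule neighbour_in_W[OF v u])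
    then have "1 \<le> \<mu> y u" using D(4)[of u y] by simp
    then show ?thesis using good_adjacent(2)[of y u s] y u s WU by blast
  qed
  then show ?thesis using that s by blast
qed

text \<open>Otherwise all tip edges have net value \<open>s\<close>, so the residue of the tip is
  that of its degree up to sign, and the violation leaves \<open>d U \<le> 5\<close>. Absorbing a
  neighbour of the tip gives \<open>6 \<le> d U\<close>; without neighbours, a tight vertex has the
  cut and residue of its complement in \<open>U\<close>, against \<open>sub_bound\<close>.\<close>

lemma v_in_U: "v \<in> U"
proof (rule ccontr)
  assume v: "v \<notin> U"
  have WU: "u \<in> W \<longleftrightarrow> u \<in> U" for u using v by blast
  obtain s where s: "s = 1 \<or> s = - 1" and g: "\<And>u. u \<in> U \<Longrightarrow> good s u \<and> \<not> good (- s) u"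
    using uniform_sign[OF v] by blast
  have tU: "6 dvd sum t U + t z" using D(7) sum.remove[OF D(2,3), of t] by (simp add: add.commute)
  have "6 dvd s * d U - t z"
  proof -
    have "sum \<psi> U = (\<Sum>u\<in>U. s * \<mu> z u)"
      by (rule sum.cong[OF refl], rule good_tip) (use WU g s in blast)+
    then have "sum \<psi> U = s * d U" by (simp add: d_U sum_distrib_left)
    then show ?thesis using pre unfolding preflow_def by simp
  qed
  then have "6 dvd (s * d U - t z) + (sum t U + t z)" using tU by (rule dvd_add)
  then have "dist6 (sum t U) = dist6 (- (s * d U))" by (intro dist6_cong) (simp add: add.commute)
  also have "\<dots> = dist6 (d U)" using s by (auto simp: dist6_minus)
  finally have "d U \<le> 4 + dist6 (d U)" using viol v by auto
  then have k5: "d U \<le> 5" using dist6_le[of "d U" 1] dist6_bounds(2)[of "d U"] by linarith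
  have no2: False if x: "x \<in> U" and c: "\<not> 2 \<le> card (U - {x})" for x
  proof -
    have "U - {x} \<noteq> {}" by (rule singleton_complement(2)[OF x])
    then obtain y where y: "U - {x} = {y}"
      using card_cases[of "U - {x}"] c by blast
    have yU: "y \<in> U" "x \<noteq> y" using y by auto
    have "d (U - {x}) = d U + d {x} - 2 * \<mu> z x" "d {x} = \<mu> z x + (\<Sum>y\<in>U - {x}. \<mu> x y)"
      by (rule degree_split[OF x])+
    then have "d {y} = d U + d {x} - 2 * \<mu> z x" "d {x} = \<mu> z x + \<mu> x y" unfolding y by auto
    then show False using edge_le_1[OF x yU] five[OF x] five[OF yU(1)] k5 by linarith
  qed
  have "U \<noteq> {}" using W_nonempty by blast
  show False
  proof (cases "\<exists>x\<in>U. 1 \<le> \<mu> z x")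
    case False
    then have "\<mu> z u = 0" if "u \<in> U" for u using that D(5)[of z u] by force
    then have "d U = 0" by (simp add: d_U)
    obtain x where x: "x \<in> U" using \<open>U \<noteq> {}\<close> by blast
    have eq: "d (U - {x}) = d {x}" using degree_split(2)[OF x] \<open>d U = 0\<close> \<open>\<And>u. u \<in> U \<Longrightarrow> \<mu> z u = 0\<close>[OF x] by simp
    have "6 dvd sum t U"
      using tU \<open>6 dvd s * d U - t z\<close> \<open>d U = 0\<close> by (simp add: dvd_add_left_iff)
    then have "6 dvd sum t (U - {x}) - (- t x)" using degree_split(3)[OF x] by simp
    then have "dist6 (sum t (U - {x})) = dist6 (t x)" using dist6_cong dist6_minus by metis
    moreover have "6 + dist6 (sum t (U - {x})) \<le> d (U - {x})"
      by (rule sub_bound(1)[OF singleton_complement(1)[OF x]]) (use no2[OF x] in blast)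
    ultimately show False using eq tight(1)[of x] WU x by auto
  next
    case True
    then obtain x where x: "x \<in> U" "1 \<le> \<mu> z x" by blast
    have dx: "d {x} = 4 + dist6 (t x)" using tight(1)[of x] WU x by auto
    have "8 \<le> d (U - {x})"
      by (rule sub8[OF singleton_complement(1)[OF x(1)]]) (use no2[OF x(1)] in blast)
    then have "\<mu> z x \<le> 2"
      using degree_split(2)[OF x(1)] dx dist6_bounds(2)[of "t x"] k5 by linarith
    then have "6 \<le> d U" using absorb(1)[of x s] WU x s g by blast
    then show False using k5 by simp
  qed
qed

text \<open>By \<open>absorb\<close> each neighbour of the tip in \<open>W\<close> has one edge to
  the tip and one to \<open>v\<close>, so \<open>W\<close> contributes at most as much to
  \<open>d U\<close> as to \<open>d {v}\<close>, against \<open>d U = d {v} + 2\<close>. Hence all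
  tip edges end in \<open>v\<close>. Tameness of \<open>W\<close> then makes the degree of
  \<open>v\<close> so large that one of them can be deleted.\<close>

lemma impossible: False
proof -
  note v = v_in_U
  have le: "d U \<le> d {v} + 2" and six: "6 \<le> d U" using viol v by auto
  have dv: "d {v} = \<mu> z v + (\<Sum>w\<in>W. \<mu> v w)" by (rule degree_split(1)[OF v])
  have dU: "d U = \<mu> z v + (\<Sum>w\<in>W. \<mu> z w)"
    unfolding d_U using sum.remove[of U v "\<mu> z"] v D(2) by simp
  have key: "d U = d {v} + 2 \<and> \<mu> z x = 1 \<and> \<mu> v x = 1" if x: "x \<in> W" "1 \<le> \<mu> z x" for x
  proof -
    have xU: "x \<in> U" "x \<noteq> v" using x by auto
    obtain s where s: "s = 1 \<or> s = - 1" "good s x" by (rule good_exists[OF x(1)])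
    have ng: "\<not> good (- s) x"
    proof
      assume "good (- s) x"
      then have "\<psi> x = - s * \<mu> z x" using good_tip[OF x(1), of "- s"] s by auto
      then show False using good_tip[OF x(1) s] x(2) s(1) by auto
    qed
    have "\<mu> z x \<le> 2"
    proof -
      have "d {v} + 3 \<le> d (U - {x})"
      proof (rule sub3[OF singleton_complement(1)[OF xU(1)]])
        show "2 \<le> card (U - {x})"
        proof (rule ccontr)
          assume "\<not> ?thesis"
          moreover have "v \<in> U - {x}" using v xU by auto
          ultimately have "U - {x} = {v}" using card_cases[of "U - {x}"] by (metis Diff_subset empty_iff singletonD)
          then have "W \<subseteq> {x}" by blast
          then show False by (rule two_vertices[OF v])
        qed
      qed (use v xU in auto)
      then show ?thesis
        using degree_split(2)[OF xU(1)] tight(1)[OF x(1)] one_sided(2)[OF x(1) s ng] le by linarith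
    qed
    then show ?thesis using absorb(2)[OF x(1) s ng x(2)] v by blast
  qed
  have "(\<Sum>w\<in>W. \<mu> z w) \<le> (\<Sum>w\<in>W. \<mu> v w)"
  proof (rule sum_mono)
    fix w assume w: "w \<in> W"
    show "\<mu> z w \<le> \<mu> v w"
      using key[OF w] D(5)[of v w] by (cases "1 \<le> \<mu> z w") auto
  qed
  then have "d U \<le> d {v}" using dU dv by simp
  then have "\<mu> z w = 0" if "w \<in> W" for w
    using key[OF that] D(5)[of z w] by force
  then have m: "d U = \<mu> z v" using dU by simp
  have "4 + dist6 (sum t (U - {v})) \<le> d (U - {v})" by (rule tame_proper[OF singleton_complement[OF v]])
  then have big: "d U + 4 \<le> d {v}"
    using degree_split(2)[OF v] m dist6_bounds(1)[of "sum t (U - {v})"] by linarith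
  have "\<psi> v \<in> netset ((\<mu> z v - 1) + 1)" using pre v unfolding preflow_def by simp
  then obtain s where s: "s = 1 \<or> s = - 1" "\<psi> v - s \<in> netset (\<mu> z v - 1)"
    by (rule netset_step) (use m six in simp)
  then have "- s = 1 \<or> - s = - 1" "\<psi> v + - s \<in> netset (\<mu> z v - 1)" by auto
  from no_spare_tip_edge[OF v this] show False
    using big six dist6_bounds(2)[of "t v - - s"] by linarith
qed

end

section \<open>Closing the induction\<close>

lemma (in critical_step) tip_bound_step: "tip_bound V z \<mu> t"
proof (cases "\<exists>x\<in>U. d {x} = 4")
  case True
  then show ?thesis using tip_bound_if_degree_4 by blast
next
  case False
  then have no4: "\<And>u. u \<in> U \<Longrightarrow> d {u} \<noteq> 4" by blast
  obtain \<psi> where \<psi>: "preflow V z \<mu> t \<psi>" "\<not> extendable V z \<mu> t \<psi>" by (rule nonextendable_preflow)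
  have a: "6 + dist6 (sum t U) \<le> d U"
  proof (rule ccontr)
    assume "\<not> ?thesis"
    moreover have "even (sum t U + d U)" by (rule inst_parity[OF I]) auto
    then have "even (d U - dist6 (sum t U))" using dist6_even[of "sum t U"] by auto
    then obtain k where k: "d U - dist6 (sum t U) = 2 * k" by (elim evenE)
    ultimately have "k \<le> 2" by linarith
    then have "d U \<le> 4 + dist6 (sum t U)" using k by linarith
    \<comment> \<open>The tip itself serves as the \<open>v\<close> outside
      \<open>U\<close>.\<close>
    then interpret violation V z \<mu> t \<psi> z
      by unfold_locales (use no4 \<psi> in auto)
    show False by (rule impossible)
  qed
  \<comment> \<open>The 3 makes the equality clause vacuous, as it must be: there is a second
    non-tip vertex, and its degree is not 4.\<close>
  have "d {v} + 3 \<le> d U" if v: "v \<in> U" for v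
  proof (rule ccontr)
    assume "\<not> ?thesis"
    then have "d U \<le> d {v} + 2" by simp
    moreover have "6 \<le> d U" using a dist6_bounds(1)[of "sum t U"] by linarith
    ultimately interpret violation V z \<mu> t \<psi> v
      by unfold_locales (use no4 \<psi> v in auto)
    show False by (rule impossible)
  qed
  then show ?thesis unfolding tip_bound_def using a by fastforce
qed

theorem critical_tip_bound:
  assumes "inst V z \<mu> t" "critical V z \<mu> t"
    and "\<And>v. v \<in> V - {z} \<Longrightarrow> 4 + dist6 (t v) \<le> cut V \<mu> {v}" and "2 \<le> card (V - {z})"
  shows "tip_bound V z \<mu> t"
  using assms
proof (induction "nat (weight V z \<mu>)" arbitrary: V \<mu> t rule: less_induct)
  case less
  have w: "0 \<le> weight V' z \<mu>'" if "inst V' z \<mu>' t'" for V' \<mu>' t'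
    unfolding weight_def
    by (intro sum_nonneg) (use multigraph.cut_nonneg[OF instD(1)[OF that]] in \<open>simp add: add_nonneg_nonneg\<close>)
  interpret critical_step V z \<mu> t
  proof
    fix V' \<mu>' t'
    assume "weight V' z \<mu>' < weight V z \<mu>" and *: "inst V' z \<mu>' t'" "critical V' z \<mu>' t'"
      "\<And>v. v \<in> V' - {z} \<Longrightarrow> 4 + dist6 (t' v) \<le> cut V' \<mu>' {v}" "2 \<le> card (V' - {z})"
    then have "nat (weight V' z \<mu>') < nat (weight V z \<mu>)" using w[OF *(1)] by simp
    then show "tip_bound V' z \<mu>' t'" by (rule less.hyps) (use * in blast)+
  qed (use less.prems in blast)+
  show ?case by (rule tip_bound_step)
qed

section \<open>Bordered graphs\<close>

lemma of_int_mod3_eq_0: "(of_int a :: 3) = 0 \<longleftrightarrow> 3 dvd a"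
proof -
  have three: "(of_int 3 :: 3) = 0" by simp
  have "(of_int a :: 3) = of_int (3 * (a div 3) + a mod 3)" by simp
  also have "\<dots> = of_int (a mod 3)" unfolding of_int_add of_int_mult three by simp
  finally have eq: "(of_int a :: 3) = of_int (a mod 3)" .
  have "a mod 3 = 0 \<or> a mod 3 = 1 \<or> a mod 3 = 2" by presburger
  moreover have "(1 :: 3) \<noteq> 0" "(2 :: 3) \<noteq> 0" by simp_all
  ultimately show ?thesis unfolding eq by (auto simp: dvd_eq_mod_eq_0)
qed

lemma of_int_mod3_surj: "\<exists>n. of_int n = (x :: 3)"
  by (cases x) blast

definition mult :: "('v, 'e, 'x) graph_scheme \<Rightarrow> 'v \<Rightarrow> 'v \<Rightarrow> int" where
  "mult G a b = int (card {e \<in> edges G. ends G e = {a, b}})"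

definition bd_int :: "('v, 'e) bordered_graph \<Rightarrow> 'v \<Rightarrow> int" where
  "bd_int G v = (SOME n. of_int n = bd G v)"

text \<open>By the Chinese remainder theorem: the boundary modulo 3 and the degree modulo 2.\<close>

definition req :: "('v, 'e) bordered_graph \<Rightarrow> 'v \<Rightarrow> int" where
  "req G v = 3 * int (degree G v) + 4 * bd_int G v"

definition net :: "('v, 'e, 'x) graph_scheme \<Rightarrow> ('e \<Rightarrow> 'v) \<Rightarrow> 'v \<Rightarrow> 'v \<Rightarrow> int" where
  "net G \<phi> a b = int (card {e \<in> edges G. ends G e = {a, b} \<and> \<phi> e = a}) -
     int (card {e \<in> edges G. ends G e = {a, b} \<and> \<phi> e = b})"

lemma of_int_bd_int: "of_int (bd_int G v) = bd G v"
  unfolding bd_int_def by (rule someI_ex) (rule of_int_mod3_surj)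

text \<open>The four cases of the definition are the residues 0, 2 or -2, 3, and 1 or -1 modulo
  6.\<close>

lemma abs_tau_dist6: "int (abs_tau G v) = dist6 (req G v)"
proof -
  define b where "b = bd_int G v"
  have "of_int b = bd G v" unfolding b_def by (rule of_int_bd_int)
  then have bd0: "bd G v = 0 \<longleftrightarrow> b mod 3 = 0"
    using of_int_mod3_eq_0[of b] by auto
  define q where "q = b div 3"
  have b: "b = 3 * q + b mod 3" by (simp add: q_def)
  have r: "b mod 3 = 0 \<or> b mod 3 = 1 \<or> b mod 3 = 2" by presburger
  have val: "dist6 (req G v) = \<bar>c\<bar>" if "6 dvd req G v - c" "\<bar>c\<bar> \<le> 3" for c
    using dist6_cong[OF that(1)] dist6_small[OF that(2)] by simp
  obtain k where k: "int (degree G v) = 2 * k \<or> int (degree G v) = 2 * k + 1"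
    by (metis evenE oddE)
  have ev: "even (degree G v) \<longleftrightarrow> int (degree G v) = 2 * k"
    using k by (metis dvd_triv_left even_of_nat odd_two_times_div_two_succ even_add even_plus_one_iff odd_one)
  have req: "req G v = 3 * int (degree G v) + 12 * q + 4 * (b mod 3)"
    unfolding req_def b_def[symmetric] by (subst b) simp
  show ?thesis
  proof (cases "even (degree G v)")
    case True
    then have dk: "int (degree G v) = 2 * k" using ev by simp
    define c where "c = (if b mod 3 = 0 then 0 else if b mod 3 = 1 then -2 else 2 :: int)"
    have "req G v - c = 6 * (k + 2 * q + (if b mod 3 = 0 then 0 else 1))"
      unfolding req dk c_def using r by auto
    then have "dist6 (req G v) = \<bar>c\<bar>" by (intro val) (auto simp: c_def)
    then show ?thesis using True bd0 by (simp add: abs_tau_def c_def)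
  next
    case False
    then have dk: "int (degree G v) = 2 * k + 1" using ev k by simp
    define c where "c = (if b mod 3 = 0 then 3 else if b mod 3 = 1 then 1 else -1 :: int)"
    have "req G v - c = 6 * (k + 2 * q + (if b mod 3 = 0 then 0 else if b mod 3 = 1 then 1 else 2))"
      unfolding req dk c_def using r by auto
    then have "dist6 (req G v) = \<bar>c\<bar>" by (intro val) (auto simp: c_def)
    then show ?thesis using False bd0 by (simp add: abs_tau_def c_def)
  qed
qed

lemma sum_boundary:
  assumes fin: "finite (verts G)" and bd: "is_boundary G \<beta>"
  shows "(\<Sum>v\<in>verts G. \<beta> v) = 0"
proof -
  define R where "R = {(u, v). u \<in> verts G \<and> v \<in> verts G \<and> (u, v) \<in> (adjacency G)\<^sup>*}"
  have "sym (adjacency G)" by (auto simp: sym_def adjacency_def insert_commute)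
  then have s: "sym ((adjacency G)\<^sup>*)" by (rule sym_rtrancl)
  have R: "equiv (verts G) R"
  proof (rule equivI)
    show "R \<subseteq> verts G \<times> verts G" by (auto simp: R_def)
    show "refl_on (verts G) R" by (auto simp: refl_on_def R_def)
    show "sym R" using s by (auto simp: sym_def R_def)
    show "trans R" by (auto simp: trans_def R_def)
  qed
  have comp: "components G = verts G // R" by (simp add: components_def R_def)
  have un: "\<Union> (verts G // R) = verts G" by (rule Union_quotient[OF R])
  have finC: "\<forall>C\<in>verts G // R. finite C" using un fin by (metis Union_upper finite_subset)
  have "sum \<beta> (\<Union> (verts G // R)) = (\<Sum>C\<in>verts G // R. sum \<beta> C)"
    using sum.Union_disjoint[OF finC] quotient_disj[OF R] by (simp add: comp_def) blast
  then show ?thesis using bd comp un by (simp add: is_boundary_def)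
qed

section \<open>Orientations of a graph as net flows\<close>

locale finite_multigraph =
  fixes G :: "('v, 'e) bordered_graph"
  assumes graph: "is_graph G"
begin

lemma fin: "finite (verts G)" "finite (edges G)"
  using graph by (auto simp: is_graph_def)

lemma ends: "e \<in> edges G \<Longrightarrow> ends G e \<subseteq> verts G" "e \<in> edges G \<Longrightarrow> card (ends G e) = 2"
  using graph by (auto simp: is_graph_def)

lemma other_end:
  assumes "e \<in> edges G" "v \<in> ends G e"
  obtains w where "w \<in> verts G" "w \<noteq> v" "ends G e = {v, w}"
proof -
  obtain a b where "ends G e = {a, b}" "a \<noteq> b" using ends(2)[OF assms(1)] by (auto simp: card_2_iff)
  then show ?thesis using that[of a] that[of b] ends(1)[OF assms(1)] assms(2) by auto
qed

lemma no_loop: "e \<in> edges G \<Longrightarrow> ends G e \<noteq> {a}"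
  using ends(2) by fastforce

lemma mult_sym: "mult G a b = mult G b a"
  by (simp add: mult_def insert_commute)

lemma no_loop_set: "{e \<in> edges G. ends G e = {a, a} \<and> Q e} = {}"
  using no_loop by auto

lemma mult_diag: "mult G a a = 0"
proof -
  have "{e \<in> edges G. ends G e = {a, a}} = {}" using no_loop by auto
  then show ?thesis unfolding mult_def by (simp only: card.empty of_nat_0)
qed

lemma net_anti: "net G \<phi> a b = - net G \<phi> b a"
  by (simp add: net_def insert_commute)

lemma card_edges_at:
  assumes v: "v \<in> verts G"
  shows "int (card {e \<in> edges_at G v. Q e}) = (\<Sum>w\<in>verts G. int (card {e \<in> edges G. ends G e = {v, w} \<and> Q e}))"
proof -
  have "{e \<in> edges_at G v. Q e} = (\<Union>w\<in>verts G. {e \<in> edges G. ends G e = {v, w} \<and> Q e})"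
  proof (intro equalityI subsetI)
    fix e assume e: "e \<in> {e \<in> edges_at G v. Q e}"
    then obtain w where "w \<in> verts G" "ends G e = {v, w}"
      using other_end[of e v] by (auto simp: edges_at_def)
    then show "e \<in> (\<Union>w\<in>verts G. {e \<in> edges G. ends G e = {v, w} \<and> Q e})"
      using e by (auto simp: edges_at_def)
  qed (auto simp: edges_at_def)
  moreover have "card (\<Union>w\<in>verts G. {e \<in> edges G. ends G e = {v, w} \<and> Q e}) =
      (\<Sum>w\<in>verts G. card {e \<in> edges G. ends G e = {v, w} \<and> Q e})"
    by (rule card_UN_disjoint) (use fin in \<open>auto simp: doubleton_eq_iff\<close>)
  ultimately show ?thesis by simp
qed

lemma degree_sum: "v \<in> verts G \<Longrightarrow> int (degree G v) = (\<Sum>w\<in>verts G. mult G v w)"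
  using card_edges_at[of v "\<lambda>_. True"] by (simp add: degree_def mult_def)

lemma net_sum:
  assumes v: "v \<in> verts G" and \<phi>: "\<And>e. e \<in> edges_at G v \<Longrightarrow> \<phi> e \<in> ends G e"
  shows "int (out_degree G \<phi> v) - int (in_degree G \<phi> v) = (\<Sum>w\<in>verts G. net G \<phi> v w)"
proof -
  have "int (card {e \<in> edges G. ends G e = {v, w} \<and> \<phi> e = v}) -
      int (card {e \<in> edges G. ends G e = {v, w} \<and> \<phi> e \<noteq> v}) = net G \<phi> v w" for w
  proof (cases "w = v")
    case True
    then show ?thesis by (simp only: net_def no_loop_set)
  next
    case False
    then have "{e \<in> edges G. ends G e = {v, w} \<and> \<phi> e \<noteq> v} = {e \<in> edges G. ends G e = {v, w} \<and> \<phi> e = w}"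
      using \<phi> by (auto simp: edges_at_def)
    then show ?thesis by (simp only: net_def)
  qed
  then show ?thesis
    unfolding out_degree_def in_degree_def card_edges_at[OF v] sum_subtractf[symmetric] by simp
qed

text \<open>The parity half of the condition modulo 6 always holds, since net outflow and degree
  have the same parity. What remains is the boundary modulo 3, where the factor 4 in
  \<open>req\<close> acts as 1.\<close>

lemma satisfies_iff:
  assumes v: "v \<in> verts G" and \<phi>: "\<And>e. e \<in> edges_at G v \<Longrightarrow> \<phi> e \<in> ends G e"
  shows "satisfies_boundary_at G \<phi> v \<longleftrightarrow> 6 dvd (\<Sum>w\<in>verts G. net G \<phi> v w) - req G v"
proof -
  define n where "n = (\<Sum>w\<in>verts G. net G \<phi> v w)"
  have n: "int (out_degree G \<phi> v) - int (in_degree G \<phi> v) = n" using net_sum[OF assms] by (simp add: n_def)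
  have "finite (edges_at G v)" using fin by (simp add: edges_at_def)
  then have "out_degree G \<phi> v + in_degree G \<phi> v = degree G v"
    unfolding out_degree_def in_degree_def degree_def
    by (subst card_Un_disjoint[symmetric]) (auto intro!: arg_cong[of _ _ card])
  then have "int (degree G v) = n + 2 * int (in_degree G \<phi> v)" using n by linarith
  then have req: "n - req G v = 4 * (n - bd_int G v) - 6 * (n + int (in_degree G \<phi> v))"
    by (simp add: req_def)
  have "satisfies_boundary_at G \<phi> v \<longleftrightarrow> (of_int n :: 3) = of_int (bd_int G v)"
    by (simp add: satisfies_boundary_at_def n[symmetric] of_int_bd_int)
  also have "\<dots> \<longleftrightarrow> 3 dvd n - bd_int G v"
    using of_int_mod3_eq_0[of "n - bd_int G v"] by simp
  also have "\<dots> \<longleftrightarrow> 6 dvd n - req G v"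
    unfolding req by presburger
  finally show ?thesis by (simp add: n_def)
qed

lemma multigraph: "multigraph (verts G) (mult G)"
  by unfold_locales (use fin mult_sym in \<open>auto simp: mult_def\<close>)

lemma cut_degree: "v \<in> verts G \<Longrightarrow> cut (verts G) (mult G) {v} = int (degree G v)"
  using fin by (simp add: degree_sum cut_def sum.remove[of "verts G" v] mult_diag)

lemma inst:
  assumes bd: "is_boundary G (bd G)" and z: "z \<in> verts G"
  shows "inst (verts G) z (mult G) (req G)"
proof -
  have "(\<Sum>v\<in>verts G. cut (verts G) (mult G) {v}) = (\<Sum>v\<in>verts G. int (degree G v))"
    by (rule sum.cong[OF refl]) (rule cut_degree)
  moreover have "cut (verts G) (mult G) (verts G) = 0" by (simp add: cut_def)
  ultimately have "even (\<Sum>v\<in>verts G. int (degree G v))"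
    using multigraph.cut_sum_singles(2)[OF multigraph, of "verts G"] by simp
  then obtain k where k: "(\<Sum>v\<in>verts G. int (degree G v)) = 2 * k" by (elim evenE)
  have "of_int (\<Sum>v\<in>verts G. bd_int G v) = (0 :: 3)"
    using sum_boundary[OF fin(1) bd] by (simp add: of_int_bd_int)
  then obtain l where l: "(\<Sum>v\<in>verts G. bd_int G v) = 3 * l" using of_int_mod3_eq_0 by blast
  have "sum (req G) (verts G) = 6 * (k + 2 * l)"
    unfolding req_def sum.distrib sum_distrib_left[symmetric] k l by simp
  then have "6 dvd sum (req G) (verts G)" by simp
  moreover have "even (req G v + cut (verts G) (mult G) {v})" if "v \<in> verts G" for v
    using that by (simp add: cut_degree req_def)
  ultimately show ?thesis unfolding inst_def using multigraph z by blast
qed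

lemma net_netset:
  assumes "a \<noteq> b" "\<And>e. e \<in> edges G \<Longrightarrow> ends G e = {a, b} \<Longrightarrow> \<phi> e \<in> {a, b}"
  shows "net G \<phi> a b \<in> netset (mult G a b)"
proof -
  let ?S = "{e \<in> edges G. ends G e = {a, b}}"
  let ?Sa = "{e \<in> edges G. ends G e = {a, b} \<and> \<phi> e = a}" and ?Sb = "{e \<in> edges G. ends G e = {a, b} \<and> \<phi> e = b}"
  have "?S = ?Sa \<union> ?Sb" "?Sa \<inter> ?Sb = {}" using assms by auto
  then have "card ?S = card ?Sa + card ?Sb" using fin by (simp add: card_Un_disjoint)
  then show ?thesis unfolding net_def mult_def netset_def by auto
qed

lemma orient_parallel:
  assumes ab: "a \<noteq> b" and s: "s \<in> netset (mult G a b)"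
  obtains \<phi> where "\<And>e. \<phi> e \<in> {a, b}" "net G \<phi> a b = s"
proof -
  let ?S = "{e \<in> edges G. ends G e = {a, b}}"
  have finS: "finite ?S" using fin by simp
  have "even (mult G a b - s)" using s by (simp add: netset_def)
  then obtain k where k: "mult G a b - s = 2 * k" by (elim evenE)
  have "0 \<le> mult G a b - k" "mult G a b - k \<le> int (card ?S)" using s k by (auto simp: netset_def mult_def)
  then have "nat (mult G a b - k) \<le> card ?S" by simp
  then obtain T where T: "T \<subseteq> ?S" "card T = nat (mult G a b - k)"
    by (rule obtain_subset_with_card_n)
  define \<phi> where "\<phi> e = (if e \<in> T then a else b)" for e
  have "{e \<in> edges G. ends G e = {a, b} \<and> \<phi> e = a} = T" "{e \<in> edges G. ends G e = {a, b} \<and> \<phi> e = b} = ?S - T"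
    using T(1) ab by (auto simp: \<phi>_def)
  moreover have "int (card (?S - T)) = int (card ?S) - int (card T)"
    using T(1) finS by (simp add: card_Diff_subset finite_subset card_mono of_nat_diff)
  ultimately have "net G \<phi> a b = 2 * int (card T) - mult G a b" by (simp add: net_def mult_def)
  also have "\<dots> = s" using T(2) \<open>0 \<le> mult G a b - k\<close> k by simp
  finally show ?thesis using that[of \<phi>] by (auto simp: \<phi>_def)
qed

lemma net_cong:
  assumes "\<And>e. e \<in> edges G \<Longrightarrow> ends G e = {a, b} \<Longrightarrow> \<phi> e = \<phi>' e"
  shows "net G \<phi> a b = net G \<phi>' a b"
proof -
  have "{e \<in> edges G. ends G e = {a, b} \<and> \<phi> e = c} = {e \<in> edges G. ends G e = {a, b} \<and> \<phi>' e = c}" for c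
    using assms by auto
  then show ?thesis by (simp add: net_def)
qed

text \<open>Use the partition into \<open>A\<close> and singletons. A preflow that extends to its
  contraction but not to \<open>G\<close> comes with a flow on all edges not inside
  \<open>A\<close>. On the edges between \<open>A\<close> and the rest this is a preflow of the
  instance on \<open>A\<close>, and extending it there would extend the original one in
  \<open>G\<close>.\<close>

lemma critical_of_flow_critical:
  assumes fc: "flow_critical G z" and z: "z \<in> verts G"
  shows "critical (verts G) z (mult G) (req G)"
  unfolding critical_def
proof (intro allI impI)
  fix A assume "A \<subseteq> verts G - {z} \<and> 2 \<le> card A"
  then have A: "A \<subseteq> verts G - {z}" "2 \<le> card A" by auto
  let ?V = "verts G"
  let ?m = "quot_mult ?V (onto_tip z A) (mult G)" and ?t = "quot_sum ?V (onto_tip z A) (req G)"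
  have zA: "z \<notin> A" "z \<in> ?V - A" using A z by auto
  have finA: "finite A" "finite (?V - A)" using A fin finite_subset[of A ?V] by auto
  note q = quot_onto_tip[OF A(1) z]
  define P where "P = insert A ((\<lambda>w. {w}) ` (?V - A))"
  have "A \<noteq> {}" using A(2) by auto
  have part: "partition_on ?V P"
    by (rule partition_onI) (use A \<open>A \<noteq> {}\<close> in \<open>auto simp: P_def disjnt_def\<close>)
  have "nontrivial_partition P" "tip_respecting z P"
    using A zA by (auto simp: P_def nontrivial_partition_def tip_respecting_def)
  then obtain \<psi> where \<psi>: "tip_preflow G z \<psi>" "extends (contract G P) {z} (contract_orientation P \<psi>)"
    and ne: "\<not> extends G z \<psi>"
    using fc part unfolding flow_critical_def by blast
  then obtain \<phi> where \<phi>: "nowhere_zero_flow (contract G P) \<phi>"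
    and \<phi>z: "\<And>e. e \<in> edges_at (contract G P) {z} \<Longrightarrow> \<phi> e = part_of P (\<psi> e)"
    unfolding extends_def contract_orientation_def by blast
  have P_w: "X = {w}" if "X \<in> P" "w \<in> X" "w \<notin> A" for X w using that by (auto simp: P_def)
  have inside: "(\<exists>X\<in>P. ends G e \<subseteq> X) \<longleftrightarrow> ends G e \<subseteq> A" if e: "e \<in> edges G" for e
  proof
    assume "\<exists>X\<in>P. ends G e \<subseteq> X"
    then obtain X where X: "X \<in> P" "ends G e \<subseteq> X" by blast
    have "X \<noteq> {w}" for w using card_mono[of "{w}" "ends G e"] ends(2)[OF e] X(2) by auto
    then show "ends G e \<subseteq> A" using X by (auto simp: P_def)
  qed (auto simp: P_def)
  have \<phi>ends: "\<phi> e \<in> P" "\<phi> e \<inter> ends G e \<noteq> {}" if "e \<in> edges G" "\<not> ends G e \<subseteq> A" for e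
    using \<phi> inside[OF that(1)] that unfolding nowhere_zero_flow_def orientation_on_def contract_def by auto
  \<comment> \<open>The end of \<open>e\<close> in the part that is its tail. Inside
    \<open>A\<close> this is an arbitrary value, which \<open>\<Phi>\<close> replaces.\<close>
  define tl where "tl e = (SOME u. u \<in> \<phi> e \<inter> ends G e)" for e
  have tl: "tl e \<in> \<phi> e" "tl e \<in> ends G e" if "e \<in> edges G" "\<not> ends G e \<subseteq> A" for e
    using someI_ex[of "\<lambda>u. u \<in> \<phi> e \<inter> ends G e"] \<phi>ends(2)[OF that] unfolding tl_def by blast+
  have tl_w: "\<phi> e = {w} \<longleftrightarrow> tl e = w" if "e \<in> edges G" "\<not> ends G e \<subseteq> A" "w \<notin> A" for e w
    using tl(1)[OF that(1,2)] P_w[OF \<phi>ends(1)[OF that(1,2)]] that(3) by auto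
  have at_w: "edges_at (contract G P) {w} = edges_at G w" if "w \<in> ?V - A" for w
    using that inside by (auto simp: edges_at_def contract_def P_def)
  have outside: "\<not> ends G e \<subseteq> A" if "e \<in> edges_at G w" "w \<notin> A" for e w
    using that by (auto simp: edges_at_def)
  have tl_at: "tl e \<in> ends G e" if "e \<in> edges_at G w" "w \<notin> A" for e w
    using tl(2)[of e] outside[OF that] that by (auto simp: edges_at_def)
  have sat_w: "6 dvd (\<Sum>b\<in>?V. net G tl w b) - req G w" if w: "w \<in> ?V - A" for w
  proof -
    have eqs: "(\<phi> e = {w}) = (tl e = w)" if "e \<in> edges_at G w" for e
      using tl_w[of e w] outside[OF that] that w by (auto simp: edges_at_def)
    have "out_degree (contract G P) \<phi> {w} = out_degree G tl w"
      "in_degree (contract G P) \<phi> {w} = in_degree G tl w"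
      unfolding out_degree_def in_degree_def at_w[OF w] using eqs by (metis (mono_tags, lifting))+
    moreover have "satisfies_boundary_at (contract G P) \<phi> {w}"
      using \<phi> w unfolding nowhere_zero_flow_def by (auto simp: contract_def P_def)
    ultimately have "satisfies_boundary_at G tl w"
      by (simp add: satisfies_boundary_at_def contract_def)
    then show ?thesis using satisfies_iff[of w tl] w tl_at by auto
  qed
  have tl_z: "tl e = \<psi> e" if e: "e \<in> edges_at G z" for e
  proof -
    have eE: "e \<in> edges G" "\<not> ends G e \<subseteq> A" using e outside[OF e zA(1)] by (auto simp: edges_at_def)
    have \<psi>e: "\<psi> e \<in> ends G e" using \<psi>(1) e unfolding tip_preflow_def orientation_on_def by blast
    then have "\<psi> e \<in> ?V" using ends(1)[OF eE(1)] by blast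
    then have "\<exists>!X. X \<in> P \<and> \<psi> e \<in> X" using A by (auto simp: P_def)
    then have pe: "part_of P (\<psi> e) \<in> P" "\<psi> e \<in> part_of P (\<psi> e)"
      using theI'[of "\<lambda>X. X \<in> P \<and> \<psi> e \<in> X"] unfolding part_of_def by blast+
    have \<phi>e: "\<phi> e = part_of P (\<psi> e)" using \<phi>z[of e] e at_w[OF zA(2)] by simp
    obtain u where u: "ends G e = {z, u}" "u \<noteq> z" using other_end[of e z] e by (auto simp: edges_at_def)
    show ?thesis
    proof (cases "\<psi> e = z")
      case True
      then have "\<phi> e = {z}" using P_w[of "\<phi> e" z] pe \<phi>e zA by simp
      then show ?thesis using tl(1)[OF eE] True by simp
    next
      case False
      then have "\<psi> e = u" using \<psi>e u by simp
      then have "z \<notin> \<phi> e" using P_w[of "\<phi> e" z] pe \<phi>e zA False by auto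
      then show ?thesis using tl[OF eE] u \<open>\<psi> e = u\<close> by auto
    qed
  qed
  define \<psi>' where "\<psi>' a = (\<Sum>w\<in>?V - A. net G tl w a)" for a
  have pre: "preflow (insert z A) z ?m ?t \<psi>'"
  proof -
    have "\<psi>' a \<in> netset (?m z a)" if a: "a \<in> A" for a
      unfolding \<psi>'_def q(2)[OF a]
    proof (rule netset_sum)
      fix w assume w: "w \<in> ?V - A"
      show "net G tl w a \<in> netset (mult G w a)"
      proof (rule net_netset)
        show "w \<noteq> a" using a w by auto
        fix e assume "e \<in> edges G" "ends G e = {w, a}"
        then show "tl e \<in> {w, a}" using tl_at[of e w] w by (auto simp: edges_at_def)
      qed
    qed
    moreover have "6 dvd sum \<psi>' A - sum (req G) (?V - A)"
    proof -
      have "6 dvd (\<Sum>w\<in>?V - A. (\<Sum>b\<in>?V. net G tl w b) - req G w)" by (rule dvd_sum) (rule sat_w)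
      moreover have "(\<Sum>w\<in>?V - A. \<Sum>b\<in>?V. net G tl w b) = sum \<psi>' A"
      proof -
        have "(\<Sum>w\<in>?V - A. \<Sum>b\<in>?V - A. net G tl w b) = (\<Sum>b\<in>?V - A. \<Sum>w\<in>?V - A. net G tl w b)" by (rule sum.swap)
        also have "\<dots> = - (\<Sum>b\<in>?V - A. \<Sum>w\<in>?V - A. net G tl b w)"
          unfolding sum_negf[symmetric] by (intro sum.cong refl net_anti)
        finally have "(\<Sum>w\<in>?V - A. \<Sum>b\<in>?V - A. net G tl w b) = 0" by simp
        moreover have "(\<Sum>b\<in>?V. net G tl w b) = (\<Sum>b\<in>?V - A. net G tl w b) + (\<Sum>b\<in>A. net G tl w b)" for w
          using A fin by (intro sum.subset_diff) auto
        moreover have "(\<Sum>w\<in>?V - A. \<Sum>b\<in>A. net G tl w b) = sum \<psi>' A" unfolding \<psi>'_def by (rule sum.swap)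
        ultimately show ?thesis by (simp add: sum.distrib)
      qed
      ultimately show ?thesis by (simp add: sum_subtractf)
    qed
    moreover have "insert z A - {z} = A" using zA by auto
    ultimately show ?thesis unfolding preflow_def q(4) by simp
  qed
  moreover have "\<not> extendable (insert z A) z ?m ?t \<psi>'"
  proof
    assume "extendable (insert z A) z ?m ?t \<psi>'"
    then obtain f where f: "flow (insert z A) ?m ?t f" and fz: "\<And>a. a \<in> A \<Longrightarrow> f z a = \<psi>' a"
      using zA unfolding extendable_def by force
    note F = flowD[OF f]
    \<comment> \<open>The choice is made once for each unordered pair \<open>X\<close>, as an edge
      knows only its set of ends; the net values are then right for both orders.\<close>
    have "\<exists>\<omega>. (\<forall>e. \<omega> e \<in> X) \<and> (\<forall>a b. X = {a, b} \<longrightarrow> net G \<omega> a b = f a b)"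
      if X: "X \<subseteq> A" "card X = 2" for X
    proof -
      obtain a b where ab: "X = {a, b}" "a \<noteq> b" using X(2) by (auto simp: card_2_iff)
      then have abA: "a \<in> A" "b \<in> A" using X by auto
      have "f a b \<in> netset (mult G a b)" using F(2)[of a b] abA ab(2) by (simp add: q)
      then obtain \<omega> where \<omega>: "\<And>e. \<omega> e \<in> {a, b}" "net G \<omega> a b = f a b"
        using orient_parallel[OF ab(2)] by blast
      have "net G \<omega> b a = f b a" using \<omega>(2) net_anti[of \<omega> b a] F(1)[of b a] abA by simp
      then show ?thesis using \<omega> ab by (intro exI[of _ \<omega>]) (auto simp: doubleton_eq_iff)
    qed
    then obtain \<Omega> where \<Omega>: "\<And>X e. X \<subseteq> A \<Longrightarrow> card X = 2 \<Longrightarrow> \<Omega> X e \<in> X"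
      "\<And>a b. {a, b} \<subseteq> A \<Longrightarrow> card {a, b} = 2 \<Longrightarrow> net G (\<Omega> {a, b}) a b = f a b"
      by metis
    define \<Phi> where "\<Phi> e = (if ends G e \<subseteq> A then \<Omega> (ends G e) e else tl e)" for e
    have orient: "\<Phi> e \<in> ends G e" if "e \<in> edges G" for e
      using \<Omega>(1)[of "ends G e" e] ends(2)[OF that] tl(2)[OF that] by (auto simp: \<Phi>_def)
    have net_out: "net G \<Phi> a b = net G tl a b" if "\<not> {a, b} \<subseteq> A" for a b
      by (rule net_cong) (use that in \<open>auto simp: \<Phi>_def\<close>)
    have net_in: "net G \<Phi> a b = f a b" if "a \<in> A" "b \<in> A" for a b
    proof (cases "a = b")
      case True
      then show ?thesis using net_anti[of \<Phi> a a] F(1)[of a a] that by simp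
    next
      case False
      have "net G \<Phi> a b = net G (\<Omega> {a, b}) a b" by (rule net_cong) (use that in \<open>auto simp: \<Phi>_def\<close>)
      then show ?thesis using \<Omega>(2)[of a b] that False by simp
    qed
    have "6 dvd (\<Sum>b\<in>?V. net G \<Phi> v b) - req G v" if v: "v \<in> ?V" for v
    proof (cases "v \<in> A")
      case False
      then have "(\<Sum>b\<in>?V. net G \<Phi> v b) = (\<Sum>b\<in>?V. net G tl v b)" by (intro sum.cong refl net_out) auto
      then show ?thesis using sat_w[of v] v False by simp
    next
      case True
      have "(\<Sum>b\<in>?V. net G \<Phi> v b) = (\<Sum>b\<in>?V - A. net G \<Phi> v b) + (\<Sum>b\<in>A. net G \<Phi> v b)"
        using A fin by (intro sum.subset_diff) auto
      also have "(\<Sum>b\<in>?V - A. net G \<Phi> v b) = (\<Sum>b\<in>?V - A. - net G tl b v)"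
      proof (rule sum.cong[OF refl])
        fix b assume "b \<in> ?V - A"
        then show "net G \<Phi> v b = - net G tl b v" using net_out[of v b] net_anti[of tl v b] by auto
      qed
      also have "\<dots> = f v z" using F(1)[of v z] fz[OF True] True by (simp add: sum_negf \<psi>'_def)
      also have "(\<Sum>b\<in>A. net G \<Phi> v b) = (\<Sum>b\<in>A. f v b)" by (rule sum.cong) (use net_in True in auto)
      also have "f v z + (\<Sum>b\<in>A. f v b) = sum (f v) (insert z A)" using zA finA by simp
      finally show ?thesis using F(3)[of v] True by (simp add: q)
    qed
    then have "nowhere_zero_flow G \<Phi>"
      unfolding nowhere_zero_flow_def orientation_on_def
      using orient satisfies_iff[of _ \<Phi>] by (auto simp: edges_at_def)
    moreover have "\<Phi> e = \<psi> e" if "e \<in> edges_at G z" for e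
      using tl_z[OF that] outside[OF that zA(1)] by (simp add: \<Phi>_def)
    ultimately show False using ne unfolding extends_def by blast
  qed
  ultimately show "\<exists>\<psi>. preflow (insert z A) z ?m ?t \<psi> \<and> \<not> extendable (insert z A) z ?m ?t \<psi>" by blast
qed

end

section \<open>Reading off the census\<close>

theorem mainTheorem6:
  fixes G :: "('v, 'e) bordered_graph" and z :: 'v
  assumes "nontrivial_canvas G z"
    and "flow_critical G z"
    and "tame G z"
    and "degree G z \<ge> 7"
    and "\<exists>v \<in> verts G. degree G v = degree G z - 2"
  shows "census G z = {#degree G z - 2#}"
proof -
  have bg: "is_graph G" "is_boundary G (bd G)" and z: "z \<in> verts G" and c3: "3 \<le> card (verts G)"
    using assms(1) by (auto simp: nontrivial_canvas_def canvas_def is_bordered_graph_def)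
  interpret finite_multigraph G by unfold_locales (rule bg(1))
  have deg: "cut (verts G) (mult G) {v} = int (degree G v)" if "v \<in> verts G" for v
    by (rule cut_degree[OF that])
  have tb: "tip_bound (verts G) z (mult G) (req G)"
  proof (rule critical_tip_bound[OF inst[OF bg(2) z] critical_of_flow_critical[OF assms(2) z]])
    show "4 + dist6 (req G v) \<le> cut (verts G) (mult G) {v}" if "v \<in> verts G - {z}" for v
      using assms(3) that deg[of v] abs_tau_dist6[of G v] unfolding tame_def by force
    show "2 \<le> card (verts G - {z})" using c3 z fin by simp
  qed
  have dz: "cut (verts G) (mult G) (verts G - {z}) = int (degree G z)"
    using multigraph.cut_compl[OF multigraph, of "{z}"] z deg[OF z] by simp
  have four: "degree G u = 4"
    if "v \<in> verts G - {z}" "degree G v + 2 = degree G z" "u \<in> verts G - {z} - {v}" for u v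
  proof -
    have "cut (verts G) (mult G) {v} + 2 = cut (verts G) (mult G) (verts G - {z})"
      using that(1,2) deg[of v] dz by simp
    then have "cut (verts G) (mult G) {u} = 4"
      using tb that(1,3) unfolding tip_bound_def by blast
    then show ?thesis using that(3) deg[of u] by simp
  qed
  obtain v where v: "v \<in> verts G" "degree G v = degree G z - 2" using assms(5) by blast
  then have vz: "v \<noteq> z" using assms(4) by auto
  let ?M = "mset_set (verts G - {z} - {v})"
  have M: "mset_set (verts G - {z}) = add_mset v ?M"
    using v vz fin by (intro mset_set.remove) auto
  have "degree G u = 4" if "u \<in> verts G - {z} - {v}" for u
    by (rule four[OF _ _ that]) (use v vz assms(4) in auto)
  then have "filter_mset (\<lambda>d. d \<noteq> 4) (image_mset (degree G) ?M) = {#}"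
    using fin by auto
  moreover have "census G z = filter_mset (\<lambda>d. d \<noteq> 4) (image_mset (degree G) (add_mset v ?M))"
    by (simp only: census_def M)
  \<comment> \<open>Since the tip has degree at least 7, \<open>degree G z - 2\<close> is not 4, so
    the entry of \<open>v\<close> passes the filter.\<close>
  ultimately show ?thesis
    using v(2) assms(4) by simp
qed

end
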